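(* Let $D$ be any selfadjoint operator on $\mathcal{H}$ with eigenspaces $W_j^\uparrow$ and $W_j^\downarrow$, i.e. $$D|j\mu n\uparrow\rangle=d_j^\uparrow|j\mu n\uparrow\rangle,\qquad D|j\mu n\downarrow\rangle=d_j^\downarrow|j\mu n\downarrow\rangle .$$ If the eigenvalues are linear in $j$, that is, $d_j^\uparrow=c_1^\uparrow j+c_2^\uparrow$ and $d_j^\downarrow=c_1^\downarrow j+c_2^\downarrow$ with real constants $c_1^\uparrow,c_2^\uparrow,c_1^\downarrow,c_2^\downarrow$ independent of $j$, then $[D,\pi'(x)]$ is a bounded operator for all $x\in\mathcal{A}(SU_q(2))$.
   Context: Fix a real number $q$ with $0<q<1$ and put $[n]=\frac{q^n-q^{-n}}{q-q^{-1}}$. $\mathcal{A}=\mathcal{A}(SU_q(2))$ is the unital complex $*$-algebra generated by $a,b$ with relations $ba=qab$, $b^*a=qab^*$, $bb^*=b^*b$, $a^*a+q^2b^*b=1$, $aa^*+bb^*=1$. For any index $x$ write $x^\pm=x\pm\frac12$. Let $\mathcal{H}_\psi$ be the Hilbert space with orthonormal basis $|lmn\rangle$, $l=0,\frac12,1,\frac32,\dots$, $m,n\in\{-l,-l+1,\dots,l\}$. The (left regular) $*$-representation $\pi$ of $\mathcal{A}$ on $\mathcal{H}_\psi$ is $$\pi(a)|lmn\rangle=A^+_{lmn}|l^+m^+n^+\rangle+A^-_{lmn}|l^-m^+n^+\rangle,\quad \pi(b)|lmn\rangle=B^+_{lmn}|l^+m^+n^-\rangle+B^-_{lmn}|l^-m^+n^-\rangle,$$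 $$A^+_{lmn}=q^{(-2l+m+n-1)/2}\Big(\tfrac{[l+m+1][l+n+1]}{[2l+1][2l+2]}\Big)^{1/2},\quad A^-_{lmn}=q^{(2l+m+n+1)/2}\Big(\tfrac{[l-m][l-n]}{[2l][2l+1]}\Big)^{1/2},$$ $$B^+_{lmn}=q^{(m+n-1)/2}\Big(\tfrac{[l+m+1][l-n+1]}{[2l+1][2l+2]}\Big)^{1/2},\quad B^-_{lmn}=-q^{(m+n-1)/2}\Big(\tfrac{[l-m][l+n]}{[2l][2l+1]}\Big)^{1/2}$$ (terms with $l^-<0$ are absent). Let $\mathbb{C}^2$ have orthonormal basis $|\frac12,\pm\frac12\rangle$. The space of spinors is $\mathcal{H}=\mathcal{H}_\psi\otimes\mathbb{C}^2$, and $\pi'=\pi\otimes\mathrm{id}$. With $C_{j\mu}=q^{-(j+\mu)/2}\frac{[j-\mu]^{1/2}}{[2j]^{1/2}}$, $S_{j\mu}=q^{(j-\mu)/2}\frac{[j+\mu]^{1/2}}{[2j]^{1/2}}$, the orthonormal spinor basis of $\mathcal{H}$ is $$|j\mu n\downarrow\rangle=C_{j\mu}|j^-\mu^+n\rangle\otimes|\tfrac12,-\tfrac12\rangle+S_{j\mu}|j^-\mu^-n\rangle\otimes|\tfrac12,+\tfrac12\rangle$$ for $j=\frac12,1,\frac32,\dots$, $\mu=-j,\dots,j$, $n=-j^-,\dots,j^-$, and $$|j\mu n\uparrow\rangle=-S_{j+1,\mu}|j^+\mu^+n\rangle\otimes|\tfrac12,-\tfrac12\rangle+C_{j+1,\mu}|j^+\mu^-n\rangle\otimes|\tfrac12,+\tfrac12\rangle$$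 for $j=0,\frac12,1,\dots$, $\mu=-j,\dots,j$, $n=-j^+,\dots,j^+$ (vectors with out-of-range indices occur with coefficient $0$). $W_j^\uparrow$ (resp. $W_j^\downarrow$) is the span of the $|j\mu n\uparrow\rangle$ (resp. $|j\mu n\downarrow\rangle$) with $j$ fixed. "Bounded" means that the commutator, defined on the dense algebraic span of the spinor basis, extends to a bounded operator on $\mathcal{H}$. *)

theory Defs
  imports
    "HOL-Analysis.Analysis"
    "HOL-Algebra.Module"
    "HOL-Library.Function_Algebras"
begin

section \<open>The Hilbert spaces \<open>\<ell>\<^sup>2(I)\<close>\<close>

definition cscale :: "complex \<Rightarrow> ('i \<Rightarrow> complex) \<Rightarrow> ('i \<Rightarrow> complex)" where
  "cscale c f = (\<lambda>i. c * f i)"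

global_interpretation cfun: vector_space "cscale :: complex \<Rightarrow> ('i \<Rightarrow> complex) \<Rightarrow> _"
  defines csubspace = cfun.subspace and cspan = cfun.span
  by standard (auto simp: cscale_def fun_eq_iff algebra_simps)

text \<open>Vectors are functions on the whole index type that vanish outside the index set \<open>I\<close>.
  Operators are functions whose values matter only on the space (or domain) in question.\<close>

definition ell2 :: "'i set \<Rightarrow> ('i \<Rightarrow> complex) set" where
  "ell2 I = {f. (\<forall>i. i \<notin> I \<longrightarrow> f i = 0) \<and> (\<lambda>i. (cmod (f i))\<^sup>2) summable_on I}"

definition l2inner :: "'i set \<Rightarrow> ('i \<Rightarrow> complex) \<Rightarrow> ('i \<Rightarrow> complex) \<Rightarrow> complex" where
  "l2inner I f g = (\<Sum>\<^sub>\<infinity>i\<in>I. cnj (f i) * g i)"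

definition l2norm :: "'i set \<Rightarrow> ('i \<Rightarrow> complex) \<Rightarrow> real" where
  "l2norm I f = sqrt (\<Sum>\<^sub>\<infinity>i\<in>I. (cmod (f i))\<^sup>2)"

definition ket :: "'i \<Rightarrow> 'i \<Rightarrow> complex" where
  "ket i = (\<lambda>k. if k = i then 1 else 0)"

definition clinear_on ::
  "('i \<Rightarrow> complex) set \<Rightarrow> (('i \<Rightarrow> complex) \<Rightarrow> ('k \<Rightarrow> complex)) \<Rightarrow> bool" where
  "clinear_on V T \<longleftrightarrow>
     (\<forall>f\<in>V. \<forall>g\<in>V. T (f + g) = T f + T g) \<and> (\<forall>c. \<forall>f\<in>V. T (cscale c f) = cscale c (T f))"

definition bounded_op :: "'i set \<Rightarrow> (('i \<Rightarrow> complex) \<Rightarrow> ('i \<Rightarrow> complex)) \<Rightarrow> bool" where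
  "bounded_op I T \<longleftrightarrow>
     T \<in> ell2 I \<rightarrow> ell2 I \<and> clinear_on (ell2 I) T \<and>
     (\<exists>K. \<forall>f\<in>ell2 I. l2norm I (T f) \<le> K * l2norm I f)"

text \<open>A possibly unbounded, densely defined operator \<open>D\<close> with domain \<open>domD\<close>. The last conjunct
  says that the graph of the adjoint is the graph of \<open>D\<close>, including equality of the domains.\<close>

definition selfadjoint ::
  "'i set \<Rightarrow> ('i \<Rightarrow> complex) set \<Rightarrow> (('i \<Rightarrow> complex) \<Rightarrow> ('i \<Rightarrow> complex)) \<Rightarrow> bool" where
  "selfadjoint I domD D \<longleftrightarrow>
     csubspace domD \<and> domD \<subseteq> ell2 I \<and>
     (\<forall>f\<in>ell2 I. \<forall>e>0. \<exists>g\<in>domD. l2norm I (f - g) < e) \<and>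
     D \<in> domD \<rightarrow> ell2 I \<and> clinear_on domD D \<and>
     (\<forall>g\<in>ell2 I. \<forall>h\<in>ell2 I.
        (\<forall>f\<in>domD. l2inner I (D f) g = l2inner I f h) \<longleftrightarrow> (g \<in> domD \<and> D g = h))"

text \<open>The commutator \<open>[D, T]\<close>, defined on the algebraic span of \<open>E\<close>, extends to a bounded
  operator on \<open>\<ell>\<^sup>2(I)\<close>. The first conjunct says that the commutator is defined on the span;
  otherwise \<open>D\<close> would be applied outside its domain, where its values mean nothing.\<close>

definition bounded_commutator ::
  "'i set \<Rightarrow> ('i \<Rightarrow> complex) set \<Rightarrow> ('i \<Rightarrow> complex) set \<Rightarrow>
   (('i \<Rightarrow> complex) \<Rightarrow> ('i \<Rightarrow> complex)) \<Rightarrow> (('i \<Rightarrow> complex) \<Rightarrow> ('i \<Rightarrow> complex)) \<Rightarrow> bool" where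
  "bounded_commutator I E domD D T \<longleftrightarrow>
     (\<forall>v\<in>cspan E. v \<in> domD \<and> T v \<in> domD) \<and>
     (\<exists>B. bounded_op I B \<and> (\<forall>v\<in>cspan E. B v = D (T v) - T (D v)))"


section \<open>The \<open>*\<close>-algebra \<open>\<A>(SU\<^sub>q(2))\<close>\<close>

text \<open>The algebra is given by generators and relations: formal \<open>*\<close>-algebra expressions in \<open>a\<close>
  and \<open>b\<close> modulo the least congruence containing the laws of unital complex \<open>*\<close>-algebras and
  the defining relations.\<close>

datatype suq2_term =
    Gen_a | Gen_b | Zero | One
  | Add suq2_term suq2_term
  | Scale complex suq2_term
  | Mult suq2_term suq2_term
  | Star suq2_term

inductive suq2_eq :: "real \<Rightarrow> suq2_term \<Rightarrow> suq2_term \<Rightarrow> bool" for q :: real where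
  refl: "suq2_eq q x x"
| sym: "suq2_eq q x y \<Longrightarrow> suq2_eq q y x"
| trans: "suq2_eq q x y \<Longrightarrow> suq2_eq q y z \<Longrightarrow> suq2_eq q x z"
| Add_cong: "suq2_eq q x x' \<Longrightarrow> suq2_eq q y y' \<Longrightarrow> suq2_eq q (Add x y) (Add x' y')"
| Scale_cong: "suq2_eq q x x' \<Longrightarrow> suq2_eq q (Scale c x) (Scale c x')"
| Mult_cong: "suq2_eq q x x' \<Longrightarrow> suq2_eq q y y' \<Longrightarrow> suq2_eq q (Mult x y) (Mult x' y')"
| Star_cong: "suq2_eq q x x' \<Longrightarrow> suq2_eq q (Star x) (Star x')"

| add_assoc: "suq2_eq q (Add (Add x y) z) (Add x (Add y z))"
| add_commute: "suq2_eq q (Add x y) (Add y x)"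
| add_zero: "suq2_eq q (Add x Zero) x"
| add_inverse: "suq2_eq q (Add x (Scale (- 1) x)) Zero"
| scale_add_right: "suq2_eq q (Scale c (Add x y)) (Add (Scale c x) (Scale c y))"
| scale_add_left: "suq2_eq q (Scale (c + d) x) (Add (Scale c x) (Scale d x))"
| scale_scale: "suq2_eq q (Scale (c * d) x) (Scale c (Scale d x))"
| scale_one: "suq2_eq q (Scale 1 x) x"

| mult_assoc: "suq2_eq q (Mult (Mult x y) z) (Mult x (Mult y z))"
| mult_one_left: "suq2_eq q (Mult One x) x"
| mult_one_right: "suq2_eq q (Mult x One) x"
| distrib_right: "suq2_eq q (Mult (Add x y) z) (Add (Mult x z) (Mult y z))"
| distrib_left: "suq2_eq q (Mult x (Add y z)) (Add (Mult x y) (Mult x z))"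
| scale_mult_left: "suq2_eq q (Mult (Scale c x) y) (Scale c (Mult x y))"
| scale_mult_right: "suq2_eq q (Mult x (Scale c y)) (Scale c (Mult x y))"

| star_star: "suq2_eq q (Star (Star x)) x"
| star_add: "suq2_eq q (Star (Add x y)) (Add (Star x) (Star y))"
| star_scale: "suq2_eq q (Star (Scale c x)) (Scale (cnj c) (Star x))"
| star_mult: "suq2_eq q (Star (Mult x y)) (Mult (Star y) (Star x))"

| rel_ba: "suq2_eq q (Mult Gen_b Gen_a) (Scale (of_real q) (Mult Gen_a Gen_b))"
| rel_bsa: "suq2_eq q (Mult (Star Gen_b) Gen_a) (Scale (of_real q) (Mult Gen_a (Star Gen_b)))"
| rel_bbs: "suq2_eq q (Mult Gen_b (Star Gen_b)) (Mult (Star Gen_b) Gen_b)"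
| rel_asa: "suq2_eq q
    (Add (Mult (Star Gen_a) Gen_a) (Scale (of_real (q\<^sup>2)) (Mult (Star Gen_b) Gen_b))) One"
| rel_aas: "suq2_eq q (Add (Mult Gen_a (Star Gen_a)) (Mult Gen_b (Star Gen_b))) One"

definition suq2_class :: "real \<Rightarrow> suq2_term \<Rightarrow> suq2_term set" where
  "suq2_class q x = {y. suq2_eq q x y}"

record 'a star_algebra = "(complex, 'a) module" +
  star :: "'a \<Rightarrow> 'a"

definition SUq2 :: "real \<Rightarrow> suq2_term set star_algebra" where
  "SUq2 q = \<lparr>
     carrier = range (suq2_class q),
     mult = (\<lambda>X Y. \<Union>x\<in>X. \<Union>y\<in>Y. suq2_class q (Mult x y)),
     one = suq2_class q One,
     zero = suq2_class q Zero,
     add = (\<lambda>X Y. \<Union>x\<in>X. \<Union>y\<in>Y. suq2_class q (Add x y)),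
     smult = (\<lambda>c X. \<Union>x\<in>X. suq2_class q (Scale c x)),
     star = (\<lambda>X. \<Union>x\<in>X. suq2_class q (Star x))\<rparr>"

lemma suq2_class_eq_iff: "suq2_class q x = suq2_class q y \<longleftrightarrow> suq2_eq q x y"
  unfolding suq2_class_def set_eq_iff mem_Collect_eq
  by (meson suq2_eq.refl suq2_eq.sym suq2_eq.trans)

lemma suq2_class_self: "x \<in> suq2_class q x"
  by (simp add: suq2_class_def suq2_eq.refl)

lemma SUq2_ops:
  "carrier (SUq2 q) = range (suq2_class q)"
  "\<one>\<^bsub>SUq2 q\<^esub> = suq2_class q One"
  "\<zero>\<^bsub>SUq2 q\<^esub> = suq2_class q Zero"
  "suq2_class q x \<otimes>\<^bsub>SUq2 q\<^esub> suq2_class q y = suq2_class q (Mult x y)"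
  "suq2_class q x \<oplus>\<^bsub>SUq2 q\<^esub> suq2_class q y = suq2_class q (Add x y)"
  "c \<odot>\<^bsub>SUq2 q\<^esub> suq2_class q x = suq2_class q (Scale c x)"
  "star (SUq2 q) (suq2_class q x) = suq2_class q (Star x)"
proof -
  have m: "suq2_class q (Mult x' y') = suq2_class q (Mult x y)"
    and a: "suq2_class q (Add x' y') = suq2_class q (Add x y)"
    if "x' \<in> suq2_class q x" "y' \<in> suq2_class q y" for x' y'
    using that unfolding suq2_class_eq_iff
    by (simp_all add: suq2_class_def suq2_eq.Mult_cong suq2_eq.Add_cong suq2_eq.sym)
  have s: "suq2_class q (Scale c x') = suq2_class q (Scale c x)"
    and t: "suq2_class q (Star x') = suq2_class q (Star x)"
    if "x' \<in> suq2_class q x" for x'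
    using that unfolding suq2_class_eq_iff
    by (simp_all add: suq2_class_def suq2_eq.Scale_cong suq2_eq.Star_cong suq2_eq.sym)
  have ne: "suq2_class q z \<noteq> {}" for z
    using suq2_class_self by blast
  have "(\<Union>x'\<in>suq2_class q x. \<Union>y'\<in>suq2_class q y. suq2_class q (Mult x' y')) =
        (\<Union>x'\<in>suq2_class q x. \<Union>y'\<in>suq2_class q y. suq2_class q (Mult x y))"
    by (intro SUP_cong HOL.refl m)
  then show "suq2_class q x \<otimes>\<^bsub>SUq2 q\<^esub> suq2_class q y = suq2_class q (Mult x y)"
    by (simp add: SUq2_def ne)
  have "(\<Union>x'\<in>suq2_class q x. \<Union>y'\<in>suq2_class q y. suq2_class q (Add x' y')) =
        (\<Union>x'\<in>suq2_class q x. \<Union>y'\<in>suq2_class q y. suq2_class q (Add x y))"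
    by (intro SUP_cong HOL.refl a)
  then show "suq2_class q x \<oplus>\<^bsub>SUq2 q\<^esub> suq2_class q y = suq2_class q (Add x y)"
    by (simp add: SUq2_def ne)
  have "(\<Union>x'\<in>suq2_class q x. suq2_class q (Scale c x')) =
        (\<Union>x'\<in>suq2_class q x. suq2_class q (Scale c x))"
    by (intro SUP_cong HOL.refl s)
  then show "c \<odot>\<^bsub>SUq2 q\<^esub> suq2_class q x = suq2_class q (Scale c x)"
    by (simp add: SUq2_def ne)
  have "(\<Union>x'\<in>suq2_class q x. suq2_class q (Star x')) =
        (\<Union>x'\<in>suq2_class q x. suq2_class q (Star x))"
    by (intro SUP_cong HOL.refl t)
  then show "star (SUq2 q) (suq2_class q x) = suq2_class q (Star x)"
    by (simp add: SUq2_def ne)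
qed (simp_all add: SUq2_def)

lemma SUq2_ring: "ring (SUq2 q)"
proof (rule ringI)
  show "abelian_group (SUq2 q)"
  proof (rule abelian_groupI)
    show "\<exists>y\<in>carrier (SUq2 q). y \<oplus>\<^bsub>SUq2 q\<^esub> x = \<zero>\<^bsub>SUq2 q\<^esub>" if "x \<in> carrier (SUq2 q)" for x
    proof -
      from that obtain t where t: "x = suq2_class q t"
        by (auto simp: SUq2_ops(1))
      have "suq2_eq q (Add (Scale (- 1) t) t) Zero"
        by (meson suq2_eq.add_commute suq2_eq.add_inverse suq2_eq.trans)
      then show ?thesis
        by (intro bexI[of _ "suq2_class q (Scale (- 1) t)"])
           (auto simp: t SUq2_ops suq2_class_eq_iff)
    qed
    fix x assume "x \<in> carrier (SUq2 q)"
    then obtain t where t: "x = suq2_class q t"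
      by (auto simp: SUq2_ops(1))
    have "suq2_eq q (Add Zero t) t"
      by (meson suq2_eq.add_commute suq2_eq.add_zero suq2_eq.trans)
    then show "\<zero>\<^bsub>SUq2 q\<^esub> \<oplus>\<^bsub>SUq2 q\<^esub> x = x"
      by (simp add: t SUq2_ops suq2_class_eq_iff)
  qed (auto simp: SUq2_ops suq2_class_eq_iff del: equalityI intro: rangeI suq2_eq.add_assoc suq2_eq.add_commute)
  show "monoid (SUq2 q)"
    by (rule monoidI)
       (auto simp: SUq2_ops suq2_class_eq_iff
         del: equalityI intro: rangeI suq2_eq.mult_assoc suq2_eq.mult_one_left suq2_eq.mult_one_right)
qed (auto simp: SUq2_ops suq2_class_eq_iff del: equalityI intro: rangeI suq2_eq.distrib_left suq2_eq.distrib_right)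

text \<open>Unital \<open>*\<close>-representations by bounded operators on \<open>\<ell>\<^sup>2(I)\<close>.\<close>

definition star_rep ::
  "('a, 'm) star_algebra_scheme \<Rightarrow> 'i set \<Rightarrow> ('a \<Rightarrow> ('i \<Rightarrow> complex) \<Rightarrow> ('i \<Rightarrow> complex)) \<Rightarrow> bool" where
  "star_rep A I \<pi> \<longleftrightarrow>
     (\<forall>x\<in>carrier A. bounded_op I (\<pi> x)) \<and>
     (\<forall>f\<in>ell2 I. \<pi> \<one>\<^bsub>A\<^esub> f = f) \<and>
     (\<forall>x\<in>carrier A. \<forall>y\<in>carrier A. \<forall>f\<in>ell2 I. \<pi> (x \<oplus>\<^bsub>A\<^esub> y) f = \<pi> x f + \<pi> y f) \<and>
     (\<forall>c. \<forall>x\<in>carrier A. \<forall>f\<in>ell2 I. \<pi> (c \<odot>\<^bsub>A\<^esub> x) f = cscale c (\<pi> x f)) \<and>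
     (\<forall>x\<in>carrier A. \<forall>y\<in>carrier A. \<forall>f\<in>ell2 I. \<pi> (x \<otimes>\<^bsub>A\<^esub> y) f = \<pi> x (\<pi> y f)) \<and>
     (\<forall>x\<in>carrier A. \<forall>f\<in>ell2 I. \<forall>g\<in>ell2 I.
        l2inner I (\<pi> (star A x) f) g = l2inner I f (\<pi> x g))"


section \<open>The left regular representation\<close>

definition qnum :: "real \<Rightarrow> real \<Rightarrow> real" where
  "qnum q x = (q powr x - q powr (- x)) / (q - inverse q)"

definition half_nats :: "real set" where
  "half_nats = range (\<lambda>k::nat. real k / 2)"

definition ladder :: "real \<Rightarrow> real set" where
  "ladder l = {m. m \<le> l \<and> (\<exists>k::nat. m = - l + real k)}"

definition psi_index :: "(real \<times> real \<times> real) set" where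
  "psi_index = {(l, m, n). l \<in> half_nats \<and> m \<in> ladder l \<and> n \<in> ladder l}"

text \<open>The vector \<open>|l m n\<rangle>\<close> is \<open>ket (l, m, n)\<close>. In all formulas below, a \<open>ket\<close> with index outside
  \<open>psi_index\<close> is multiplied by a coefficient that vanishes. In particular, \<open>A_minus\<close> and
  \<open>B_minus\<close> vanish at \<open>l = 0\<close>, since division by \<open>0\<close> yields \<open>0\<close>.\<close>

definition A_plus :: "real \<Rightarrow> real \<Rightarrow> real \<Rightarrow> real \<Rightarrow> real" where
  "A_plus q l m n = q powr ((- 2 * l + m + n - 1) / 2) *
     sqrt (qnum q (l + m + 1) * qnum q (l + n + 1) / (qnum q (2 * l + 1) * qnum q (2 * l + 2)))"

definition A_minus :: "real \<Rightarrow> real \<Rightarrow> real \<Rightarrow> real \<Rightarrow> real" where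
  "A_minus q l m n = q powr ((2 * l + m + n + 1) / 2) *
     sqrt (qnum q (l - m) * qnum q (l - n) / (qnum q (2 * l) * qnum q (2 * l + 1)))"

definition B_plus :: "real \<Rightarrow> real \<Rightarrow> real \<Rightarrow> real \<Rightarrow> real" where
  "B_plus q l m n = q powr ((m + n - 1) / 2) *
     sqrt (qnum q (l + m + 1) * qnum q (l - n + 1) / (qnum q (2 * l + 1) * qnum q (2 * l + 2)))"

definition B_minus :: "real \<Rightarrow> real \<Rightarrow> real \<Rightarrow> real \<Rightarrow> real" where
  "B_minus q l m n = - (q powr ((m + n - 1) / 2) *
     sqrt (qnum q (l - m) * qnum q (l + n) / (qnum q (2 * l) * qnum q (2 * l + 1))))"

text \<open>Since \<open>a\<close> and \<open>b\<close> generate the \<open>*\<close>-algebra, these conditions determine \<open>\<pi>\<close> on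
  \<open>\<ell>\<^sup>2(psi_index)\<close>.\<close>

definition left_regular_rep ::
  "real \<Rightarrow> (suq2_term set \<Rightarrow> (real \<times> real \<times> real \<Rightarrow> complex) \<Rightarrow> (real \<times> real \<times> real \<Rightarrow> complex))
   \<Rightarrow> bool" where
  "left_regular_rep q \<pi> \<longleftrightarrow>
     star_rep (SUq2 q) psi_index \<pi> \<and>
     (\<forall>(l, m, n)\<in>psi_index.
        \<pi> (suq2_class q Gen_a) (ket (l, m, n)) =
          cscale (of_real (A_plus q l m n)) (ket (l + 1/2, m + 1/2, n + 1/2)) +
          cscale (of_real (A_minus q l m n)) (ket (l - 1/2, m + 1/2, n + 1/2)) \<and>
        \<pi> (suq2_class q Gen_b) (ket (l, m, n)) =
          cscale (of_real (B_plus q l m n)) (ket (l + 1/2, m + 1/2, n - 1/2)) +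
          cscale (of_real (B_minus q l m n)) (ket (l - 1/2, m + 1/2, n - 1/2)))"


section \<open>Spinors\<close>

text \<open>\<open>\<complex>\<^sup>2\<close> is \<open>\<ell>\<^sup>2({1/2, -1/2})\<close>, and the Hilbert space tensor product
  \<open>\<ell>\<^sup>2(I) \<otimes> \<ell>\<^sup>2(J)\<close> is \<open>\<ell>\<^sup>2(I \<times> J)\<close> with elementary tensors \<open>tensor u w\<close>.
  The operator \<open>amplify T\<close> is \<open>T \<otimes> id\<close>.\<close>

definition tensor :: "('i \<Rightarrow> complex) \<Rightarrow> ('k \<Rightarrow> complex) \<Rightarrow> ('i \<times> 'k \<Rightarrow> complex)" where
  "tensor u w = (\<lambda>(i, s). u i * w s)"

definition amplify ::
  "(('i \<Rightarrow> complex) \<Rightarrow> ('i \<Rightarrow> complex)) \<Rightarrow> ('i \<times> 'k \<Rightarrow> complex) \<Rightarrow> ('i \<times> 'k \<Rightarrow> complex)" where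
  "amplify T v = (\<lambda>(i, s). T (\<lambda>k. v (k, s)) i)"

definition spinor_index :: "((real \<times> real \<times> real) \<times> real) set" where
  "spinor_index = psi_index \<times> {1/2, - 1/2}"

definition C_coeff :: "real \<Rightarrow> real \<Rightarrow> real \<Rightarrow> real" where
  "C_coeff q j \<mu> = q powr (- (j + \<mu>) / 2) * sqrt (qnum q (j - \<mu>)) / sqrt (qnum q (2 * j))"

definition S_coeff :: "real \<Rightarrow> real \<Rightarrow> real \<Rightarrow> real" where
  "S_coeff q j \<mu> = q powr ((j - \<mu>) / 2) * sqrt (qnum q (j + \<mu>)) / sqrt (qnum q (2 * j))"

definition spinor_down ::
  "real \<Rightarrow> real \<Rightarrow> real \<Rightarrow> real \<Rightarrow> (real \<times> real \<times> real) \<times> real \<Rightarrow> complex" where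
  "spinor_down q j \<mu> n =
     cscale (of_real (C_coeff q j \<mu>)) (tensor (ket (j - 1/2, \<mu> + 1/2, n)) (ket (- 1/2))) +
     cscale (of_real (S_coeff q j \<mu>)) (tensor (ket (j - 1/2, \<mu> - 1/2, n)) (ket (1/2)))"

definition spinor_up ::
  "real \<Rightarrow> real \<Rightarrow> real \<Rightarrow> real \<Rightarrow> (real \<times> real \<times> real) \<times> real \<Rightarrow> complex" where
  "spinor_up q j \<mu> n =
     cscale (of_real (- S_coeff q (j + 1) \<mu>)) (tensor (ket (j + 1/2, \<mu> + 1/2, n)) (ket (- 1/2))) +
     cscale (of_real (C_coeff q (j + 1) \<mu>)) (tensor (ket (j + 1/2, \<mu> - 1/2, n)) (ket (1/2)))"

definition down_index :: "(real \<times> real \<times> real) set" where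
  "down_index = {(j, \<mu>, n). j \<in> half_nats - {0} \<and> \<mu> \<in> ladder j \<and> n \<in> ladder (j - 1/2)}"

definition up_index :: "(real \<times> real \<times> real) set" where
  "up_index = {(j, \<mu>, n). j \<in> half_nats \<and> \<mu> \<in> ladder j \<and> n \<in> ladder (j + 1/2)}"

definition spinor_basis :: "real \<Rightarrow> ((real \<times> real \<times> real) \<times> real \<Rightarrow> complex) set" where
  "spinor_basis q =
     (\<lambda>(j, \<mu>, n). spinor_up q j \<mu> n) ` up_index \<union> (\<lambda>(j, \<mu>, n). spinor_down q j \<mu> n) ` down_index"

end

theory Submission
  imports Defs
begin

text \<open>On the span of the product basis \<open>D = f(l) + h(l) P\<close>, where \<open>P\<close> is the projection onto the
  down-spinors and \<open>f\<close>, \<open>h\<close> are linear in \<open>l\<close>. The generators shift \<open>l\<close> by \<open>1/2\<close>, so \<open>[f(l), x]\<close> and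
  \<open>[h(l), x]\<close> are bounded, and it remains to bound \<open>h(l) [P, x]\<close>. Up to constants the entries of \<open>P\<close>
  are \<open>O(q\<^bsup>l-m\<^esup>)\<close>, while the part of \<open>x\<close> that raises \<open>l\<close> depends on \<open>m\<close> only up to
  \<open>q\<^bsup>2(l+m)\<^esup>\<close> and the part that lowers \<open>l\<close> is \<open>O(q\<^bsup>l+m\<^esup>)\<close>. Hence all entries of \<open>[P, x]\<close> are
  \<open>O(q\<^bsup>2l\<^esup>)\<close>, which beats the linear growth of \<open>h\<close>. Adjoints and products are handled by
  transposition and the Leibniz rule.\<close>

section \<open>Bounded operators on \<open>\<ell>\<^sup>2(I)\<close>\<close>

text \<open>The obstacle is that the two operators are simple in different bases: D is diagonal on
  spinors, while the generators are shifts of kets. Rather than expanding the generators over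
  spinors, the proof expands D over kets. At level l the down-spinor with j = l + 1/2 and the
  up-spinor with j = l - 1/2 are built from the same numbers C, S with C^2 + S^2 = 1. Hence f(l) is
  the up-eigenvalue at l - 1/2, f(l) + h(l) is the down-eigenvalue at l + 1/2, and D has blocks of
  size at most two with entries f + h S^2, f + h C^2 and h C S. A commutator of weighted shifts is a
  sum of weighted shifts, so boundedness reduces to uniform bounds on coefficients. The boundary
  needs care: a shift preserves the algebraic span only if its coefficient vanishes on every step
  that leaves the index set, and its transpose requires the same for every step that enters it. The
  two halves of a generator behave differently. For the raising half the products of entries need
  not be small near m = l, and only their difference is; for the lowering half each product is
  already small.\<close>

lemma ell2_zero: "0 \<in> ell2 I"
  by (simp add: ell2_def zero_fun_def)

text \<open>The pointwise inequality |x + y|^2 <= 2 (|x|^2 + |y|^2) gives summability and the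
  estimate together. The loss of a constant against Minkowski's inequality is harmless, since only
  boundedness is at stake.\<close>

lemma ell2_add:
  assumes f: "f \<in> ell2 I" and g: "g \<in> ell2 I"
  shows "f + g \<in> ell2 I"
    and "(l2norm I (f + g))\<^sup>2 \<le> 2 * ((l2norm I f)\<^sup>2 + (l2norm I g)\<^sup>2)"
proof -
  let ?F = "\<lambda>i. (cmod (f i))\<^sup>2" and ?G = "\<lambda>i. (cmod (g i))\<^sup>2" and ?H = "\<lambda>i. (cmod ((f + g) i))\<^sup>2"
  have sF: "?F summable_on I" and sG: "?G summable_on I"
    using f g by (auto simp: ell2_def)
  have bound: "?H i \<le> 2 * (?F i + ?G i)" for i
  proof -
    have "?H i \<le> (cmod (f i) + cmod (g i))\<^sup>2"
      by (simp add: norm_triangle_ineq power_mono)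
    also have "\<dots> \<le> 2 * (?F i + ?G i)"
      using sum_squares_bound[of "cmod (f i)" "cmod (g i)"] by (simp add: power2_sum)
    finally show ?thesis .
  qed
  have sFG: "(\<lambda>i. 2 * (?F i + ?G i)) summable_on I"
    by (intro summable_on_cmult_right summable_on_add sF sG)
  have sH: "?H summable_on I"
    by (rule summable_on_comparison_test[OF sFG bound]) auto
  then show "f + g \<in> ell2 I"
    using f g by (auto simp: ell2_def)
  have "infsum ?H I \<le> (\<Sum>\<^sub>\<infinity>i\<in>I. 2 * (?F i + ?G i))"
    by (rule infsum_mono[OF sH sFG bound])
  also have "\<dots> = 2 * (infsum ?F I + infsum ?G I)"
    by (simp only: infsum_cmult_right' infsum_add[OF sF sG])
  finally show "(l2norm I (f + g))\<^sup>2 \<le> 2 * ((l2norm I f)\<^sup>2 + (l2norm I g)\<^sup>2)"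
    by (simp add: l2norm_def infsum_nonneg)
qed

lemma ell2_scale:
  assumes "f \<in> ell2 I"
  shows "cscale c f \<in> ell2 I" and "l2norm I (cscale c f) = cmod c * l2norm I f"
proof -
  show "cscale c f \<in> ell2 I"
    using assms by (auto simp: ell2_def cscale_def norm_mult power_mult_distrib intro: summable_on_cmult_right)
  show "l2norm I (cscale c f) = cmod c * l2norm I f"
    by (simp add: l2norm_def cscale_def norm_mult power_mult_distrib infsum_cmult_right' real_sqrt_mult)
qed

lemma l2norm_nonneg: "0 \<le> l2norm I f"
  by (simp add: l2norm_def infsum_nonneg)

lemma l2norm_add_le:
  assumes "f \<in> ell2 I" "g \<in> ell2 I"
  shows "l2norm I (f + g) \<le> 2 * (l2norm I f + l2norm I g)"
proof (rule power2_le_imp_le)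
  have "(l2norm I (f + g))\<^sup>2 \<le> 2 * ((l2norm I f)\<^sup>2 + (l2norm I g)\<^sup>2)"
    by (rule ell2_add(2)[OF assms])
  also have "\<dots> \<le> (2 * (l2norm I f + l2norm I g))\<^sup>2"
    using mult_nonneg_nonneg[OF l2norm_nonneg[of I f] l2norm_nonneg[of I g]]
      zero_le_power2[of "l2norm I f"] zero_le_power2[of "l2norm I g"]
    by (simp add: power_mult_distrib power2_sum)
  finally show "(l2norm I (f + g))\<^sup>2 \<le> (2 * (l2norm I f + l2norm I g))\<^sup>2" .
qed (simp add: l2norm_nonneg)

lemma csubspace_ell2: "csubspace (ell2 I)"
  by (rule cfun.subspaceI) (auto intro: ell2_zero ell2_add(1) ell2_scale(1))

lemma ket_in_ell2:
  assumes "i \<in> I"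
  shows "ket i \<in> ell2 I"
proof -
  have "(\<lambda>k. (cmod (ket i k))\<^sup>2) summable_on {i}"
    by simp
  then have "(\<lambda>k. (cmod (ket i k))\<^sup>2) summable_on I"
    using assms by (subst summable_on_cong_neutral[where T = "{i}"]) (auto simp: ket_def)
  then show ?thesis
    using assms by (auto simp: ell2_def ket_def)
qed

lemma l2inner_ket_right:
  assumes "i \<in> I"
  shows "l2inner I f (ket i) = cnj (f i)"
proof -
  have "l2inner I f (ket i) = (\<Sum>\<^sub>\<infinity>k\<in>{i}. cnj (f k) * ket i k)"
    unfolding l2inner_def using assms by (intro infsum_cong_neutral) (auto simp: ket_def)
  then show ?thesis by (simp add: ket_def)
qed

lemma l2inner_ket_left:
  assumes "i \<in> I"
  shows "l2inner I (ket i) g = g i"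
proof -
  have "l2inner I (ket i) g = (\<Sum>\<^sub>\<infinity>k\<in>{i}. cnj (ket i k) * g k)"
    unfolding l2inner_def using assms by (intro infsum_cong_neutral) (auto simp: ket_def)
  then show ?thesis by (simp add: ket_def)
qed

lemma bounded_opD:
  assumes "bounded_op I B"
  shows "f \<in> ell2 I \<Longrightarrow> B f \<in> ell2 I"
    and "f \<in> ell2 I \<Longrightarrow> g \<in> ell2 I \<Longrightarrow> B (f + g) = B f + B g"
    and "f \<in> ell2 I \<Longrightarrow> B (cscale c f) = cscale c (B f)"
  using assms by (auto simp: bounded_op_def clinear_on_def)

text \<open>\<open>bounded_op\<close> admits a negative constant. Replacing it by its maximum with 0
  makes it usable as a monotone factor in the estimate for compositions.\<close>

lemma bounded_op_bound:
  assumes "bounded_op I B"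
  obtains K where "K \<ge> 0" "\<And>f. f \<in> ell2 I \<Longrightarrow> l2norm I (B f) \<le> K * l2norm I f"
proof -
  from assms obtain K where K: "\<forall>f\<in>ell2 I. l2norm I (B f) \<le> K * l2norm I f"
    by (auto simp: bounded_op_def)
  have "l2norm I (B f) \<le> max K 0 * l2norm I f" if "f \<in> ell2 I" for f
    using K that mult_right_mono[OF max.cobounded1[of K 0] l2norm_nonneg[of I f]]
    by (meson order_trans)
  then show ?thesis by (intro that[of "max K 0"]) auto
qed

lemma bounded_op_add:
  assumes B: "bounded_op I B" and C: "bounded_op I C"
  shows "bounded_op I (\<lambda>f. B f + C f)"
proof -
  obtain K where K: "\<And>f. f \<in> ell2 I \<Longrightarrow> l2norm I (B f) \<le> K * l2norm I f"
    using bounded_op_bound[OF B] by blast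
  obtain L where L: "\<And>f. f \<in> ell2 I \<Longrightarrow> l2norm I (C f) \<le> L * l2norm I f"
    using bounded_op_bound[OF C] by blast
  have "l2norm I (B f + C f) \<le> (2 * (K + L)) * l2norm I f" if f: "f \<in> ell2 I" for f
    using l2norm_add_le[OF bounded_opD(1)[OF B f] bounded_opD(1)[OF C f]] K[OF f] L[OF f]
    by (simp add: algebra_simps)
  then have "\<exists>K. \<forall>f\<in>ell2 I. l2norm I (B f + C f) \<le> K * l2norm I f"
    by blast
  moreover have "clinear_on (ell2 I) (\<lambda>f. B f + C f)"
    using bounded_opD[OF B] bounded_opD[OF C]
    by (simp add: clinear_on_def fun_eq_iff cscale_def algebra_simps del: plus_fun_apply)
       (simp add: algebra_simps)
  moreover have "(\<lambda>f. B f + C f) \<in> ell2 I \<rightarrow> ell2 I"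
    using bounded_opD(1)[OF B] bounded_opD(1)[OF C] by (intro funcsetI ell2_add(1))
  ultimately show ?thesis
    unfolding bounded_op_def by blast
qed

lemma bounded_op_scale:
  assumes B: "bounded_op I B"
  shows "bounded_op I (\<lambda>f. cscale c (B f))"
proof -
  obtain K where K: "\<And>f. f \<in> ell2 I \<Longrightarrow> l2norm I (B f) \<le> K * l2norm I f"
    using bounded_op_bound[OF B] by blast
  have "l2norm I (cscale c (B f)) \<le> (cmod c * K) * l2norm I f" if f: "f \<in> ell2 I" for f
    using ell2_scale(2)[OF bounded_opD(1)[OF B f]] mult_left_mono[OF K[OF f] norm_ge_zero[of c]]
    by (simp add: mult.assoc)
  then have "\<exists>K. \<forall>f\<in>ell2 I. l2norm I (cscale c (B f)) \<le> K * l2norm I f"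
    by blast
  then show ?thesis
    unfolding bounded_op_def clinear_on_def
    using bounded_opD[OF B]
    by (auto simp: ell2_scale(1) cfun.scale_right_distrib mult.commute)
qed

lemma bounded_op_comp:
  assumes B: "bounded_op I B" and C: "bounded_op I C"
  shows "bounded_op I (\<lambda>f. B (C f))"
proof -
  obtain K where K: "K \<ge> 0" "\<And>f. f \<in> ell2 I \<Longrightarrow> l2norm I (B f) \<le> K * l2norm I f"
    using bounded_op_bound[OF B] by blast
  obtain L where L: "\<And>f. f \<in> ell2 I \<Longrightarrow> l2norm I (C f) \<le> L * l2norm I f"
    using bounded_op_bound[OF C] by blast
  have "l2norm I (B (C f)) \<le> (K * L) * l2norm I f" if f: "f \<in> ell2 I" for f
    using K(2)[OF bounded_opD(1)[OF C f]] mult_left_mono[OF L[OF f] K(1)]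
    by (simp add: mult.assoc)
  then show ?thesis
    unfolding bounded_op_def clinear_on_def
    using bounded_opD[OF B] bounded_opD[OF C]
    by auto
qed

lemma bounded_op_id: "bounded_op I (\<lambda>f. f)"
  unfolding bounded_op_def clinear_on_def by (auto intro!: exI[of _ 1])

section \<open>Weighted shifts\<close>

text \<open>The operator that sends the basis vector at k to a(k) times the basis vector at k +
  \<tau>. It is defined on the whole index group, without truncation, so that compositions and
  transposes are again of this form with explicit coefficients.\<close>

definition wshift :: "'i::ab_group_add \<Rightarrow> ('i \<Rightarrow> real) \<Rightarrow> ('i \<Rightarrow> complex) \<Rightarrow> 'i \<Rightarrow> complex" where
  "wshift \<tau> a v = (\<lambda>i. of_real (a (i - \<tau>)) * v (i - \<tau>))"

lemma wshift_add: "wshift \<tau> a (f + g) = wshift \<tau> a f + wshift \<tau> a g"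
  by (simp add: wshift_def fun_eq_iff algebra_simps)

lemma wshift_cscale: "wshift \<tau> a (cscale c f) = cscale c (wshift \<tau> a f)"
  by (simp add: wshift_def cscale_def fun_eq_iff)

lemma wshift_wshift: "wshift \<delta> d (wshift \<tau> a v) = wshift (\<tau> + \<delta>) (\<lambda>k. d (k + \<tau>) * a k) v"
  by (simp add: wshift_def fun_eq_iff algebra_simps)

lemma wshift_diff: "wshift \<tau> a v - wshift \<tau> b v = wshift \<tau> (\<lambda>k. a k - b k) v"
  by (simp add: wshift_def fun_eq_iff algebra_simps)

lemma wshift_ket: "wshift \<tau> a (ket k) = cscale (of_real (a k)) (ket (k + \<tau>))"
  by (auto simp: wshift_def cscale_def ket_def fun_eq_iff)

text \<open>The truncation to I makes this an operator on the whole of \<open>ell2 I\<close>; only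
  the entries between two indices of I survive, so only these have to be bounded.\<close>

lemma bounded_op_wshift:
  fixes I :: "'i::ab_group_add set"
  assumes M: "\<And>k. k \<in> I \<Longrightarrow> k + \<tau> \<in> I \<Longrightarrow> \<bar>a k\<bar> \<le> M"
  shows "bounded_op I (\<lambda>f i. if i \<in> I then wshift \<tau> a f i else 0)" (is "bounded_op I ?B")
proof -
  \<comment> \<open>J holds the target indices whose source also lies in I. At the remaining targets
    the shifted vector is 0 because f vanishes off I, so all sums may be taken over J and reindexed
    by the source.\<close>
  define J where "J = {i \<in> I. i - \<tau> \<in> I}"
  have inj: "inj_on (\<lambda>i. i - \<tau>) J"
    by (auto simp: inj_on_def)
  have main: "?B f \<in> ell2 I \<and> l2norm I (?B f) \<le> \<bar>M\<bar> * l2norm I f" if f: "f \<in> ell2 I" for f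
  proof -
    let ?F = "\<lambda>i. (cmod (f i))\<^sup>2" and ?G = "\<lambda>i. (cmod (?B f i))\<^sup>2"
    let ?H = "\<lambda>i. M\<^sup>2 * (cmod (f (i - \<tau>)))\<^sup>2"
    have sF: "?F summable_on I" and supp: "\<And>i. i \<notin> I \<Longrightarrow> f i = 0"
      using f by (auto simp: ell2_def)
    have sub: "(\<lambda>i. i - \<tau>) ` J \<subseteq> I"
      by (auto simp: J_def)
    have sF': "?F summable_on (\<lambda>i. i - \<tau>) ` J"
      by (rule summable_on_subset_banach[OF sF sub])
    then have sJ: "(?F \<circ> (\<lambda>i. i - \<tau>)) summable_on J"
      using summable_on_reindex[OF inj] by blast
    have sH: "?H summable_on J"
      using summable_on_cmult_right[OF sJ, of "M\<^sup>2"] by (simp add: o_def)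
    have le: "?G i \<le> ?H i" if "i \<in> J" for i
    proof -
      have "\<bar>a (i - \<tau>)\<bar> \<le> M"
        using M[of "i - \<tau>"] that by (auto simp: J_def)
      then have "(a (i - \<tau>))\<^sup>2 \<le> M\<^sup>2"
        by (simp add: abs_le_square_iff[symmetric])
      then show ?thesis
        using that by (auto simp: J_def wshift_def norm_mult power_mult_distrib intro: mult_right_mono)
    qed
    have sGJ: "?G summable_on J"
      by (rule summable_on_comparison_test[OF sH le]) auto
    have neutral: "?G i = 0" if "i \<in> I - J" for i
      using that supp by (auto simp: J_def wshift_def)
    have sG: "?G summable_on I"
      using sGJ by (subst summable_on_cong_neutral[where T = J]) (use neutral in \<open>auto simp: J_def\<close>)
    have "infsum ?G I = infsum ?G J"
      by (rule infsum_cong_neutral) (use neutral in \<open>auto simp: J_def\<close>)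
    also have "\<dots> \<le> infsum ?H J"
      by (rule infsum_mono[OF sGJ sH le])
    also have "\<dots> = M\<^sup>2 * infsum ?F ((\<lambda>i. i - \<tau>) ` J)"
      by (simp add: infsum_reindex[OF inj] o_def infsum_cmult_right')
    also have "\<dots> \<le> M\<^sup>2 * infsum ?F I"
      by (intro mult_left_mono infsum_mono2 sF sF' sub) auto
    finally have "sqrt (infsum ?G I) \<le> sqrt (M\<^sup>2 * infsum ?F I)"
      by simp
    then show ?thesis
      using sG by (simp add: ell2_def l2norm_def real_sqrt_mult)
  qed
  moreover have "clinear_on (ell2 I) ?B"
    by (auto simp: clinear_on_def fun_eq_iff wshift_def cscale_def algebra_simps)
  ultimately show ?thesis
    unfolding bounded_op_def by blast
qed

lemma ket_span_subset_ell2: "cspan (ket ` I) \<subseteq> ell2 I"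
  by (rule cfun.span_minimal[OF _ csubspace_ell2]) (auto intro: ket_in_ell2)

lemma ket_span_outside: "v \<in> cspan (ket ` I) \<Longrightarrow> i \<notin> I \<Longrightarrow> v i = 0"
  using ket_span_subset_ell2[of I] unfolding ell2_def by blast

text \<open>The untruncated shift keeps finite combinations of kets inside I because a step out of I
  carries the coefficient 0.\<close>

lemma wshift_ket_span:
  assumes van: "\<And>k. k \<in> I \<Longrightarrow> k + \<tau> \<notin> I \<Longrightarrow> a k = 0"
    and v: "v \<in> cspan (ket ` I)"
  shows "wshift \<tau> a v \<in> cspan (ket ` I)"
  using v
proof (induction v rule: cfun.span_induct_alt)
  case base
  have "wshift \<tau> a 0 = 0"
    by (simp add: wshift_def fun_eq_iff)
  then show ?case by (metis cfun.span_zero)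
next
  case (step c x y)
  then obtain k where k: "k \<in> I" "x = ket k" by auto
  have "wshift \<tau> a x \<in> cspan (ket ` I)"
  proof (cases "k + \<tau> \<in> I")
    case True
    then show ?thesis
      unfolding k wshift_ket by (intro cfun.span_scale cfun.span_base imageI)
  next
    case False
    then show ?thesis
      using van[OF k(1)] by (simp add: k wshift_ket cfun.span_zero)
  qed
  then show ?case
    using step unfolding wshift_add wshift_cscale by (intro cfun.span_add cfun.span_scale)
qed

section \<open>Operators with bounded commutator\<close>

definition bounded_ext :: "'i set \<Rightarrow> (('i \<Rightarrow> complex) \<Rightarrow> ('i \<Rightarrow> complex)) \<Rightarrow> bool" where
  "bounded_ext I T \<longleftrightarrow> (\<exists>B. bounded_op I B \<and> (\<forall>v\<in>cspan (ket ` I). B v = T v))"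

text \<open>The conditions are bundled so that they are stable under products: the Leibniz rule
  needs bounded factors, bounded commutators, and a right factor that maps the algebraic span to
  itself.\<close>

definition regular_wrt ::
  "'i set \<Rightarrow> (('i \<Rightarrow> complex) \<Rightarrow> ('i \<Rightarrow> complex)) \<Rightarrow> (('i \<Rightarrow> complex) \<Rightarrow> ('i \<Rightarrow> complex)) \<Rightarrow> bool" where
  "regular_wrt I D T \<longleftrightarrow>
     T \<in> cspan (ket ` I) \<rightarrow> cspan (ket ` I) \<and> bounded_ext I T \<and> bounded_ext I (\<lambda>v. D (T v) - T (D v))"

lemma bounded_ext_cong:
  assumes "\<And>v. v \<in> cspan (ket ` I) \<Longrightarrow> S v = T v"
  shows "bounded_ext I S \<longleftrightarrow> bounded_ext I T"
  using assms by (simp add: bounded_ext_def)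

text \<open>Linearity on the span is inherited from the extension, so it need not be listed in
  \<open>regular_wrt\<close>.\<close>

lemma bounded_ext_linear:
  assumes "bounded_ext I T"
  shows "clinear_on (cspan (ket ` I)) T"
proof -
  from assms obtain B where B: "bounded_op I B" "\<And>v. v \<in> cspan (ket ` I) \<Longrightarrow> B v = T v"
    by (auto simp: bounded_ext_def)
  have sub: "f \<in> ell2 I" if "f \<in> cspan (ket ` I)" for f
    using that ket_span_subset_ell2 by blast
  have "T (f + g) = T f + T g" if f: "f \<in> cspan (ket ` I)" and g: "g \<in> cspan (ket ` I)" for f g
    using bounded_opD(2)[OF B(1) sub[OF f] sub[OF g]]
    by (simp only: B(2) f g cfun.span_add)
  moreover have "T (cscale c f) = cscale c (T f)" if f: "f \<in> cspan (ket ` I)" for c f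
    using bounded_opD(3)[OF B(1) sub[OF f]]
    by (simp only: B(2) f cfun.span_scale)
  ultimately show ?thesis
    by (simp add: clinear_on_def)
qed

lemma bounded_ext_add:
  assumes "bounded_ext I S" "bounded_ext I T"
  shows "bounded_ext I (\<lambda>v. S v + T v)"
proof -
  from assms obtain B C where "bounded_op I B" "bounded_op I C"
    "\<And>v. v \<in> cspan (ket ` I) \<Longrightarrow> B v = S v" "\<And>v. v \<in> cspan (ket ` I) \<Longrightarrow> C v = T v"
    unfolding bounded_ext_def by blast
  then show ?thesis
    unfolding bounded_ext_def by (intro exI[of _ "\<lambda>f. B f + C f"]) (auto intro: bounded_op_add)
qed

lemma bounded_ext_scale:
  assumes "bounded_ext I T"
  shows "bounded_ext I (\<lambda>v. cscale c (T v))"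
proof -
  from assms obtain B where "bounded_op I B" "\<And>v. v \<in> cspan (ket ` I) \<Longrightarrow> B v = T v"
    unfolding bounded_ext_def by blast
  then show ?thesis
    unfolding bounded_ext_def by (intro exI[of _ "\<lambda>f. cscale c (B f)"]) (auto intro: bounded_op_scale)
qed

lemma bounded_ext_comp:
  assumes "bounded_ext I S" "bounded_ext I T" "T \<in> cspan (ket ` I) \<rightarrow> cspan (ket ` I)"
  shows "bounded_ext I (\<lambda>v. S (T v))"
proof -
  from assms obtain B C where "bounded_op I B" "bounded_op I C"
    "\<And>v. v \<in> cspan (ket ` I) \<Longrightarrow> B v = S v" "\<And>v. v \<in> cspan (ket ` I) \<Longrightarrow> C v = T v"
    unfolding bounded_ext_def by blast
  then show ?thesis
    unfolding bounded_ext_def using assms(3)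
    by (intro exI[of _ "\<lambda>f. B (C f)"]) (auto intro: bounded_op_comp)
qed

lemma bounded_ext_zero: "bounded_ext I (\<lambda>v. 0)"
proof -
  have "(\<lambda>v::'a \<Rightarrow> complex. 0) = (\<lambda>v. cscale 0 v)"
    by (simp add: fun_eq_iff cscale_def)
  then show ?thesis
    unfolding bounded_ext_def using bounded_op_scale[OF bounded_op_id, of I 0] by auto
qed

lemma bounded_ext_sum:
  assumes "finite \<Delta>" "\<And>\<delta>. \<delta> \<in> \<Delta> \<Longrightarrow> bounded_ext I (T \<delta>)"
  shows "bounded_ext I (\<lambda>v. \<Sum>\<delta>\<in>\<Delta>. T \<delta> v)"
  using assms by (induction \<Delta> rule: finite_induct) (simp_all add: bounded_ext_zero bounded_ext_add)

section \<open>Linear maps on an algebraic span\<close>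

lemma clinear_onD:
  assumes "clinear_on V T"
  shows "f \<in> V \<Longrightarrow> g \<in> V \<Longrightarrow> T (f + g) = T f + T g" and "f \<in> V \<Longrightarrow> T (cscale c f) = cscale c (T f)"
  using assms by (auto simp: clinear_on_def)

lemma clinear_on_span_diff:
  assumes T: "clinear_on (cspan E) T" and "f \<in> cspan E" "g \<in> cspan E"
  shows "T (f - g) = T f - T g"
  using clinear_onD(1)[OF T, of "f - g" g] assms(2,3) by (simp add: cfun.span_diff)

lemma clinear_on_span_eq:
  assumes T: "clinear_on (cspan E) T" and S: "clinear_on (cspan E) S"
    and eq: "\<And>x. x \<in> E \<Longrightarrow> T x = S x" and v: "v \<in> cspan E"
  shows "T v = S v"
proof -
  \<comment> \<open>Membership is carried through the induction, because additivity of T and S may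
    be used only for vectors of the span.\<close>
  have "v \<in> cspan E \<and> T v = S v"
    using v
  proof (induction v rule: cfun.span_induct_alt)
    case base
    have "T 0 = 0" "S 0 = 0"
      using clinear_onD(2)[OF T cfun.span_zero, of 0] clinear_onD(2)[OF S cfun.span_zero, of 0]
      by (simp_all only: cfun.scale_zero_left)
    then show ?case by (metis cfun.span_zero)
  next
    case (step c x y)
    have x: "x \<in> cspan E" and cx: "cscale c x \<in> cspan E"
      using step by (auto intro: cfun.span_base cfun.span_scale)
    have "T (cscale c x + y) = S (cscale c x + y)"
      using step clinear_onD(1)[OF T cx, of y] clinear_onD(1)[OF S cx, of y]
      by (simp only: clinear_onD(2)[OF T x] clinear_onD(2)[OF S x] eq)
    then show ?case
      using step cx by (metis cfun.span_add)
  qed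
  then show ?thesis ..
qed

text \<open>The commutator also evaluates S at D v, so agreement on the span is enough only when D
  preserves the span.\<close>

lemma regular_wrt_cong:
  assumes eq: "\<And>v. v \<in> cspan (ket ` I) \<Longrightarrow> S v = T v"
    and D: "D \<in> cspan (ket ` I) \<rightarrow> cspan (ket ` I)"
  shows "regular_wrt I D S \<longleftrightarrow> regular_wrt I D T"
proof -
  have "bounded_ext I S \<longleftrightarrow> bounded_ext I T"
    "bounded_ext I (\<lambda>v. D (S v) - S (D v)) \<longleftrightarrow> bounded_ext I (\<lambda>v. D (T v) - T (D v))"
    using D by (auto intro!: bounded_ext_cong simp: eq Pi_iff)
  moreover have "S \<in> cspan (ket ` I) \<rightarrow> cspan (ket ` I) \<longleftrightarrow> T \<in> cspan (ket ` I) \<rightarrow> cspan (ket ` I)"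
    by (simp add: Pi_iff eq)
  ultimately show ?thesis by (simp add: regular_wrt_def)
qed

section \<open>Closure of the regular operators under the algebra operations\<close>

lemma regular_wrt_id:
  assumes "D \<in> cspan (ket ` I) \<rightarrow> cspan (ket ` I)"
  shows "regular_wrt I D (\<lambda>v. v)"
  using bounded_op_id[of I] by (auto simp: regular_wrt_def bounded_ext_zero) (auto simp: bounded_ext_def)

lemma regular_wrt_add:
  assumes D: "clinear_on (cspan (ket ` I)) D" "D \<in> cspan (ket ` I) \<rightarrow> cspan (ket ` I)"
    and S: "regular_wrt I D S" and T: "regular_wrt I D T"
  shows "regular_wrt I D (\<lambda>v. S v + T v)"
proof -
  have "bounded_ext I (\<lambda>v. (D (S v) - S (D v)) + (D (T v) - T (D v)))"
    using S T by (intro bounded_ext_add) (auto simp: regular_wrt_def)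
  also have "?this \<longleftrightarrow> bounded_ext I (\<lambda>v. D (S v + T v) - (S (D v) + T (D v)))"
    using S T by (intro bounded_ext_cong) (auto simp: regular_wrt_def Pi_iff clinear_onD[OF D(1)] algebra_simps)
  finally show ?thesis
    using S T by (auto simp: regular_wrt_def Pi_iff intro: bounded_ext_add cfun.span_add)
qed

lemma regular_wrt_scale:
  assumes D: "clinear_on (cspan (ket ` I)) D" "D \<in> cspan (ket ` I) \<rightarrow> cspan (ket ` I)"
    and T: "regular_wrt I D T"
  shows "regular_wrt I D (\<lambda>v. cscale c (T v))"
proof -
  have "bounded_ext I (\<lambda>v. cscale c (D (T v) - T (D v)))"
    using T by (intro bounded_ext_scale) (auto simp: regular_wrt_def)
  also have "?this \<longleftrightarrow> bounded_ext I (\<lambda>v. D (cscale c (T v)) - cscale c (T (D v)))"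
    using T by (intro bounded_ext_cong)
      (auto simp: regular_wrt_def Pi_iff clinear_onD[OF D(1)] cfun.scale_right_diff_distrib)
  finally show ?thesis
    using T by (auto simp: regular_wrt_def Pi_iff intro: bounded_ext_scale cfun.span_scale)
qed

text \<open>Leibniz rule: [D, S T] = [D, S] T + S [D, T].\<close>

lemma regular_wrt_comp:
  assumes D: "clinear_on (cspan (ket ` I)) D" "D \<in> cspan (ket ` I) \<rightarrow> cspan (ket ` I)"
    and S: "regular_wrt I D S" and T: "regular_wrt I D T"
  shows "regular_wrt I D (\<lambda>v. S (T v))"
proof -
  have lin: "clinear_on (cspan (ket ` I)) S"
    using S by (auto simp: regular_wrt_def intro: bounded_ext_linear)
  have mapD: "D v \<in> cspan (ket ` I)" and mapT: "T v \<in> cspan (ket ` I)"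
    if "v \<in> cspan (ket ` I)" for v
    using that D T by (auto simp: regular_wrt_def)
  \<comment> \<open>For the summand S [D, T] the vector [D, T] v has to lie in the span, since only
    there does S agree with its bounded extension.\<close>
  have "(\<lambda>v. D (T v) - T (D v)) \<in> cspan (ket ` I) \<rightarrow> cspan (ket ` I)"
    using mapD mapT by (blast intro: cfun.span_diff)
  then have "bounded_ext I (\<lambda>v. S (D (T v) - T (D v)))"
    using S T bounded_ext_comp[of I S "\<lambda>v. D (T v) - T (D v)"] by (simp add: regular_wrt_def)
  moreover have "bounded_ext I (\<lambda>v. D (S (T v)) - S (D (T v)))"
    using S T bounded_ext_comp[of I "\<lambda>w. D (S w) - S (D w)" T] by (simp add: regular_wrt_def)
  ultimately have "bounded_ext I (\<lambda>v. (D (S (T v)) - S (D (T v))) + S (D (T v) - T (D v)))"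
    by (rule bounded_ext_add[rotated])
  also have "?this \<longleftrightarrow> bounded_ext I (\<lambda>v. D (S (T v)) - S (T (D v)))"
    by (intro bounded_ext_cong) (simp add: clinear_on_span_diff[OF lin] mapD mapT)
  finally show ?thesis
    using S T bounded_ext_comp[of I S T] by (auto simp: regular_wrt_def)
qed

lemma bounded_ext_wshift:
  assumes van: "\<And>k. k \<in> I \<Longrightarrow> k + \<tau> \<notin> I \<Longrightarrow> a k = 0"
    and M: "\<And>k. k \<in> I \<Longrightarrow> k + \<tau> \<in> I \<Longrightarrow> \<bar>a k\<bar> \<le> M"
  shows "bounded_ext I (wshift \<tau> a)"
  unfolding bounded_ext_def
proof (intro exI conjI ballI)
  show "bounded_op I (\<lambda>f i. if i \<in> I then wshift \<tau> a f i else 0)"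
    by (rule bounded_op_wshift) (rule M)
  fix v :: "'a \<Rightarrow> complex" assume "v \<in> cspan (ket ` I)"
  then have "wshift \<tau> a v \<in> cspan (ket ` I)"
    using van by (intro wshift_ket_span) auto
  then show "(\<lambda>i. if i \<in> I then wshift \<tau> a v i else 0) = wshift \<tau> a v"
    using ket_span_outside by fastforce
qed

section \<open>Commutators of weighted shifts\<close>

lemma wshift_sum: "finite \<Delta> \<Longrightarrow> wshift \<tau> a (\<Sum>\<delta>\<in>\<Delta>. f \<delta>) = (\<Sum>\<delta>\<in>\<Delta>. wshift \<tau> a (f \<delta>))"
proof (induction \<Delta> rule: finite_induct)
  case empty
  then show ?case by (simp add: wshift_def fun_eq_iff)
next
  case (insert x F)
  then show ?case by (simp only: sum.insert wshift_add simp_thms)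
qed

text \<open>The shift by \<delta> in D and the shift by \<tau> both compose, in either order, to a
  shift by \<tau> + \<delta>. Their commutator is one weighted shift whose coefficient is the
  difference of the two products, and D has only finitely many such parts.\<close>

lemma regular_wrt_wshift:
  assumes \<Delta>: "finite \<Delta>" and D: "\<And>v. v \<in> cspan (ket ` I) \<Longrightarrow> D v = (\<Sum>\<delta>\<in>\<Delta>. wshift \<delta> (d \<delta>) v)"
    and vand: "\<And>\<delta> k. \<delta> \<in> \<Delta> \<Longrightarrow> k \<in> I \<Longrightarrow> k + \<delta> \<notin> I \<Longrightarrow> d \<delta> k = 0"
    and van: "\<And>k. k \<in> I \<Longrightarrow> k + \<tau> \<notin> I \<Longrightarrow> a k = 0"
    and M: "\<And>k. k \<in> I \<Longrightarrow> k + \<tau> \<in> I \<Longrightarrow> \<bar>a k\<bar> \<le> M"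
    and N: "\<And>\<delta>. \<delta> \<in> \<Delta> \<Longrightarrow>
      \<exists>N. \<forall>k\<in>I. k + \<tau> + \<delta> \<in> I \<longrightarrow> \<bar>d \<delta> (k + \<tau>) * a k - a (k + \<delta>) * d \<delta> k\<bar> \<le> N"
  shows "regular_wrt I D (wshift \<tau> a)"
proof -
  have map: "wshift \<tau> a \<in> cspan (ket ` I) \<rightarrow> cspan (ket ` I)"
    using wshift_ket_span[of I \<tau> a] van by auto
  let ?\<kappa> = "\<lambda>\<delta> k. d \<delta> (k + \<tau>) * a k - a (k + \<delta>) * d \<delta> k"
  have comm: "D (wshift \<tau> a v) - wshift \<tau> a (D v) = (\<Sum>\<delta>\<in>\<Delta>. wshift (\<tau> + \<delta>) (?\<kappa> \<delta>) v)"
    if "v \<in> cspan (ket ` I)" for v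
  proof -
    have "wshift \<tau> a (D v) = (\<Sum>\<delta>\<in>\<Delta>. wshift (\<tau> + \<delta>) (\<lambda>k. a (k + \<delta>) * d \<delta> k) v)"
      using that by (simp add: D wshift_sum \<Delta> wshift_wshift add.commute)
    moreover have "D (wshift \<tau> a v) = (\<Sum>\<delta>\<in>\<Delta>. wshift (\<tau> + \<delta>) (\<lambda>k. d \<delta> (k + \<tau>) * a k) v)"
      using that map by (simp add: D Pi_iff wshift_wshift)
    ultimately show ?thesis
      by (simp add: sum_subtractf[symmetric] wshift_diff)
  qed
  have "bounded_ext I (wshift (\<tau> + \<delta>) (?\<kappa> \<delta>))" if \<delta>: "\<delta> \<in> \<Delta>" for \<delta>
  proof -
    obtain N where N: "\<And>k. k \<in> I \<Longrightarrow> k + \<tau> + \<delta> \<in> I \<Longrightarrow> \<bar>?\<kappa> \<delta> k\<bar> \<le> N"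
      using N[OF \<delta>] by blast
    show ?thesis
    proof (rule bounded_ext_wshift)
      \<comment> \<open>Each product vanishes on a step out of I: if the intermediate index is
        already outside, the first factor applied is 0; otherwise the second one is.\<close>
      fix k assume k: "k \<in> I" "k + (\<tau> + \<delta>) \<notin> I"
      have "d \<delta> (k + \<tau>) * a k = 0"
        using van[OF k(1)] vand[OF \<delta>, of "k + \<tau>"] k(2) by (auto simp: add.assoc)
      moreover have "a (k + \<delta>) * d \<delta> k = 0"
        using vand[OF \<delta> k(1)] van[of "k + \<delta>"] k(2) by (auto simp: algebra_simps)
      ultimately show "?\<kappa> \<delta> k = 0" by (simp only: diff_self)
    qed (use N in \<open>auto simp: add.assoc\<close>)
  qed
  then have "bounded_ext I (\<lambda>v. \<Sum>\<delta>\<in>\<Delta>. wshift (\<tau> + \<delta>) (?\<kappa> \<delta>) v)"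
    by (rule bounded_ext_sum[OF \<Delta>])
  also have "?this \<longleftrightarrow> bounded_ext I (\<lambda>v. D (wshift \<tau> a v) - wshift \<tau> a (D v))"
    using comm by (intro bounded_ext_cong) simp
  finally show ?thesis
    using map bounded_ext_wshift[OF van M] by (simp add: regular_wrt_def)
qed

text \<open>The matrix of \<open>[D, T\<^sup>*]\<close> is minus the transpose of that of \<open>[D, T]\<close>.\<close>

lemma regular_wrt_wshift_adjoint:
  assumes \<Delta>: "finite \<Delta>" and D: "\<And>v. v \<in> cspan (ket ` I) \<Longrightarrow> D v = (\<Sum>\<delta>\<in>\<Delta>. wshift \<delta> (d \<delta>) v)"
    and vand: "\<And>\<delta> k. \<delta> \<in> \<Delta> \<Longrightarrow> k \<in> I \<Longrightarrow> k + \<delta> \<notin> I \<Longrightarrow> d \<delta> k = 0"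
    and sym: "\<And>\<delta>. \<delta> \<in> \<Delta> \<Longrightarrow> - \<delta> \<in> \<Delta>" "\<And>\<delta> k. \<delta> \<in> \<Delta> \<Longrightarrow> d (- \<delta>) k = d \<delta> (k - \<delta>)"
    and van: "\<And>k. k \<notin> I \<Longrightarrow> k + \<tau> \<in> I \<Longrightarrow> a k = 0"
    and M: "\<And>k. k \<in> I \<Longrightarrow> k + \<tau> \<in> I \<Longrightarrow> \<bar>a k\<bar> \<le> M"
    and N: "\<And>\<delta>. \<delta> \<in> \<Delta> \<Longrightarrow>
      \<exists>N. \<forall>k\<in>I. k + \<tau> + \<delta> \<in> I \<longrightarrow> \<bar>d \<delta> (k + \<tau>) * a k - a (k + \<delta>) * d \<delta> k\<bar> \<le> N"
  shows "regular_wrt I D (wshift (- \<tau>) (\<lambda>k. a (k - \<tau>)))"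
proof (rule regular_wrt_wshift[OF \<Delta> D vand])
  fix k assume "k \<in> I" "k + - \<tau> \<notin> I"
  then show "a (k - \<tau>) = 0" using van[of "k - \<tau>"] by simp
next
  fix k assume "k \<in> I" "k + - \<tau> \<in> I"
  then show "\<bar>a (k - \<tau>)\<bar> \<le> M" using M[of "k - \<tau>"] by simp
next
  fix \<delta> assume \<delta>: "\<delta> \<in> \<Delta>"
  obtain N where N: "\<And>k. k \<in> I \<Longrightarrow> k + \<tau> + - \<delta> \<in> I \<Longrightarrow>
      \<bar>d (- \<delta>) (k + \<tau>) * a k - a (k + - \<delta>) * d (- \<delta>) k\<bar> \<le> N"
    using N[OF sym(1)[OF \<delta>]] by blast
  \<comment> \<open>The entry leading from k to k - \<tau> + \<delta> is, up to sign, the entry of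
    the original commutator in the opposite direction; hence the source k - \<tau> + \<delta> and
    the step - \<delta>.\<close>
  have "\<bar>d \<delta> (k + - \<tau>) * a (k - \<tau>) - a (k + \<delta> - \<tau>) * d \<delta> k\<bar> \<le> N"
    if "k \<in> I" "k + - \<tau> + \<delta> \<in> I" for k
    using N[of "k - \<tau> + \<delta>"] that sym(2)[OF \<delta>] by (simp add: algebra_simps abs_minus_commute)
  then show "\<exists>N. \<forall>k\<in>I. k + - \<tau> + \<delta> \<in> I \<longrightarrow>
      \<bar>d \<delta> (k + - \<tau>) * a (k - \<tau>) - a (k + \<delta> - \<tau>) * d \<delta> k\<bar> \<le> N"
    by blast
qed

section \<open>Coefficients\<close>

text \<open>The q-number [x] without its exponential growth: [x] = q^(1-x) qcomp(x) / (1 - q^2). It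
  stays in [0, 1] for x >= 0 and is at least 1 - q^2 for x >= 1, so all growth and decay is visible
  in the powers of q.\<close>

definition qcomp :: "real \<Rightarrow> real \<Rightarrow> real" where
  "qcomp q x = 1 - q powr (2 * x)"

text \<open>The projection onto the down-spinors preserves the plane spanned by \<open>|l m n\<rangle>\<close> tensor spin
  \<open>1/2\<close> and \<open>|l (m+1) n\<rangle>\<close> tensor spin \<open>- 1/2\<close>. Its matrix there has diagonal \<open>down_diag q l m\<close>,
  \<open>1 - down_diag q l m\<close> and off-diagonal entries \<open>down_off q l m\<close>.\<close>

definition down_diag :: "real \<Rightarrow> real \<Rightarrow> real \<Rightarrow> real" where
  "down_diag q l m = q powr (2 * (l - m)) * qcomp q (l + m + 1) / qcomp q (2 * l + 1)"

definition down_off :: "real \<Rightarrow> real \<Rightarrow> real \<Rightarrow> real" where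
  "down_off q l m = q powr (l - m) * sqrt (qcomp q (l - m)) * sqrt (qcomp q (l + m + 1)) / qcomp q (2 * l + 1)"

context
  fixes q :: real
  assumes q: "0 < q" "q < 1"
begin

lemma one_minus_q2_pos: "0 < 1 - q\<^sup>2"
  using q by (simp add: power_less_one_iff)

lemma q_powr_le: "x \<le> y \<Longrightarrow> q powr y \<le> q powr x"
  using q by (intro powr_mono') auto

lemma qcomp_le_one: "qcomp q x \<le> 1"
  by (simp add: qcomp_def)

lemma qcomp_nonneg: "0 \<le> x \<Longrightarrow> 0 \<le> qcomp q x"
  using q_powr_le[of 0 "2 * x"] q by (simp add: qcomp_def)

lemma qcomp_ge: "1 \<le> x \<Longrightarrow> 1 - q\<^sup>2 \<le> qcomp q x"
  using q_powr_le[of 2 "2 * x"] q by (simp add: qcomp_def)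

lemma qcomp_pos: "1 \<le> x \<Longrightarrow> 0 < qcomp q x"
  using qcomp_ge[of x] one_minus_q2_pos by linarith

lemma qcomp_zero: "qcomp q 0 = 0"
  using q by (simp add: qcomp_def)

section \<open>Separating the powers of q from the coefficients\<close>

lemma sqrt_q_powr: "sqrt (q powr x) = q powr (x / 2)"
  using q by (simp add: powr_half_sqrt[symmetric] powr_powr)

lemma qnum_eq: "qnum q x = q powr (1 - x) * qcomp q x / (1 - q\<^sup>2)"
proof -
  have "q powr x - q powr (- x) = - (q powr (- x)) * qcomp q x"
    using q by (simp add: qcomp_def right_diff_distrib flip: powr_add)
  moreover have "q - inverse q = - ((1 - q\<^sup>2) / q)"
    using q by (simp add: field_simps power2_eq_square)
  moreover have "q powr (1 - x) = q * q powr (- x)"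
    using q powr_add[of q 1 "- x"] by simp
  ultimately show ?thesis
    using one_minus_q2_pos q by (simp only: qnum_def mult_minus_left minus_divide_left[symmetric] minus_divide_right[symmetric] minus_minus) simp
qed

lemma sqrt_qnum: "sqrt (qnum q x) = q powr ((1 - x) / 2) * sqrt (qcomp q x) / sqrt (1 - q\<^sup>2)"
  by (simp add: qnum_eq real_sqrt_mult real_sqrt_divide sqrt_q_powr)

text \<open>The factors 1 - q^2 cancel, as there are two above and two below. The identity holds for
  all real arguments because \<open>sqrt\<close> is extended to negative numbers as an odd function
  and so remains multiplicative.\<close>

lemma sqrt_qnum_ratio:
  "sqrt (qnum q x * qnum q y / (qnum q z * qnum q w)) =
   q powr ((z + w - x - y) / 2) * sqrt (qcomp q x * qcomp q y / (qcomp q z * qcomp q w))"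
proof -
  have *: "qnum q x * qnum q y / (qnum q z * qnum q w) =
      (q powr (1 - x) * q powr (1 - y) / (q powr (1 - z) * q powr (1 - w))) *
      (qcomp q x * qcomp q y / (qcomp q z * qcomp q w))"
    using one_minus_q2_pos by (simp add: qnum_eq mult_ac)
  have "q powr (1 - x) * q powr (1 - y) / (q powr (1 - z) * q powr (1 - w)) = q powr (z + w - x - y)"
    using q by (simp add: algebra_simps flip: powr_add powr_diff)
  then show ?thesis
    unfolding * by (simp only: real_sqrt_mult sqrt_q_powr)
qed

lemma q_powr_mult: "x + y = z \<Longrightarrow> q powr x * q powr y = q powr z"
  by (simp flip: powr_add)

lemma C_coeff_eq: "C_coeff q j \<mu> = sqrt (qcomp q (j - \<mu>)) / sqrt (qcomp q (2 * j))"
proof -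
  have "q powr (- (j + \<mu>) / 2) * q powr ((1 - (j - \<mu>)) / 2) = q powr ((1 - 2 * j) / 2)"
    by (rule q_powr_mult) (simp add: field_simps)
  moreover have "sqrt (1 - q\<^sup>2) > 0" "q powr ((1 - 2 * j) / 2) > 0"
    using one_minus_q2_pos q by auto
  ultimately show ?thesis
    unfolding C_coeff_def sqrt_qnum by (simp add: field_simps)
qed

text \<open>In C the powers of q cancel entirely; here q^(j-\<mu>) survives. This factor is the
  source of the decay of the projection away from the top of the ladder.\<close>

lemma S_coeff_eq: "S_coeff q j \<mu> = q powr (j - \<mu>) * sqrt (qcomp q (j + \<mu>)) / sqrt (qcomp q (2 * j))"
proof -
  have "q powr ((j - \<mu>) / 2) * q powr ((1 - (j + \<mu>)) / 2) = q powr (j - \<mu>) * q powr ((1 - 2 * j) / 2)"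
    unfolding powr_add[symmetric] by (rule arg_cong[of _ _ "(powr) q"]) (simp add: field_simps)
  moreover have "sqrt (1 - q\<^sup>2) > 0" "q powr ((1 - 2 * j) / 2) > 0"
    using one_minus_q2_pos q by auto
  ultimately show ?thesis
    unfolding S_coeff_def sqrt_qnum by (simp add: field_simps)
qed

text \<open>In this and the next three formulas the coefficient is split into a factor in l, n and a
  factor in l, m. D changes only m and the spin, so the first factor is common to both terms of the
  commutator and can be pulled out.\<close>

lemma A_plus_eq: "A_plus q l m n =
    sqrt (qcomp q (l + n + 1) / (qcomp q (2 * l + 1) * qcomp q (2 * l + 2))) * sqrt (qcomp q (l + m + 1))"
  using q unfolding A_plus_def sqrt_qnum_ratio
  by (simp add: field_simps flip: powr_add real_sqrt_mult)

lemma A_minus_eq: "A_minus q l m n =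
    q powr (l + n + 1) * sqrt (qcomp q (l - n) / (qcomp q (2 * l) * qcomp q (2 * l + 1))) *
    (q powr (l + m) * sqrt (qcomp q (l - m)))"
proof -
  have "q powr ((2 * l + m + n + 1) / 2) * q powr ((2 * l + (2 * l + 1) - (l - m) - (l - n)) / 2) =
      q powr (l + n + 1) * q powr (l + m)"
    unfolding powr_add[symmetric] by (rule arg_cong[of _ _ "(powr) q"]) (simp add: field_simps)
  then show ?thesis
    unfolding A_minus_def sqrt_qnum_ratio
    by (simp add: real_sqrt_mult real_sqrt_divide mult_ac)
qed

lemma B_plus_eq: "B_plus q l m n =
    q powr (l + n) * sqrt (qcomp q (l - n + 1) / (qcomp q (2 * l + 1) * qcomp q (2 * l + 2))) *
    sqrt (qcomp q (l + m + 1))"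
proof -
  have "q powr ((m + n - 1) / 2) * q powr ((2 * l + 1 + (2 * l + 2) - (l + m + 1) - (l - n + 1)) / 2) =
      q powr (l + n)"
    unfolding powr_add[symmetric] by (rule arg_cong[of _ _ "(powr) q"]) (simp add: field_simps)
  then show ?thesis
    unfolding B_plus_def sqrt_qnum_ratio
    by (simp add: real_sqrt_mult real_sqrt_divide mult_ac)
qed

lemma B_minus_eq: "B_minus q l m n =
    - sqrt (qcomp q (l + n) / (qcomp q (2 * l) * qcomp q (2 * l + 1))) *
    (q powr (l + m) * sqrt (qcomp q (l - m)))"
proof -
  have "q powr ((m + n - 1) / 2) * q powr ((2 * l + (2 * l + 1) - (l - m) - (l + n)) / 2) =
      q powr (l + m)"
    unfolding powr_add[symmetric] by (rule arg_cong[of _ _ "(powr) q"]) (simp add: field_simps)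
  then show ?thesis
    unfolding B_minus_def sqrt_qnum_ratio
    by (simp add: real_sqrt_mult real_sqrt_divide mult_ac)
qed

text \<open>Both denominators are at least 1 - q^2, so the quotient is at most 1/(1 - q^2)^2 and its
  root at most 1/(1 - q^2), the constant called L in the commutator estimates.\<close>

lemma sqrt_qcomp_ratio_le:
  assumes "0 \<le> x" "1 \<le> z" "1 \<le> w"
  shows "\<bar>sqrt (qcomp q x / (qcomp q z * qcomp q w))\<bar> \<le> 1 / (1 - q\<^sup>2)"
proof -
  have "(1 - q\<^sup>2)\<^sup>2 \<le> qcomp q z * qcomp q w"
    unfolding power2_eq_square[of "1 - q\<^sup>2"]
    using assms one_minus_q2_pos by (intro mult_mono qcomp_ge) (auto intro: qcomp_nonneg)
  then have "qcomp q x / (qcomp q z * qcomp q w) \<le> 1 / (1 - q\<^sup>2)\<^sup>2"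
    using one_minus_q2_pos qcomp_le_one qcomp_nonneg[OF assms(1)] by (intro frac_le) auto
  then have "sqrt (qcomp q x / (qcomp q z * qcomp q w)) \<le> sqrt (1 / (1 - q\<^sup>2)\<^sup>2)"
    by (simp only: real_sqrt_le_iff)
  moreover have "0 \<le> sqrt (qcomp q x / (qcomp q z * qcomp q w))"
    using assms by (simp add: qcomp_nonneg)
  ultimately show ?thesis
    using one_minus_q2_pos by (simp add: real_sqrt_divide)
qed

lemma q_powr_le_one: "0 \<le> x \<Longrightarrow> q powr x \<le> 1"
  using q_powr_le[of 0 x] q by simp

lemma damped_ratio_le:
  assumes "0 \<le> x" "0 \<le> y" "1 \<le> z" "1 \<le> w"
  shows "\<bar>q powr x * sqrt (qcomp q y / (qcomp q z * qcomp q w))\<bar> \<le> inverse (1 - q\<^sup>2)"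
proof -
  have "\<bar>q powr x\<bar> * \<bar>sqrt (qcomp q y / (qcomp q z * qcomp q w))\<bar> \<le> 1 * (1 / (1 - q\<^sup>2))"
    using assms sqrt_qcomp_ratio_le[OF assms(2-4)] by (intro mult_mono) (auto simp: q_powr_le_one)
  then show ?thesis by (simp add: abs_mult divide_inverse)
qed

section \<open>Estimates\<close>

lemma inverse_qcomp_le: "1 \<le> y \<Longrightarrow> inverse (qcomp q y) \<le> inverse (1 - q\<^sup>2)"
  using qcomp_ge one_minus_q2_pos by (intro le_imp_inverse_le) auto

text \<open>The numerator qcomp(x) - qcomp(y) is a difference of two powers of q, of which q^(2x) is
  the larger.\<close>

lemma qcomp_ratio_le:
  assumes "x \<le> y" "1 \<le> y"
  shows "\<bar>qcomp q x / qcomp q y - 1\<bar> \<le> q powr (2 * x) * inverse (1 - q\<^sup>2)"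
proof -
  have "qcomp q x / qcomp q y - 1 = (qcomp q x - qcomp q y) * inverse (qcomp q y)"
    using qcomp_pos[OF assms(2)] by (simp add: field_simps)
  moreover have "\<bar>qcomp q x - qcomp q y\<bar> \<le> q powr (2 * x)"
    using q_powr_le[of "2 * x" "2 * y"] assms(1) by (simp add: qcomp_def)
  ultimately show ?thesis
    using inverse_qcomp_le[OF assms(2)] qcomp_pos[OF assms(2)] by (simp add: abs_mult mult_mono)
qed

text \<open>Both quotients are within a multiple of q^(2(l+m+1)) of 1, so they are equally close to
  each other. The raising estimates draw part of their decay from here.\<close>

lemma qcomp_ratio_step:
  assumes "0 \<le> l" "- l - 1 \<le> m" "m \<le> l"
  shows "\<bar>qcomp q (l + m + 2) / qcomp q (2 * l + 2) - qcomp q (l + m + 1) / qcomp q (2 * l + 1)\<bar>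
    \<le> 2 * inverse (1 - q\<^sup>2) * q powr (2 * (l + m + 1))"
proof -
  have "\<bar>qcomp q (l + m + 2) / qcomp q (2 * l + 2) - 1\<bar> \<le> q powr (2 * (l + m + 2)) * inverse (1 - q\<^sup>2)"
    "\<bar>qcomp q (l + m + 1) / qcomp q (2 * l + 1) - 1\<bar> \<le> q powr (2 * (l + m + 1)) * inverse (1 - q\<^sup>2)"
    using assms by (intro qcomp_ratio_le; simp)+
  moreover have "q powr (2 * (l + m + 2)) * inverse (1 - q\<^sup>2) \<le> q powr (2 * (l + m + 1)) * inverse (1 - q\<^sup>2)"
    using one_minus_q2_pos by (intro mult_right_mono q_powr_le) auto
  ultimately show ?thesis by (simp add: algebra_simps)
qed

lemma sqrt_qcomp_le_one: "sqrt (qcomp q x) \<le> 1"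
  using qcomp_le_one by simp

lemma down_diag_le:
  assumes "0 \<le> l" "- l - 1 \<le> m"
  shows "\<bar>down_diag q l m\<bar> \<le> q powr (2 * (l - m)) * inverse (1 - q\<^sup>2)"
proof -
  have "qcomp q (l + m + 1) * inverse (qcomp q (2 * l + 1)) \<le> 1 * inverse (1 - q\<^sup>2)"
    using assms by (intro mult_mono qcomp_le_one inverse_qcomp_le) (auto intro: qcomp_nonneg)
  moreover have "0 \<le> qcomp q (l + m + 1)" "0 \<le> qcomp q (2 * l + 1)"
    using assms by (auto intro: qcomp_nonneg)
  ultimately show ?thesis
    by (simp add: down_diag_def abs_mult divide_inverse mult.assoc mult_left_mono)
qed

lemma down_off_le:
  assumes "0 \<le> l" "- l - 1 \<le> m" "m \<le> l"
  shows "\<bar>down_off q l m\<bar> \<le> q powr (l - m) * inverse (1 - q\<^sup>2)"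
proof -
  have "0 \<le> qcomp q (l - m)" "0 \<le> qcomp q (l + m + 1)" "0 \<le> qcomp q (2 * l + 1)"
    using assms by (auto intro: qcomp_nonneg)
  moreover have "sqrt (qcomp q (l - m)) * (sqrt (qcomp q (l + m + 1)) * inverse (qcomp q (2 * l + 1)))
      \<le> 1 * (1 * inverse (1 - q\<^sup>2))"
    using assms calculation by (intro mult_mono sqrt_qcomp_le_one inverse_qcomp_le) auto
  ultimately show ?thesis
    by (simp add: down_off_def abs_mult divide_inverse mult.assoc mult_left_mono)
qed

text \<open>Raising l and m together leaves l - m unchanged, so the prefactor q^(2(l-m)) is common
  and only the quotient varies. In the product with q^(2(l+m+1)) the variable m cancels, leaving
  q^(4l+2), which is weakened to the common rate q^(2l).\<close>

lemma down_diag_step: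
  assumes "0 \<le> l" "- l - 1 \<le> m" "m \<le> l"
  shows "\<bar>down_diag q (l + 1/2) (m + 1/2) - down_diag q l m\<bar> \<le> 2 * inverse (1 - q\<^sup>2) * q powr (2 * l)"
proof -
  have "down_diag q (l + 1/2) (m + 1/2) - down_diag q l m =
      q powr (2 * (l - m)) * (qcomp q (l + m + 2) / qcomp q (2 * l + 2) - qcomp q (l + m + 1) / qcomp q (2 * l + 1))"
    by (simp add: down_diag_def algebra_simps)
  then have "\<bar>down_diag q (l + 1/2) (m + 1/2) - down_diag q l m\<bar> =
      q powr (2 * (l - m)) * \<bar>qcomp q (l + m + 2) / qcomp q (2 * l + 2) - qcomp q (l + m + 1) / qcomp q (2 * l + 1)\<bar>"
    by (simp add: abs_mult)
  also have "\<dots> \<le> q powr (2 * (l - m)) * (2 * inverse (1 - q\<^sup>2) * q powr (2 * (l + m + 1)))"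
    using assms by (intro mult_left_mono qcomp_ratio_step) auto
  also have "\<dots> = 2 * inverse (1 - q\<^sup>2) * q powr (4 * l + 2)"
    by (simp add: algebra_simps flip: powr_add)
  also have "\<dots> \<le> 2 * inverse (1 - q\<^sup>2) * q powr (2 * l)"
    using assms one_minus_q2_pos by (intro mult_left_mono q_powr_le) auto
  finally show ?thesis .
qed

lemma down_off_half_step: "down_off q (l + 1/2) (m + 1/2) =
    q powr (l - m) * sqrt (qcomp q (l - m)) * sqrt (qcomp q (l + m + 2)) / qcomp q (2 * l + 2)"
proof -
  have "l + 1/2 - (m + 1/2) = l - m" "l + 1/2 + (m + 1/2) + 1 = l + m + 2" "2 * (l + 1/2) + 1 = 2 * l + 2"
    by simp_all
  then show ?thesis
    unfolding down_off_def by presburger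
qed

text \<open>Both terms have the same numerator z and differ only in their denominators qcomp(2l+2)
  and qcomp(2l+1). These are exponentially close in l, so |z| <= 1 is all that is needed of
  z.\<close>

lemma down_off_step_same:
  assumes "0 \<le> l" "- l - 1 \<le> m" "m \<le> l"
  shows "\<bar>down_off q (l + 1/2) (m + 1/2) * sqrt (qcomp q (l + m + 1)) - sqrt (qcomp q (l + m + 2)) * down_off q l m\<bar>
    \<le> (inverse (1 - q\<^sup>2))\<^sup>2 * q powr (2 * l)" (is "\<bar>?L\<bar> \<le> _")
proof -
  let ?x = "qcomp q (2 * l + 1)" and ?y = "qcomp q (2 * l + 2)"
  have xy: "0 < ?x" "0 < ?y"
    using assms by (auto intro: qcomp_pos)
  have nn: "0 \<le> qcomp q (l - m)" "0 \<le> qcomp q (l + m + 1)" "0 \<le> qcomp q (l + m + 2)"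
    using assms by (auto intro: qcomp_nonneg)
  define z where "z = q powr (l - m) * (sqrt (qcomp q (l - m)) * (sqrt (qcomp q (l + m + 1)) * sqrt (qcomp q (l + m + 2))))"
  have "z \<le> 1 * (1 * (1 * 1))"
    unfolding z_def using assms nn q_powr_le[of 0 "l - m"] q
    by (intro mult_mono sqrt_qcomp_le_one) auto
  then have z: "\<bar>z\<bar> \<le> 1"
    using nn by (auto simp: z_def)
  have "?L = z * (inverse ?y - inverse ?x)"
    unfolding down_off_half_step down_off_def z_def divide_inverse right_diff_distrib by (simp add: mult_ac add_ac)
  also have "inverse ?y - inverse ?x = (?x - ?y) * (inverse ?x * inverse ?y)"
    using xy by (simp add: field_simps)
  finally have "\<bar>?L\<bar> = \<bar>z\<bar> * (\<bar>?x - ?y\<bar> * (inverse ?x * inverse ?y))"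
    using xy by (simp add: abs_mult)
  also have "\<dots> \<le> 1 * (q powr (2 * l) * (inverse (1 - q\<^sup>2) * inverse (1 - q\<^sup>2)))"
  proof (intro mult_mono inverse_qcomp_le z)
    show "\<bar>?x - ?y\<bar> \<le> q powr (2 * l)"
    proof -
      have "q powr (2 * (2 * l + 2)) \<le> q powr (2 * (2 * l + 1))" "q powr (2 * (2 * l + 1)) \<le> q powr (2 * l)"
        using assms by (simp_all add: q_powr_le)
      then show ?thesis
        using powr_ge_zero[of q "2 * (2 * l + 2)"] unfolding qcomp_def by linarith
    qed
  qed (use xy assms one_minus_q2_pos in auto)
  finally show ?thesis
    by (simp add: power2_eq_square mult.commute)
qed

text \<open>Here the roots pair up to squares, which turns the difference into z times a difference
  of the quotients in \<open>qcomp_ratio_step\<close>. Now the decay of z is needed: q^(l-m)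
  q^(2(l+m+1)) = q^(2l) q^(l+m+2), with a nonnegative second exponent.\<close>

lemma down_off_step_cross:
  assumes "0 \<le> l" "- l - 1 \<le> m" "m \<le> l"
  shows "\<bar>down_off q (l + 1/2) (m + 1/2) * sqrt (qcomp q (l + m + 2)) - sqrt (qcomp q (l + m + 1)) * down_off q l m\<bar>
    \<le> 2 * inverse (1 - q\<^sup>2) * q powr (2 * l)" (is "\<bar>?L\<bar> \<le> _")
proof -
  have nn: "0 \<le> qcomp q (l - m)" "0 \<le> qcomp q (l + m + 1)" "0 \<le> qcomp q (l + m + 2)"
    using assms by (auto intro: qcomp_nonneg)
  define z where "z = q powr (l - m) * sqrt (qcomp q (l - m))"
  have z: "\<bar>z\<bar> \<le> q powr (l - m)"
    using nn mult_left_mono[OF sqrt_qcomp_le_one[of "l - m"], of "q powr (l - m)"] by (simp add: z_def)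
  have "?L = z * ((sqrt (qcomp q (l + m + 2)))\<^sup>2 / qcomp q (2 * l + 2) - (sqrt (qcomp q (l + m + 1)))\<^sup>2 / qcomp q (2 * l + 1))"
    unfolding down_off_half_step down_off_def z_def power2_eq_square divide_inverse right_diff_distrib
    by (simp add: mult_ac add_ac del: real_sqrt_mult_self)
  then have "\<bar>?L\<bar> = \<bar>z\<bar> * \<bar>qcomp q (l + m + 2) / qcomp q (2 * l + 2) - qcomp q (l + m + 1) / qcomp q (2 * l + 1)\<bar>"
    using nn by (simp add: abs_mult)
  also have "\<dots> \<le> q powr (l - m) * (2 * inverse (1 - q\<^sup>2) * q powr (2 * (l + m + 1)))"
    using assms by (intro mult_mono z qcomp_ratio_step) auto
  also have "\<dots> = 2 * inverse (1 - q\<^sup>2) * q powr (2 * l + (l + m + 2))"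
    by (simp add: algebra_simps flip: powr_add)
  also have "\<dots> \<le> 2 * inverse (1 - q\<^sup>2) * q powr (2 * l)"
    using assms one_minus_q2_pos by (intro mult_left_mono q_powr_le) auto
  finally show ?thesis .
qed

section \<open>Absorbing the linear growth of the eigenvalues\<close>

lemma linear_times_q_powr_bounded:
  obtains K where "K \<ge> 0" "\<And>l. 0 \<le> l \<Longrightarrow> (1 + l) * q powr (2 * l) \<le> K"
proof -
  \<comment> \<open>With this c one has q^(2l) = exp(- c l), and c l <= exp(c l) bounds l exp(- c l)
    by 1/c.\<close>
  define c where "c = - 2 * ln q"
  have c: "c > 0" using q by (simp add: c_def)
  have "(1 + l) * q powr (2 * l) \<le> 1 + 1 / c" if l: "0 \<le> l" for l
  proof -
    have e: "q powr (2 * l) = exp (- (c * l))"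
      using q by (simp add: powr_def c_def algebra_simps)
    have "c * l * exp (- (c * l)) \<le> exp (c * l) * exp (- (c * l))"
      using exp_ge_add_one_self[of "c * l"] by (intro mult_right_mono) (linarith, simp)
    then have "l * exp (- (c * l)) \<le> 1 / c"
      using c by (simp add: field_simps exp_minus_inverse)
    moreover have "exp (- (c * l)) \<le> 1"
      using mult_nonneg_nonneg[of c l] c l by simp
    ultimately show ?thesis
      unfolding e ring_distribs by linarith
  qed
  then show ?thesis
    using that[of "1 + 1 / c"] c by simp
qed

lemma linear_commutator_bound:
  fixes hc h0 K M :: real
  obtains N where "\<And>l l' X X'. 0 \<le> l \<Longrightarrow> \<bar>l' - l\<bar> = 1/2 \<Longrightarrow> \<bar>X' - X\<bar> \<le> K * q powr (2 * l) \<Longrightarrow> \<bar>X'\<bar> \<le> M \<Longrightarrow>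
     \<bar>(hc * l' + h0) * X' - (hc * l + h0) * X\<bar> \<le> N"
proof -
  obtain L where L: "L \<ge> 0" "\<And>l. 0 \<le> l \<Longrightarrow> (1 + l) * q powr (2 * l) \<le> L"
    using linear_times_q_powr_bounded by blast
  define H where "H = \<bar>hc\<bar> + \<bar>h0\<bar>"
  have "\<bar>(hc * l' + h0) * X' - (hc * l + h0) * X\<bar> \<le> H * \<bar>K\<bar> * L + \<bar>hc\<bar> * M"
    if l: "0 \<le> l" and d: "\<bar>l' - l\<bar> = 1/2" and X: "\<bar>X' - X\<bar> \<le> K * q powr (2 * l)" and X': "\<bar>X'\<bar> \<le> M" for l l' X X'
  proof -
    have "\<bar>hc * l + h0\<bar> \<le> \<bar>hc\<bar> * l + \<bar>h0\<bar>"
      using l abs_triangle_ineq[of "hc * l" h0] by (simp add: abs_mult)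
    also have "\<dots> \<le> H * (1 + l)"
      using l mult_nonneg_nonneg[OF abs_ge_zero[of h0] l] by (simp add: H_def algebra_simps)
    finally have h: "\<bar>hc * l + h0\<bar> \<le> H * (1 + l)" .
    have "\<bar>X' - X\<bar> \<le> \<bar>K\<bar> * q powr (2 * l)"
      using X by (rule order_trans) (simp add: mult_right_mono)
    then have "\<bar>hc * l + h0\<bar> * \<bar>X' - X\<bar> \<le> (H * (1 + l)) * (\<bar>K\<bar> * q powr (2 * l))"
      using h l by (intro mult_mono) (auto simp: H_def)
    also have "\<dots> = H * \<bar>K\<bar> * ((1 + l) * q powr (2 * l))"
      by simp
    also have "\<dots> \<le> H * \<bar>K\<bar> * L"
      using L(2)[OF l] by (intro mult_left_mono) (auto simp: H_def)
    finally have 1: "\<bar>hc * l + h0\<bar> * \<bar>X' - X\<bar> \<le> H * \<bar>K\<bar> * L" .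
    have 2: "\<bar>hc * (l' - l)\<bar> * \<bar>X'\<bar> \<le> \<bar>hc\<bar> * M"
      using d X' unfolding abs_mult by (intro mult_mono) (auto intro: mult_left_le)
    \<comment> \<open>Discrete product rule: in the first summand the linear factor meets the
      exponentially small difference, in the second it contributes only its bounded
      increment.\<close>
    have "(hc * l' + h0) * X' - (hc * l + h0) * X = (hc * l + h0) * (X' - X) + hc * (l' - l) * X'"
      by (simp add: algebra_simps)
    then have "\<bar>(hc * l' + h0) * X' - (hc * l + h0) * X\<bar> \<le> \<bar>hc * l + h0\<bar> * \<bar>X' - X\<bar> + \<bar>hc * (l' - l)\<bar> * \<bar>X'\<bar>"
      by (metis abs_mult abs_triangle_ineq)
    then show ?thesis using 1 2 by linarith
  qed
  then show ?thesis by (rule that)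
qed

end

section \<open>Index sets\<close>

text \<open>With K = 2l, a = l + m and b = l + n the index set becomes a set of natural triples, and
  every boundary question about half-integers a comparison of naturals.\<close>

lemma psi_index_iff:
  "(l, m, n) \<in> psi_index \<longleftrightarrow>
   (\<exists>K a b :: nat. a \<le> K \<and> b \<le> K \<and> l = real K / 2 \<and> m = real a - real K / 2 \<and> n = real b - real K / 2)"
  (is "?L \<longleftrightarrow> ?R")
proof
  assume ?L
  then obtain K a b :: nat where "l = real K / 2" "m = - l + real a" "n = - l + real b" "m \<le> l" "n \<le> l"
    by (auto simp: psi_index_def half_nats_def ladder_def)
  then show ?R
    by (intro exI[of _ K] exI[of _ a] exI[of _ b]) auto
next
  assume ?R
  then obtain K a b :: nat where *: "a \<le> K" "b \<le> K" "l = real K / 2" "m = real a - real K / 2" "n = real b - real K / 2"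
    by blast
  then have "m = - l + real a" "n = - l + real b" "m \<le> l" "n \<le> l" "l \<in> half_nats"
    by (auto simp: half_nats_def)
  then show ?L
    by (auto simp: psi_index_def ladder_def)
qed

lemma psi_indexD:
  assumes "(l, m, n) \<in> psi_index"
  shows "0 \<le> l" "- l \<le> m" "m \<le> l" "- l \<le> n" "n \<le> l"
  using assms by (auto simp: psi_index_iff)

lemma psi_indexI:
  fixes K a b :: nat
  assumes "a \<le> K" "b \<le> K" "l = real K / 2" "m = real a - real K / 2" "n = real b - real K / 2"
  shows "(l, m, n) \<in> psi_index"
  using assms by (auto simp: psi_index_iff)

lemma psi_index_up:
  assumes "(l, m, n) \<in> psi_index"
  shows "(l + 1/2, m + 1/2, n + 1/2) \<in> psi_index" "(l + 1/2, m + 1/2, n - 1/2) \<in> psi_index"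
proof -
  obtain K a b :: nat where *: "a \<le> K" "b \<le> K" "l = real K / 2" "m = real a - real K / 2" "n = real b - real K / 2"
    using assms unfolding psi_index_iff by blast
  show "(l + 1/2, m + 1/2, n + 1/2) \<in> psi_index"
    by (rule psi_indexI[of "a + 1" "K + 1" "b + 1"]) (use * in \<open>auto simp: field_simps\<close>)
  show "(l + 1/2, m + 1/2, n - 1/2) \<in> psi_index"
    by (rule psi_indexI[of "a + 1" "K + 1" b]) (use * in \<open>auto simp: field_simps\<close>)
qed

lemma psi_index_m_step:
  assumes "(l, m, n) \<in> psi_index"
  shows "m \<noteq> l \<Longrightarrow> (l, m + 1, n) \<in> psi_index" "m \<noteq> - l \<Longrightarrow> (l, m - 1, n) \<in> psi_index"
proof -
  obtain K a b :: nat where *: "a \<le> K" "b \<le> K" "l = real K / 2" "m = real a - real K / 2" "n = real b - real K / 2"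
    using assms unfolding psi_index_iff by blast
  show "(l, m + 1, n) \<in> psi_index" if "m \<noteq> l"
    by (rule psi_indexI[of "a + 1" K b]) (use * that le_neq_implies_less[of a K] in auto)
  show "(l, m - 1, n) \<in> psi_index" if "m \<noteq> - l"
    by (rule psi_indexI[of "a - 1" K b]) (use * that in auto)
qed

lemma psi_index_down:
  assumes "(l, m, n) \<in> psi_index" "m \<noteq> l"
  shows "n \<noteq> l \<Longrightarrow> (l - 1/2, m + 1/2, n + 1/2) \<in> psi_index"
    and "n \<noteq> - l \<Longrightarrow> (l - 1/2, m + 1/2, n - 1/2) \<in> psi_index"
proof -
  obtain K a b :: nat where *: "a \<le> K" "b \<le> K" "l = real K / 2" "m = real a - real K / 2" "n = real b - real K / 2"
    using assms unfolding psi_index_iff by blast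
  have aK: "a < K"
    using * assms(2) by (cases "a = K") auto
  show "(l - 1/2, m + 1/2, n + 1/2) \<in> psi_index" if "n \<noteq> l"
  proof -
    have "b < K" using * that by (cases "b = K") auto
    then show ?thesis
      by (intro psi_indexI[of a "K - 1" b]) (use * aK in \<open>auto simp: of_nat_diff field_simps\<close>)
  qed
  show "(l - 1/2, m + 1/2, n - 1/2) \<in> psi_index" if "n \<noteq> - l"
  proof -
    have "0 < b" using * that by (cases "b = 0") auto
    then show ?thesis
      by (intro psi_indexI[of a "K - 1" "b - 1"]) (use * aK in \<open>auto simp: of_nat_diff field_simps\<close>)
  qed
qed

text \<open>A raising step enters the index set from outside only along these edges. There a factor
  qcomp(0) annihilates the raising coefficient, which the adjoint shift requires.\<close>

lemma psi_index_up_converse: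
  shows "(l + 1/2, m + 1/2, n + 1/2) \<in> psi_index \<Longrightarrow> m \<noteq> - l - 1 \<Longrightarrow> n \<noteq> - l - 1 \<Longrightarrow> (l, m, n) \<in> psi_index"
    and "(l + 1/2, m + 1/2, n - 1/2) \<in> psi_index \<Longrightarrow> m \<noteq> - l - 1 \<Longrightarrow> n \<noteq> l + 1 \<Longrightarrow> (l, m, n) \<in> psi_index"
proof -
  assume mem: "(l + 1/2, m + 1/2, n + 1/2) \<in> psi_index" and ne: "m \<noteq> - l - 1" "n \<noteq> - l - 1"
  obtain K a b :: nat where *: "a \<le> K" "b \<le> K" "l + 1/2 = real K / 2"
      "m + 1/2 = real a - real K / 2" "n + 1/2 = real b - real K / 2"
    using mem unfolding psi_index_iff by blast
  have "0 < a" "0 < b" using * ne by (cases "a = 0"; cases "b = 0"; auto)+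
  then show "(l, m, n) \<in> psi_index"
    by (intro psi_indexI[of "a - 1" "K - 1" "b - 1"]) (use * in \<open>auto simp: of_nat_diff field_simps\<close>)
next
  assume mem: "(l + 1/2, m + 1/2, n - 1/2) \<in> psi_index" and ne: "m \<noteq> - l - 1" "n \<noteq> l + 1"
  obtain K a b :: nat where *: "a \<le> K" "b \<le> K" "l + 1/2 = real K / 2"
      "m + 1/2 = real a - real K / 2" "n - 1/2 = real b - real K / 2"
    using mem unfolding psi_index_iff by blast
  have "0 < a" using * ne by (cases "a = 0") auto
  moreover have "b < K" using * ne by (cases "b = K") auto
  ultimately show "(l, m, n) \<in> psi_index"
    by (intro psi_indexI[of "a - 1" "K - 1" b]) (use * in \<open>auto simp: of_nat_diff field_simps\<close>)
qed

lemma psi_index_down_converse: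
  shows "(l - 1/2, m + 1/2, n + 1/2) \<in> psi_index \<Longrightarrow> (l, m, n) \<in> psi_index"
    and "(l - 1/2, m + 1/2, n - 1/2) \<in> psi_index \<Longrightarrow> (l, m, n) \<in> psi_index"
proof -
  assume "(l - 1/2, m + 1/2, n + 1/2) \<in> psi_index"
  then obtain K a b :: nat where *: "a \<le> K" "b \<le> K" "l - 1/2 = real K / 2"
      "m + 1/2 = real a - real K / 2" "n + 1/2 = real b - real K / 2"
    unfolding psi_index_iff by blast
  show "(l, m, n) \<in> psi_index"
    by (rule psi_indexI[of a "K + 1" b]) (use * in \<open>auto simp: field_simps\<close>)
next
  assume "(l - 1/2, m + 1/2, n - 1/2) \<in> psi_index"
  then obtain K a b :: nat where *: "a \<le> K" "b \<le> K" "l - 1/2 = real K / 2"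
      "m + 1/2 = real a - real K / 2" "n - 1/2 = real b - real K / 2"
    unfolding psi_index_iff by blast
  show "(l, m, n) \<in> psi_index"
    by (rule psi_indexI[of a "K + 1" "b + 1"]) (use * in \<open>auto simp: field_simps\<close>)
qed

section \<open>Commutators of the generators\<close>

text \<open>Raising m by 1 while lowering the spin by 1 preserves m plus spin, that is, the label
  \<mu> of the spinors; these are the two kets of one block of D.\<close>

definition spin_flip :: "(real \<times> real \<times> real) \<times> real" where
  "spin_flip = ((0, 1, 0), - 1)"

definition spin_steps :: "((real \<times> real \<times> real) \<times> real) set" where
  "spin_steps = {0, spin_flip, - spin_flip}"

definition spin_free :: "(real \<Rightarrow> real \<Rightarrow> real \<Rightarrow> real) \<Rightarrow> (real \<times> real \<times> real) \<times> real \<Rightarrow> real" where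
  "spin_free a = (\<lambda>k. case fst k of (l, m, n) \<Rightarrow> a l m n)"

text \<open>\<open>D\<close> is the sum of the weighted shifts by \<open>0\<close> and \<open>\<plusminus> spin_flip\<close>, for the eigenvalue
  \<open>f(l) = fc * l + f0\<close> on up-spinors and \<open>f(l) + h(l)\<close>, \<open>h(l) = hc * l + h0\<close>, on down-spinors.\<close>

definition dirac_coeff :: "real \<Rightarrow> real \<Rightarrow> real \<Rightarrow> real \<Rightarrow> real \<Rightarrow>
    (real \<times> real \<times> real) \<times> real \<Rightarrow> (real \<times> real \<times> real) \<times> real \<Rightarrow> real" where
  "dirac_coeff q fc f0 hc h0 \<delta> = (\<lambda>((l, m, n), s).
     if \<delta> = 0 then fc * l + f0 + (hc * l + h0) * (if s = 1/2 then down_diag q l m else 1 - down_diag q l (m - 1))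
     else if \<delta> = spin_flip then (if s = 1/2 then (hc * l + h0) * down_off q l m else 0)
     else (if s = - 1/2 then (hc * l + h0) * down_off q l (m - 1) else 0))"

lemma spin_flip_simps:
  "spin_flip \<noteq> 0" "- spin_flip \<noteq> 0" "- spin_flip \<noteq> spin_flip" "spin_flip \<noteq> - spin_flip"
  by (auto simp: spin_flip_def zero_prod_def)

lemma finite_spin_steps: "finite spin_steps"
  by (simp add: spin_steps_def)

lemma uminus_spin_steps: "\<delta> \<in> spin_steps \<Longrightarrow> - \<delta> \<in> spin_steps"
  by (auto simp: spin_steps_def)

text \<open>The matrix of D is real and symmetric: the entry from k to k - \<delta> equals the entry
  from k - \<delta> to k.\<close>

lemma dirac_coeff_sym:
  assumes "\<delta> \<in> spin_steps"
  shows "dirac_coeff q fc f0 hc h0 (- \<delta>) k = dirac_coeff q fc f0 hc h0 \<delta> (k - \<delta>)"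
proof -
  obtain l m n s where k: "k = ((l, m, n), s)"
    by (metis prod.exhaust)
  consider "\<delta> = 0" | "\<delta> = spin_flip" | "\<delta> = - spin_flip"
    using assms by (auto simp: spin_steps_def)
  then show ?thesis
  proof cases
    case 2
    have "s + 1 = 1/2 \<longleftrightarrow> s = - 1/2" by linarith
    then show ?thesis
      using spin_flip_simps by (simp add: 2 k dirac_coeff_def) (simp add: spin_flip_def)
  next
    case 3
    have "s - 1 = - 1/2 \<longleftrightarrow> s = 1/2" by linarith
    then show ?thesis
      using spin_flip_simps by (simp add: 3 k dirac_coeff_def) (simp add: spin_flip_def)
  qed simp
qed

context
  fixes q :: real
  assumes q: "0 < q" "q < 1"
begin

text \<open>At m = l with spin 1/2, and at m = - l with spin - 1/2, the block of D is
  one-dimensional. The missing partner is suppressed because one of the factors of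
  \<open>down_off\<close> is then the root of qcomp(0).\<close>

lemma dirac_coeff_boundary:
  assumes "\<delta> \<in> spin_steps" "k \<in> spinor_index" "k + \<delta> \<notin> spinor_index"
  shows "dirac_coeff q fc f0 hc h0 \<delta> k = 0"
proof -
  obtain l m n s where k: "k = ((l, m, n), s)"
    by (metis prod.exhaust)
  have mem: "(l, m, n) \<in> psi_index" "s = 1/2 \<or> s = - 1/2"
    using assms(2) by (auto simp: k spinor_index_def)
  consider "\<delta> = 0" | "\<delta> = spin_flip" | "\<delta> = - spin_flip"
    using assms(1) by (auto simp: spin_steps_def)
  then show ?thesis
  proof cases
    case 2
    show ?thesis
    proof (cases "s = 1/2")
      case True
      then have "(l, m + 1, n) \<notin> psi_index"
        using assms(3) by (auto simp: 2 k spin_flip_def spinor_index_def)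
      then have "m = l"
        using psi_index_m_step(1)[OF mem(1)] by blast
      then show ?thesis
        using spin_flip_simps by (simp add: 2 k dirac_coeff_def down_off_def qcomp_zero[OF q])
    qed (use spin_flip_simps in \<open>simp add: 2 k dirac_coeff_def\<close>)
  next
    case 3
    show ?thesis
    proof (cases "s = - 1/2")
      case True
      then have "(l, m - 1, n) \<notin> psi_index"
        using assms(3) by (auto simp: 3 k spin_flip_def spinor_index_def)
      then have "m = - l"
        using psi_index_m_step(2)[OF mem(1)] by blast
      then show ?thesis
        using spin_flip_simps by (simp add: 3 k dirac_coeff_def down_off_def qcomp_zero[OF q])
    qed (use spin_flip_simps in \<open>simp add: 3 k dirac_coeff_def\<close>)
  qed (use assms in simp)
qed

lemma A_plus_boundary:
  assumes "(l, m, n) \<notin> psi_index" "(l + 1/2, m + 1/2, n + 1/2) \<in> psi_index"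
  shows "A_plus q l m n = 0"
proof -
  have "l + m + 1 = 0 \<or> l + n + 1 = 0"
    using psi_index_up_converse(1)[OF assms(2)] assms(1) by force
  then show ?thesis by (auto simp: A_plus_eq[OF q] qcomp_zero[OF q])
qed

lemma B_plus_boundary:
  assumes "(l, m, n) \<notin> psi_index" "(l + 1/2, m + 1/2, n + - 1/2) \<in> psi_index"
  shows "B_plus q l m n = 0"
proof -
  have "l + m + 1 = 0 \<or> l - n + 1 = 0"
    using psi_index_up_converse(2)[of l m n] assms by force
  then show ?thesis by (auto simp: B_plus_eq[OF q] qcomp_zero[OF q])
qed

text \<open>The f-part of D is diagonal and contributes only fc * \<epsilon> times the coefficient
  of the shift. What remains is h(l') X' - h(l) X, with X' and X the entries of P x and x P; the
  three groups of bounds concern the diagonal and the two off-diagonal parts of P.\<close>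

lemma dirac_commutator_bounded:
  fixes a :: "real \<Rightarrow> real \<Rightarrow> real \<Rightarrow> real"
  assumes \<epsilon>: "\<bar>\<epsilon>\<bar> = 1/2"
    and diag: "\<And>l m n. (l, m, n) \<in> psi_index \<Longrightarrow> (l + \<epsilon>, m + 1/2, n + \<nu>) \<in> psi_index \<Longrightarrow>
       \<bar>a l m n\<bar> \<le> M \<and> \<bar>down_diag q (l + \<epsilon>) (m + 1/2)\<bar> \<le> M \<and> \<bar>1 - down_diag q (l + \<epsilon>) (m - 1/2)\<bar> \<le> M \<and>
       \<bar>a l m n * (down_diag q (l + \<epsilon>) (m + 1/2) - down_diag q l m)\<bar> \<le> K * q powr (2 * l) \<and>
       \<bar>a l m n * (down_diag q (l + \<epsilon>) (m - 1/2) - down_diag q l (m - 1))\<bar> \<le> K * q powr (2 * l)"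
    and up: "\<And>l m n. (l, m, n) \<in> psi_index \<Longrightarrow> (l + \<epsilon>, m + 3/2, n + \<nu>) \<in> psi_index \<Longrightarrow>
       \<bar>down_off q (l + \<epsilon>) (m + 1/2) * a l m n\<bar> \<le> M \<and>
       \<bar>down_off q (l + \<epsilon>) (m + 1/2) * a l m n - a l (m + 1) n * down_off q l m\<bar> \<le> K * q powr (2 * l)"
    and down: "\<And>l m n. (l, m, n) \<in> psi_index \<Longrightarrow> (l + \<epsilon>, m - 1/2, n + \<nu>) \<in> psi_index \<Longrightarrow>
       \<bar>down_off q (l + \<epsilon>) (m - 1/2) * a l m n\<bar> \<le> M \<and>
       \<bar>down_off q (l + \<epsilon>) (m - 1/2) * a l m n - a l (m - 1) n * down_off q l (m - 1)\<bar> \<le> K * q powr (2 * l)"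
    and \<delta>: "\<delta> \<in> spin_steps"
  defines "\<tau> \<equiv> ((\<epsilon>, 1/2, \<nu>), 0)"
  shows "\<exists>N. \<forall>k\<in>spinor_index. k + \<tau> + \<delta> \<in> spinor_index \<longrightarrow>
    \<bar>dirac_coeff q fc f0 hc h0 \<delta> (k + \<tau>) * spin_free a k - spin_free a (k + \<delta>) * dirac_coeff q fc f0 hc h0 \<delta> k\<bar> \<le> N"
proof -
  \<comment> \<open>The diagonal entries are products of two numbers bounded by M, the off-diagonal
    ones are bounded by M directly; M^2 + M covers both.\<close>
  obtain N where N: "\<And>l l' X X'. 0 \<le> l \<Longrightarrow> \<bar>l' - l\<bar> = 1/2 \<Longrightarrow> \<bar>X' - X\<bar> \<le> K * q powr (2 * l) \<Longrightarrow> \<bar>X'\<bar> \<le> M\<^sup>2 + M \<Longrightarrow>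
     \<bar>(hc * l' + h0) * X' - (hc * l + h0) * X\<bar> \<le> N"
    using linear_commutator_bound[OF q, of K "M\<^sup>2 + M" hc h0] by blast
  have MM: "x \<le> M\<^sup>2 + M" if "x \<le> M" for x
    using that by (simp add: add_increasing)
  have "\<bar>dirac_coeff q fc f0 hc h0 \<delta> (k + \<tau>) * spin_free a k - spin_free a (k + \<delta>) * dirac_coeff q fc f0 hc h0 \<delta> k\<bar> \<le> \<bar>fc\<bar> * M + \<bar>N\<bar>"
    if k: "k \<in> spinor_index" and k': "k + \<tau> + \<delta> \<in> spinor_index" for k
  proof -
    obtain l m n s where kk: "k = ((l, m, n), s)"
      by (metis prod.exhaust)
    have mem: "(l, m, n) \<in> psi_index" and s: "s = 1/2 \<or> s = - 1/2"
      using k by (auto simp: kk spinor_index_def)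
    have l: "0 \<le> l" "\<bar>l + \<epsilon> - l\<bar> = 1/2"
      using psi_indexD[OF mem] \<epsilon> by auto
    consider "\<delta> = 0" | "\<delta> = spin_flip" | "\<delta> = - spin_flip"
      using \<delta> by (auto simp: spin_steps_def)
    then show ?thesis
    proof cases
      case 1
      have mem': "(l + \<epsilon>, m + 1/2, n + \<nu>) \<in> psi_index"
        using k' by (auto simp: 1 kk \<tau>_def spinor_index_def)
      note D = diag[OF mem mem']
      have M: "0 \<le> M" using D abs_ge_zero[of "a l m n"] by linarith
      have "\<bar>\<epsilon>\<bar> * \<bar>a l m n\<bar> \<le> 1 * M"
        using D \<epsilon> M by (intro mult_mono) auto
      then have "\<bar>fc * \<epsilon> * a l m n\<bar> \<le> \<bar>fc\<bar> * M"
        by (simp add: abs_mult mult.assoc mult_left_mono)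
      moreover define P' where "P' = (if s = 1/2 then down_diag q (l + \<epsilon>) (m + 1/2) else 1 - down_diag q (l + \<epsilon>) (m - 1/2))"
      moreover define P where "P = (if s = 1/2 then down_diag q l m else 1 - down_diag q l (m - 1))"
      have P': "\<bar>a l m n * P'\<bar> \<le> M\<^sup>2 + M"
      proof -
        have "\<bar>P'\<bar> \<le> M" using D by (simp add: P'_def)
        then have "\<bar>a l m n\<bar> * \<bar>P'\<bar> \<le> M * M" using D M by (intro mult_mono) auto
        then show ?thesis using M by (simp add: abs_mult power2_eq_square)
      qed
      \<comment> \<open>For spin - 1/2 the diagonal entries are 1 minus \<open>down_diag\<close>;
        the ones cancel in the difference and only a sign remains.\<close>
      have "a l m n * P' - a l m n * P = (if s = 1/2 then 1 else - 1) * (a l m n * (if s = 1/2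
          then down_diag q (l + \<epsilon>) (m + 1/2) - down_diag q l m else down_diag q (l + \<epsilon>) (m - 1/2) - down_diag q l (m - 1)))"
        by (simp add: P'_def P_def algebra_simps)
      then have "\<bar>a l m n * P' - a l m n * P\<bar> \<le> K * q powr (2 * l)"
        using D by (simp split: if_splits)
      then have "\<bar>(hc * (l + \<epsilon>) + h0) * (a l m n * P') - (hc * l + h0) * (a l m n * P)\<bar> \<le> N"
        using l P' by (intro N)
      moreover have "dirac_coeff q fc f0 hc h0 \<delta> (k + \<tau>) * spin_free a k - spin_free a (k + \<delta>) * dirac_coeff q fc f0 hc h0 \<delta> k =
          fc * \<epsilon> * a l m n + ((hc * (l + \<epsilon>) + h0) * (a l m n * P') - (hc * l + h0) * (a l m n * P))"
        by (simp add: dirac_coeff_def 1 kk \<tau>_def spin_free_def P'_def P_def algebra_simps)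
      ultimately show ?thesis by linarith
    next
      case 2
      \<comment> \<open>From spin - 1/2 the flip would lead to spin - 3/2, so a target inside the
        index set forces spin 1/2.\<close>
      have s: "s = 1/2" and mem': "(l + \<epsilon>, m + 3/2, n + \<nu>) \<in> psi_index"
        using k' s by (auto simp: 2 kk \<tau>_def spin_flip_def spinor_index_def algebra_simps)
      note D = up[OF mem mem']
      have M: "0 \<le> M" using D by linarith
      have "\<bar>(hc * (l + \<epsilon>) + h0) * (down_off q (l + \<epsilon>) (m + 1/2) * a l m n) - (hc * l + h0) * (a l (m + 1) n * down_off q l m)\<bar> \<le> N"
        using D l by (intro N) (auto intro: MM)
      moreover have "dirac_coeff q fc f0 hc h0 \<delta> (k + \<tau>) * spin_free a k - spin_free a (k + \<delta>) * dirac_coeff q fc f0 hc h0 \<delta> k =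
          (hc * (l + \<epsilon>) + h0) * (down_off q (l + \<epsilon>) (m + 1/2) * a l m n) - (hc * l + h0) * (a l (m + 1) n * down_off q l m)"
        using spin_flip_simps by (simp add: dirac_coeff_def 2 s kk \<tau>_def spin_free_def) (simp add: spin_flip_def)
      ultimately show ?thesis using mult_nonneg_nonneg[OF abs_ge_zero[of fc] M] by linarith
    next
      case 3
      have s: "s = - 1/2" and mem': "(l + \<epsilon>, m - 1/2, n + \<nu>) \<in> psi_index"
        using k' s by (auto simp: 3 kk \<tau>_def spin_flip_def spinor_index_def algebra_simps)
      note D = down[OF mem mem']
      have M: "0 \<le> M" using D by linarith
      have "\<bar>(hc * (l + \<epsilon>) + h0) * (down_off q (l + \<epsilon>) (m - 1/2) * a l m n) - (hc * l + h0) * (a l (m - 1) n * down_off q l (m - 1))\<bar> \<le> N"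
        using D l by (intro N) (auto intro: MM)
      moreover have "dirac_coeff q fc f0 hc h0 \<delta> (k + \<tau>) * spin_free a k - spin_free a (k + \<delta>) * dirac_coeff q fc f0 hc h0 \<delta> k =
          (hc * (l + \<epsilon>) + h0) * (down_off q (l + \<epsilon>) (m - 1/2) * a l m n) - (hc * l + h0) * (a l (m - 1) n * down_off q l (m - 1))"
        using spin_flip_simps by (simp add: dirac_coeff_def 3 s kk \<tau>_def spin_free_def) (simp add: spin_flip_def)
      ultimately show ?thesis using mult_nonneg_nonneg[OF abs_ge_zero[of fc] M] by linarith
    qed
  qed
  then show ?thesis by blast
qed

text \<open>On the diagonal the whole coefficient can be pulled out and the variation of
  \<open>down_diag\<close> remains. Across a flip m changes, so only \<alpha> can be pulled out;
  what remains is \<open>down_off_step_same\<close> for the flip and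
  \<open>down_off_step_cross\<close> for its inverse.\<close>

lemma dirac_commutator_bounded_plus:
  assumes a: "\<And>l m n. a l m n = \<alpha> l n * sqrt (qcomp q (l + m + 1))"
    and \<alpha>: "\<And>l m n. (l, m, n) \<in> psi_index \<Longrightarrow> \<bar>\<alpha> l n\<bar> \<le> inverse (1 - q\<^sup>2)"
    and \<delta>: "\<delta> \<in> spin_steps"
  shows "\<exists>N. \<forall>k\<in>spinor_index. k + ((1/2, 1/2, \<nu>), 0) + \<delta> \<in> spinor_index \<longrightarrow>
    \<bar>dirac_coeff q fc f0 hc h0 \<delta> (k + ((1/2, 1/2, \<nu>), 0)) * spin_free a k -
     spin_free a (k + \<delta>) * dirac_coeff q fc f0 hc h0 \<delta> k\<bar> \<le> N"
proof -
  define L where "L = inverse (1 - q\<^sup>2)"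
  have L: "1 \<le> L" "0 \<le> L"
    using one_minus_q2_pos[OF q] q by (auto simp: L_def one_le_inverse_iff)
  have sqrt_le: "\<bar>sqrt (qcomp q x)\<bar> \<le> 1" if "0 \<le> x" for x
    using sqrt_qcomp_le_one[OF q, of x] qcomp_nonneg[OF q that] by simp
  have down_diag_bd: "\<bar>down_diag q l m\<bar> \<le> L" if "0 \<le> l" "- l - 1 \<le> m" "m \<le> l" for l m
    using down_diag_le[OF q that(1,2)] mult_right_mono[OF q_powr_le[OF q, of 0 "2 * (l - m)"] L(2)] that q
    by (simp add: L_def)
  have down_off_bd: "\<bar>down_off q l m\<bar> \<le> L" if "0 \<le> l" "- l - 1 \<le> m" "m \<le> l" for l m
    using down_off_le[OF q that] mult_right_mono[OF q_powr_le[OF q, of 0 "l - m"] L(2)] that q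
    by (simp add: L_def)
  have a_bd: "\<bar>a l m' n\<bar> \<le> L" if "(l, m, n) \<in> psi_index" "- l - 1 \<le> m'" for l m m' n
    using mult_mono[OF \<alpha>[OF that(1)] sqrt_le[of "l + m' + 1"]] that(2) L
    by (simp add: a abs_mult L_def)
  have step: "\<bar>x * y\<bar> \<le> 2 * L * L\<^sup>2 * q powr (2 * l)"
    if "\<bar>x\<bar> \<le> L" "\<bar>y\<bar> \<le> c * q powr (2 * l)" "c \<le> 2 * L\<^sup>2" for x y l c :: real
  proof -
    have "\<bar>y\<bar> \<le> 2 * L\<^sup>2 * q powr (2 * l)"
      using that(2) mult_right_mono[OF that(3), of "q powr (2 * l)"] by simp
    then have "\<bar>x\<bar> * \<bar>y\<bar> \<le> L * (2 * L\<^sup>2 * q powr (2 * l))"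
      using that L by (intro mult_mono) auto
    then show ?thesis by (simp add: abs_mult mult_ac)
  qed
  have c: "2 * L \<le> 2 * L\<^sup>2" "L\<^sup>2 \<le> 2 * L\<^sup>2"
    using L by (auto simp: power2_eq_square)
  \<comment> \<open>M dominates |1 - \<open>down_diag\<close>| <= 1 + L as well as the products of
    an off-diagonal entry and a coefficient, bounded by L * L. K is the pulled-out factor L times 2
    L^2; since L >= 1, the latter dominates the constants 2 L and L^2 of the step lemmas.\<close>
  let ?M = "1 + L + L * L" and ?K = "2 * L * L\<^sup>2"
  have LL: "0 \<le> L * L" using L by simp
  show ?thesis
  proof (rule dirac_commutator_bounded[where M = ?M and K = ?K and \<epsilon> = "1/2"])
    fix l m n assume mem: "(l, m, n) \<in> psi_index" and mem': "(l + 1/2, m + 1/2, n + \<nu>) \<in> psi_index"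
    note b = psi_indexD[OF mem]
    have "\<bar>down_diag q (l + 1/2) (m + 1/2) - down_diag q l m\<bar> \<le> 2 * L * q powr (2 * l)"
      using down_diag_step[OF q, of l m] b by (simp add: L_def)
    then have 1: "\<bar>a l m n * (down_diag q (l + 1/2) (m + 1/2) - down_diag q l m)\<bar> \<le> ?K * q powr (2 * l)"
      using a_bd[OF mem, of m] b c by (intro step) auto
    have "\<bar>down_diag q (l + 1/2) (m - 1/2) - down_diag q l (m - 1)\<bar> \<le> 2 * L * q powr (2 * l)"
      using down_diag_step[OF q, of l "m - 1"] b by (simp add: L_def)
    then have 2: "\<bar>a l m n * (down_diag q (l + 1/2) (m - 1/2) - down_diag q l (m - 1))\<bar> \<le> ?K * q powr (2 * l)"
      using a_bd[OF mem, of m] b c by (intro step) auto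
    have A: "\<bar>a l m n\<bar> \<le> L" using a_bd[OF mem, of m] b by simp
    have "\<bar>down_diag q (l + 1/2) (m - 1/2)\<bar> \<le> L" "\<bar>down_diag q (l + 1/2) (m + 1/2)\<bar> \<le> L"
      using b by (auto intro!: down_diag_bd)
    then show "\<bar>a l m n\<bar> \<le> ?M \<and> \<bar>down_diag q (l + 1/2) (m + 1/2)\<bar> \<le> ?M \<and> \<bar>1 - down_diag q (l + 1/2) (m - 1/2)\<bar> \<le> ?M \<and>
       \<bar>a l m n * (down_diag q (l + 1/2) (m + 1/2) - down_diag q l m)\<bar> \<le> ?K * q powr (2 * l) \<and>
       \<bar>a l m n * (down_diag q (l + 1/2) (m - 1/2) - down_diag q l (m - 1))\<bar> \<le> ?K * q powr (2 * l)"
      using 1 2 A LL L by linarith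
  next
    fix l m n assume mem: "(l, m, n) \<in> psi_index" and mem': "(l + 1/2, m + 3/2, n + \<nu>) \<in> psi_index"
    note b = psi_indexD[OF mem] psi_indexD[OF mem']
    have "\<bar>\<alpha> l n\<bar> \<le> L" using \<alpha>[OF mem] by (simp add: L_def)
    moreover have "\<bar>down_off q (l + 1/2) (m + 1/2) * sqrt (qcomp q (l + m + 1)) - sqrt (qcomp q (l + m + 2)) * down_off q l m\<bar>
        \<le> L\<^sup>2 * q powr (2 * l)"
      using down_off_step_same[OF q, of l m] b by (simp add: L_def)
    ultimately have "\<bar>\<alpha> l n * (down_off q (l + 1/2) (m + 1/2) * sqrt (qcomp q (l + m + 1)) - sqrt (qcomp q (l + m + 2)) * down_off q l m)\<bar>
        \<le> ?K * q powr (2 * l)"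
      using c by (intro step) auto
    also have "\<alpha> l n * (down_off q (l + 1/2) (m + 1/2) * sqrt (qcomp q (l + m + 1)) - sqrt (qcomp q (l + m + 2)) * down_off q l m) =
        down_off q (l + 1/2) (m + 1/2) * a l m n - a l (m + 1) n * down_off q l m"
      by (simp add: a algebra_simps)
    finally have 1: "\<bar>down_off q (l + 1/2) (m + 1/2) * a l m n - a l (m + 1) n * down_off q l m\<bar> \<le> ?K * q powr (2 * l)" .
    have "\<bar>down_off q (l + 1/2) (m + 1/2)\<bar> * \<bar>a l m n\<bar> \<le> L * L"
      using b L a_bd[OF mem, of m] by (intro mult_mono down_off_bd) auto
    then show "\<bar>down_off q (l + 1/2) (m + 1/2) * a l m n\<bar> \<le> ?M \<and>
       \<bar>down_off q (l + 1/2) (m + 1/2) * a l m n - a l (m + 1) n * down_off q l m\<bar> \<le> ?K * q powr (2 * l)"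
      using 1 L by (simp add: abs_mult)
  next
    fix l m n assume mem: "(l, m, n) \<in> psi_index" and mem': "(l + 1/2, m - 1/2, n + \<nu>) \<in> psi_index"
    note b = psi_indexD[OF mem] psi_indexD[OF mem']
    have "\<bar>\<alpha> l n\<bar> \<le> L" using \<alpha>[OF mem] by (simp add: L_def)
    moreover have "\<bar>down_off q (l + 1/2) (m - 1/2) * sqrt (qcomp q (l + m + 1)) - sqrt (qcomp q (l + m)) * down_off q l (m - 1)\<bar>
        \<le> 2 * L * q powr (2 * l)"
      using down_off_step_cross[OF q, of l "m - 1"] b by (simp add: L_def add_ac)
    ultimately have "\<bar>\<alpha> l n * (down_off q (l + 1/2) (m - 1/2) * sqrt (qcomp q (l + m + 1)) - sqrt (qcomp q (l + m)) * down_off q l (m - 1))\<bar>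
        \<le> ?K * q powr (2 * l)"
      using c by (intro step) auto
    also have "\<alpha> l n * (down_off q (l + 1/2) (m - 1/2) * sqrt (qcomp q (l + m + 1)) - sqrt (qcomp q (l + m)) * down_off q l (m - 1)) =
        down_off q (l + 1/2) (m - 1/2) * a l m n - a l (m - 1) n * down_off q l (m - 1)"
      by (simp add: a algebra_simps)
    finally have 1: "\<bar>down_off q (l + 1/2) (m - 1/2) * a l m n - a l (m - 1) n * down_off q l (m - 1)\<bar> \<le> ?K * q powr (2 * l)" .
    have "\<bar>down_off q (l + 1/2) (m - 1/2)\<bar> * \<bar>a l m n\<bar> \<le> L * L"
      using b L a_bd[OF mem, of m] by (intro mult_mono down_off_bd) auto
    then show "\<bar>down_off q (l + 1/2) (m - 1/2) * a l m n\<bar> \<le> ?M \<and>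
       \<bar>down_off q (l + 1/2) (m - 1/2) * a l m n - a l (m - 1) n * down_off q l (m - 1)\<bar> \<le> ?K * q powr (2 * l)"
      using 1 L by (simp add: abs_mult)
  qed (use \<delta> in auto)
qed

text \<open>No cancellation is used: the coefficient is of order q^(l+m) and the entries of P at
  most of order q^(l-m), so each product alone is of order q^(2l). A lowering step inside the index
  set has l >= 1/2, which keeps clear of the zero denominator at l = 0.\<close>

lemma dirac_commutator_bounded_minus:
  assumes a: "\<And>l m n. a l m n = \<alpha> l n * (q powr (l + m) * sqrt (qcomp q (l - m)))"
    and \<alpha>: "\<And>l m n. (l, m, n) \<in> psi_index \<Longrightarrow> 1/2 \<le> l \<Longrightarrow> \<bar>\<alpha> l n\<bar> \<le> inverse (1 - q\<^sup>2)"
    and \<delta>: "\<delta> \<in> spin_steps"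
  shows "\<exists>N. \<forall>k\<in>spinor_index. k + ((- 1/2, 1/2, \<nu>), 0) + \<delta> \<in> spinor_index \<longrightarrow>
    \<bar>dirac_coeff q fc f0 hc h0 \<delta> (k + ((- 1/2, 1/2, \<nu>), 0)) * spin_free a k -
     spin_free a (k + \<delta>) * dirac_coeff q fc f0 hc h0 \<delta> k\<bar> \<le> N"
proof -
  define L where "L = inverse (1 - q\<^sup>2)"
  have L: "1 \<le> L" "0 \<le> L"
    using one_minus_q2_pos[OF q] q by (auto simp: L_def one_le_inverse_iff)
  have sqrt_le: "\<bar>sqrt (qcomp q x)\<bar> \<le> 1" if "0 \<le> x" for x
    using sqrt_qcomp_le_one[OF q, of x] qcomp_nonneg[OF q that] by simp
  have a_bd: "\<bar>a l m' n\<bar> \<le> L * q powr (l + m')" if "(l, m, n) \<in> psi_index" "1/2 \<le> l" "m' \<le> l" for l m m' n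
  proof -
    have "\<bar>\<alpha> l n\<bar> * (q powr (l + m') * \<bar>sqrt (qcomp q (l - m'))\<bar>) \<le> L * (q powr (l + m') * 1)"
      using \<alpha>[OF that(1,2)] sqrt_le[of "l - m'"] that L by (intro mult_mono) (auto simp: L_def)
    then show ?thesis by (simp add: a abs_mult)
  qed
  \<comment> \<open>The shifts of l and m by 1/2 and of m by 1 can lower the total exponent slightly
    below 2l; the factor q^(-2) covers this loss.\<close>
  define K where "K = L * L * q powr (- 2)"
  have prod: "\<bar>x * y\<bar> \<le> K * q powr (2 * l)"
    if "\<bar>x\<bar> \<le> L * q powr u" "\<bar>y\<bar> \<le> q powr v * L" "2 * l - 2 \<le> u + v" for x y u v l :: real
  proof -
    have "\<bar>x\<bar> * \<bar>y\<bar> \<le> (L * q powr u) * (q powr v * L)"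
      using that L by (intro mult_mono) auto
    also have "\<dots> = L * L * q powr (u + v)"
      by (simp add: powr_add)
    also have "\<dots> \<le> L * L * q powr (- 2 + 2 * l)"
      using that L by (intro mult_left_mono q_powr_le[OF q]) auto
    also have "\<dots> = K * q powr (2 * l)"
      by (simp only: K_def powr_add mult_ac)
    finally show ?thesis by (simp add: abs_mult)
  qed
  have K: "0 \<le> K" "L * L \<le> K" "1 \<le> q powr (- 2)"
    using L q_powr_le[OF q, of "- 2" 0] q by (auto simp: K_def mult_left_mono[of 1 "q powr (- 2)" "L * L", simplified])
  have K_le: "K * q powr (2 * l) \<le> K" if "0 \<le> l" for l
    using K(1) q_powr_le[OF q, of 0 "2 * l"] that q by (intro mult_left_le) auto
  let ?M = "1 + L + K"
  note sg = down_diag_le[OF q, folded L_def] and rh = down_off_le[OF q, folded L_def]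
  show ?thesis
  proof (rule dirac_commutator_bounded[where M = ?M and K = "2 * K" and \<epsilon> = "- 1/2"])
    fix l m n assume mem: "(l, m, n) \<in> psi_index" and mem': "(l + - 1/2, m + 1/2, n + \<nu>) \<in> psi_index"
    note b = psi_indexD[OF mem] psi_indexD[OF mem']
    have l: "1/2 \<le> l" "0 \<le> l" and ml: "m \<le> l" "- l \<le> m" "m \<le> l - 1" using b by auto
    note A = a_bd[OF mem l(1) ml(1)]
    have "\<bar>a l m n * down_diag q (l + - 1/2) (m + 1/2)\<bar> \<le> K * q powr (2 * l)"
      by (rule prod[OF A sg]) (use l ml in auto)
    moreover have "\<bar>a l m n * down_diag q l m\<bar> \<le> K * q powr (2 * l)"
      by (rule prod[OF A sg]) (use l ml in auto)
    ultimately have 1: "\<bar>a l m n * (down_diag q (l + - 1/2) (m + 1/2) - down_diag q l m)\<bar> \<le> 2 * K * q powr (2 * l)"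
      unfolding right_diff_distrib by linarith
    have "\<bar>a l m n * down_diag q (l + - 1/2) (m - 1/2)\<bar> \<le> K * q powr (2 * l)"
      by (rule prod[OF A sg]) (use l ml in auto)
    moreover have "\<bar>a l m n * down_diag q l (m - 1)\<bar> \<le> K * q powr (2 * l)"
      by (rule prod[OF A sg]) (use l ml in auto)
    ultimately have 2: "\<bar>a l m n * (down_diag q (l + - 1/2) (m - 1/2) - down_diag q l (m - 1))\<bar> \<le> 2 * K * q powr (2 * l)"
      unfolding right_diff_distrib by linarith
    have sb: "\<bar>down_diag q l' m'\<bar> \<le> L" if "0 \<le> l'" "- l' - 1 \<le> m'" "m' \<le> l'" for l' m'
      using sg[OF that(1,2)] mult_right_mono[OF q_powr_le[OF q, of 0 "2 * (l' - m')"] L(2)] that q by simp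
    have 3: "\<bar>down_diag q (l + - 1/2) (m + 1/2)\<bar> \<le> L" "\<bar>down_diag q (l + - 1/2) (m - 1/2)\<bar> \<le> L"
      using l ml by (auto intro!: sb)
    have "L * q powr (l + m) \<le> L * 1"
      using ml L q_powr_le[OF q, of 0 "l + m"] q by (intro mult_left_mono) auto
    then show "\<bar>a l m n\<bar> \<le> ?M \<and> \<bar>down_diag q (l + - 1/2) (m + 1/2)\<bar> \<le> ?M \<and> \<bar>1 - down_diag q (l + - 1/2) (m - 1/2)\<bar> \<le> ?M \<and>
       \<bar>a l m n * (down_diag q (l + - 1/2) (m + 1/2) - down_diag q l m)\<bar> \<le> 2 * K * q powr (2 * l) \<and>
       \<bar>a l m n * (down_diag q (l + - 1/2) (m - 1/2) - down_diag q l (m - 1))\<bar> \<le> 2 * K * q powr (2 * l)"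
      using 1 2 3 A K(1) L by linarith
  next
    fix l m n assume mem: "(l, m, n) \<in> psi_index" and mem': "(l + - 1/2, m + 3/2, n + \<nu>) \<in> psi_index"
    note b = psi_indexD[OF mem] psi_indexD[OF mem']
    have l: "1/2 \<le> l" "0 \<le> l" and ml: "m \<le> l" "- l \<le> m" "m + 1 \<le> l" "m \<le> l - 2" using b by auto
    have 1: "\<bar>a l m n * down_off q (l + - 1/2) (m + 1/2)\<bar> \<le> K * q powr (2 * l)"
      by (rule prod[OF a_bd[OF mem l(1) ml(1)] rh]) (use l ml in auto)
    have 2: "\<bar>a l (m + 1) n * down_off q l m\<bar> \<le> K * q powr (2 * l)"
      by (rule prod[OF a_bd[OF mem l(1) ml(3)] rh]) (use l ml in auto)
    show "\<bar>down_off q (l + - 1/2) (m + 1/2) * a l m n\<bar> \<le> ?M \<and>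
       \<bar>down_off q (l + - 1/2) (m + 1/2) * a l m n - a l (m + 1) n * down_off q l m\<bar> \<le> 2 * K * q powr (2 * l)"
      using 1 2 K_le[OF l(2)] L unfolding mult.commute[of "down_off q (l + - 1/2) (m + 1/2)"] by linarith
  next
    fix l m n assume mem: "(l, m, n) \<in> psi_index" and mem': "(l + - 1/2, m - 1/2, n + \<nu>) \<in> psi_index"
    note b = psi_indexD[OF mem] psi_indexD[OF mem']
    have l: "1/2 \<le> l" "0 \<le> l" and ml: "m \<le> l" "- l \<le> m" "m - 1 \<le> l" using b by auto
    have 1: "\<bar>a l m n * down_off q (l + - 1/2) (m - 1/2)\<bar> \<le> K * q powr (2 * l)"
      by (rule prod[OF a_bd[OF mem l(1) ml(1)] rh]) (use l ml in auto)
    have 2: "\<bar>a l (m - 1) n * down_off q l (m - 1)\<bar> \<le> K * q powr (2 * l)"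
      by (rule prod[OF a_bd[OF mem l(1) ml(3)] rh]) (use l ml in auto)
    show "\<bar>down_off q (l + - 1/2) (m - 1/2) * a l m n\<bar> \<le> ?M \<and>
       \<bar>down_off q (l + - 1/2) (m - 1/2) * a l m n - a l (m - 1) n * down_off q l (m - 1)\<bar> \<le> 2 * K * q powr (2 * l)"
      using 1 2 K_le[OF l(2)] L unfolding mult.commute[of "down_off q (l + - 1/2) (m - 1/2)"] by linarith
  qed (use \<delta> in auto)
qed

end

section \<open>The spinor basis\<close>

lemma tensor_ket: "tensor (ket i) (ket s) = ket (i, s)"
  by (auto simp: tensor_def ket_def fun_eq_iff)

lemma up_index_iff:
  "(j, \<mu>, n) \<in> up_index \<longleftrightarrow>
   (\<exists>K a b :: nat. a \<le> K \<and> b \<le> K + 1 \<and> j = real K / 2 \<and> \<mu> = real a - real K / 2 \<and> n = real b - real (K + 1) / 2)"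
  (is "?L \<longleftrightarrow> ?R")
proof
  assume ?L
  then obtain K a b :: nat where "j = real K / 2" "\<mu> = - j + real a" "n = - (j + 1/2) + real b" "\<mu> \<le> j" "n \<le> j + 1/2"
    by (auto simp: up_index_def half_nats_def ladder_def)
  then show ?R
    by (intro exI[of _ K] exI[of _ a] exI[of _ b]) (auto simp: field_simps)
next
  assume ?R
  then obtain K a b :: nat where "a \<le> K" "b \<le> K + 1" "j = real K / 2" "\<mu> = real a - real K / 2" "n = real b - real (K + 1) / 2"
    by blast
  then have "\<mu> = - j + real a" "n = - (j + 1/2) + real b" "\<mu> \<le> j" "n \<le> j + 1/2" "j \<in> half_nats"
    by (auto simp: half_nats_def field_simps)
  then show ?L
    by (auto simp: up_index_def ladder_def)
qed

text \<open>Here K is 2l for the level l = j - 1/2 on which the down-spinor lives, not 2j; it is a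
  natural number because j is not 0.\<close>

lemma down_index_iff:
  "(j, \<mu>, n) \<in> down_index \<longleftrightarrow>
   (\<exists>K a b :: nat. a \<le> K + 1 \<and> b \<le> K \<and> j = real (K + 1) / 2 \<and> \<mu> = real a - real (K + 1) / 2 \<and> n = real b - real K / 2)"
  (is "?L \<longleftrightarrow> ?R")
proof
  assume ?L
  then obtain K a b :: nat where *: "j = real K / 2" "j \<noteq> 0" "\<mu> = - j + real a" "n = - (j - 1/2) + real b" "\<mu> \<le> j" "n \<le> j - 1/2"
    by (auto simp: down_index_def half_nats_def ladder_def)
  then obtain K' where "K = K' + 1"
    by (cases K) auto
  then show ?R
    using * by (intro exI[of _ K'] exI[of _ a] exI[of _ b]) (auto simp: field_simps)
next
  assume ?R
  then obtain K a b :: nat where "a \<le> K + 1" "b \<le> K" "j = real (K + 1) / 2" "\<mu> = real a - real (K + 1) / 2" "n = real b - real K / 2"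
    by blast
  moreover from this have "j \<in> half_nats"
    unfolding half_nats_def by blast
  ultimately have "\<mu> = - j + real a" "n = - (j - 1/2) + real b" "\<mu> \<le> j" "n \<le> j - 1/2" "j \<noteq> 0" "j \<in> half_nats"
    by (auto simp: field_simps)
  then show ?L
    by (auto simp: down_index_def ladder_def)
qed

lemma up_index_psi_index:
  assumes "(j, \<mu>, n) \<in> up_index"
  shows "(j + 1/2, \<mu> + 1/2, n) \<in> psi_index" "(j + 1/2, \<mu> - 1/2, n) \<in> psi_index"
proof -
  obtain K a b :: nat where *: "a \<le> K" "b \<le> K + 1" "j = real K / 2" "\<mu> = real a - real K / 2" "n = real b - real (K + 1) / 2"
    using assms unfolding up_index_iff by blast
  show "(j + 1/2, \<mu> + 1/2, n) \<in> psi_index"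
    by (rule psi_indexI[of "a + 1" "K + 1" b]) (use * in \<open>auto simp: field_simps\<close>)
  show "(j + 1/2, \<mu> - 1/2, n) \<in> psi_index"
    by (rule psi_indexI[of a "K + 1" b]) (use * in \<open>auto simp: field_simps\<close>)
qed

text \<open>At \<mu> = j and at \<mu> = - j a down-spinor consists of a single ket. An up-spinor, in
  contrast, always has both of its kets in the index set.\<close>

lemma down_index_psi_index:
  assumes "(j, \<mu>, n) \<in> down_index"
  shows "\<mu> \<noteq> j \<Longrightarrow> (j - 1/2, \<mu> + 1/2, n) \<in> psi_index" "\<mu> \<noteq> - j \<Longrightarrow> (j - 1/2, \<mu> - 1/2, n) \<in> psi_index"
proof -
  obtain K a b :: nat where *: "a \<le> K + 1" "b \<le> K" "j = real (K + 1) / 2" "\<mu> = real a - real (K + 1) / 2" "n = real b - real K / 2"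
    using assms unfolding down_index_iff by blast
  show "(j - 1/2, \<mu> + 1/2, n) \<in> psi_index" if "\<mu> \<noteq> j"
  proof -
    have "a \<noteq> K + 1" using * that by (auto simp: field_simps)
    then show ?thesis
      by (intro psi_indexI[of a K b]) (use * in \<open>auto simp: field_simps\<close>)
  qed
  show "(j - 1/2, \<mu> - 1/2, n) \<in> psi_index" if "\<mu> \<noteq> - j"
  proof -
    have "a \<noteq> 0" using * that by (cases "a = 0") (auto simp: field_simps)
    then show ?thesis
      by (intro psi_indexI[of "a - 1" K b]) (use * in \<open>auto simp: field_simps of_nat_diff\<close>)
  qed
qed

lemma psi_index_spinor_index:
  assumes "(l, m, n) \<in> psi_index"
  shows "(l + 1/2, m + 1/2, n) \<in> down_index" "(l + 1/2, m - 1/2, n) \<in> down_index"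
    "m \<noteq> l \<Longrightarrow> (l - 1/2, m + 1/2, n) \<in> up_index" "m \<noteq> - l \<Longrightarrow> (l - 1/2, m - 1/2, n) \<in> up_index"
proof -
  obtain K a b :: nat where *: "a \<le> K" "b \<le> K" "l = real K / 2" "m = real a - real K / 2" "n = real b - real K / 2"
    using assms unfolding psi_index_iff by blast
  show "(l + 1/2, m + 1/2, n) \<in> down_index"
    unfolding down_index_iff by (intro exI[of _ K] exI[of _ "a + 1"] exI[of _ b]) (use * in \<open>auto simp: field_simps\<close>)
  show "(l + 1/2, m - 1/2, n) \<in> down_index"
    unfolding down_index_iff by (intro exI[of _ K] exI[of _ a] exI[of _ b]) (use * in \<open>auto simp: field_simps\<close>)
  show "(l - 1/2, m + 1/2, n) \<in> up_index" if "m \<noteq> l"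
  proof -
    have "a < K" using * that by (cases "a = K") auto
    then show ?thesis
      unfolding up_index_iff
      by (intro exI[of _ "K - 1"] exI[of _ a] exI[of _ b]) (use * in \<open>auto simp: field_simps of_nat_diff\<close>)
  qed
  show "(l - 1/2, m - 1/2, n) \<in> up_index" if "m \<noteq> - l"
  proof -
    have "0 < a" using * that by (cases "a = 0") auto
    then show ?thesis
      unfolding up_index_iff
      by (intro exI[of _ "K - 1"] exI[of _ "a - 1"] exI[of _ b]) (use * in \<open>auto simp: field_simps of_nat_diff\<close>)
  qed
qed

context
  fixes q :: real
  assumes q: "0 < q" "q < 1"
begin

lemma C_coeff_top: "C_coeff q j j = 0"
  by (simp add: C_coeff_eq[OF q] qcomp_zero[OF q])

lemma S_coeff_bottom: "S_coeff q j (- j) = 0"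
  by (simp add: S_coeff_eq[OF q] qcomp_zero[OF q])

text \<open>The vector (C, S) is a unit vector by the addition rule qcomp(x + y) = qcomp(x) + q^(2x)
  qcomp(y) with x = l - m and y = l + m + 1. The entries of the projection onto it are the products
  of its components.\<close>

lemma coeff_products:
  assumes "0 \<le> l" "- l - 1 \<le> m" "m \<le> l"
  shows "(S_coeff q (l + 1/2) (m + 1/2))\<^sup>2 = down_diag q l m"
    and "(C_coeff q (l + 1/2) (m + 1/2))\<^sup>2 = 1 - down_diag q l m"
    and "C_coeff q (l + 1/2) (m + 1/2) * S_coeff q (l + 1/2) (m + 1/2) = down_off q l m"
proof -
  have "l + 1/2 - (m + 1/2) = l - m" "l + 1/2 + (m + 1/2) = l + m + 1" "2 * (l + 1/2) = 2 * l + 1"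
    by simp_all
  then have S: "S_coeff q (l + 1/2) (m + 1/2) = q powr (l - m) * sqrt (qcomp q (l + m + 1)) / sqrt (qcomp q (2 * l + 1))"
    and C: "C_coeff q (l + 1/2) (m + 1/2) = sqrt (qcomp q (l - m)) / sqrt (qcomp q (2 * l + 1))"
    by (simp_all only: S_coeff_eq[OF q] C_coeff_eq[OF q])
  have nn: "0 \<le> qcomp q (l - m)" "0 \<le> qcomp q (l + m + 1)" "0 < qcomp q (2 * l + 1)"
    using assms by (auto intro: qcomp_nonneg[OF q] qcomp_pos[OF q])
  have sq: "(q powr (l - m))\<^sup>2 = q powr (2 * (l - m))"
    using q by (simp add: powr_power)
  show 1: "(S_coeff q (l + 1/2) (m + 1/2))\<^sup>2 = down_diag q l m"
    using nn by (simp add: S down_diag_def power_mult_distrib power_divide sq add_ac)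
  have "q powr (2 * (l - m)) * q powr (2 * (l + m + 1)) = q powr (2 * (2 * l + 1))"
    by (rule q_powr_mult[OF q]) simp
  then have "qcomp q (l - m) = qcomp q (2 * l + 1) - q powr (2 * (l - m)) * qcomp q (l + m + 1)"
    by (simp add: qcomp_def algebra_simps)
  then show "(C_coeff q (l + 1/2) (m + 1/2))\<^sup>2 = 1 - down_diag q l m"
    using nn by (simp add: C down_diag_def power_divide diff_divide_distrib)
  show "C_coeff q (l + 1/2) (m + 1/2) * S_coeff q (l + 1/2) (m + 1/2) = down_off q l m"
    using nn by (simp add: C S down_off_def)
qed

lemma spinor_down_ket: "spinor_down q (l + 1/2) (m + 1/2) n =
    cscale (of_real (C_coeff q (l + 1/2) (m + 1/2))) (ket ((l, m + 1, n), - 1/2)) +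
    cscale (of_real (S_coeff q (l + 1/2) (m + 1/2))) (ket ((l, m, n), 1/2))"
  by (simp add: spinor_down_def tensor_ket add.assoc)

text \<open>The argument j + 1 of the coefficients turns j = l - 1/2 into l + 1/2, so the up-spinor
  uses the same pair C, S as the down-spinor on this plane.\<close>

lemma spinor_up_ket: "spinor_up q (l - 1/2) (m + 1/2) n =
    cscale (of_real (- S_coeff q (l + 1/2) (m + 1/2))) (ket ((l, m + 1, n), - 1/2)) +
    cscale (of_real (C_coeff q (l + 1/2) (m + 1/2))) (ket ((l, m, n), 1/2))"
proof -
  have "l - 1/2 + 1 = l + 1/2" "l - 1/2 + 1/2 = l" "m + 1/2 + 1/2 = m + 1" "m + 1/2 - 1/2 = m"
    by simp_all
  then show ?thesis
    unfolding spinor_up_def tensor_ket by presburger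
qed

text \<open>The passage from kets to spinors on the plane is orthogonal, so its inverse is its
  transpose. At the ends of the ladder the identities are formal: one of the up-spinor expressions
  then has no valid index.\<close>

lemma ket_spinor:
  assumes "0 \<le> l" "- l - 1 \<le> m" "m \<le> l"
  shows "ket ((l, m + 1, n), - 1/2) =
      cscale (of_real (C_coeff q (l + 1/2) (m + 1/2))) (spinor_down q (l + 1/2) (m + 1/2) n) +
      cscale (of_real (- S_coeff q (l + 1/2) (m + 1/2))) (spinor_up q (l - 1/2) (m + 1/2) n)" (is "?down = _")
    and "ket ((l, m, n), 1/2) =
      cscale (of_real (S_coeff q (l + 1/2) (m + 1/2))) (spinor_down q (l + 1/2) (m + 1/2) n) +
      cscale (of_real (C_coeff q (l + 1/2) (m + 1/2))) (spinor_up q (l - 1/2) (m + 1/2) n)" (is "?up = _")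
proof -
  define C where "C = complex_of_real (C_coeff q (l + 1/2) (m + 1/2))"
  define S where "S = complex_of_real (S_coeff q (l + 1/2) (m + 1/2))"
  have "(C_coeff q (l + 1/2) (m + 1/2))\<^sup>2 + (S_coeff q (l + 1/2) (m + 1/2))\<^sup>2 = 1"
    using coeff_products[OF assms] by simp
  then have 1: "C * C + S * S = 1"
    unfolding C_def S_def power2_eq_square by (simp flip: of_real_mult of_real_add)
  have 2: "C * (C * x) + S * (S * x) = x" for x
  proof -
    have "C * (C * x) + S * (S * x) = (C * C + S * S) * x" by (simp add: algebra_simps)
    then show ?thesis using 1 by simp
  qed
  show "?down = cscale (of_real (C_coeff q (l + 1/2) (m + 1/2))) (spinor_down q (l + 1/2) (m + 1/2) n) +
      cscale (of_real (- S_coeff q (l + 1/2) (m + 1/2))) (spinor_up q (l - 1/2) (m + 1/2) n)"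
    unfolding spinor_down_ket spinor_up_ket
    by (simp add: fun_eq_iff cscale_def 2 flip: C_def S_def) (simp add: algebra_simps 2)
  show "?up = cscale (of_real (S_coeff q (l + 1/2) (m + 1/2))) (spinor_down q (l + 1/2) (m + 1/2) n) +
      cscale (of_real (C_coeff q (l + 1/2) (m + 1/2))) (spinor_up q (l - 1/2) (m + 1/2) n)"
    unfolding spinor_down_ket spinor_up_ket
    by (simp add: fun_eq_iff cscale_def 2 flip: C_def S_def) (simp add: algebra_simps 2)
qed

lemma spinor_basis_in_span: "spinor_basis q \<subseteq> cspan (ket ` spinor_index)"
proof
  fix x assume "x \<in> spinor_basis q"
  then consider (up) j \<mu> n where "(j, \<mu>, n) \<in> up_index" "x = spinor_up q j \<mu> n"
    | (down) j \<mu> n where "(j, \<mu>, n) \<in> down_index" "x = spinor_down q j \<mu> n"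
    by (auto simp: spinor_basis_def)
  then show "x \<in> cspan (ket ` spinor_index)"
  proof cases
    case up
    have "ket ((j + 1/2, \<mu> + 1/2, n), - 1/2) \<in> cspan (ket ` spinor_index)"
      "ket ((j + 1/2, \<mu> - 1/2, n), 1/2) \<in> cspan (ket ` spinor_index)"
      using up_index_psi_index[OF up(1)] by (auto simp: spinor_index_def intro!: cfun.span_base)
    then show ?thesis
      unfolding up(2) spinor_up_def tensor_ket by (intro cfun.span_add cfun.span_scale)
  next
    case down
    have "cscale (of_real (C_coeff q j \<mu>)) (ket ((j - 1/2, \<mu> + 1/2, n), - 1/2)) \<in> cspan (ket ` spinor_index)"
    proof (cases "\<mu> = j")
      \<comment> \<open>The ket lies outside the index set here, but its coefficient is 0.\<close>
      case True
      then show ?thesis unfolding True C_coeff_top of_real_0 cfun.scale_zero_left by (metis cfun.span_zero)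
    next
      case False
      then show ?thesis
        using down_index_psi_index(1)[OF down(1)]
        by (intro cfun.span_scale cfun.span_base) (auto simp: spinor_index_def)
    qed
    moreover have "cscale (of_real (S_coeff q j \<mu>)) (ket ((j - 1/2, \<mu> - 1/2, n), 1/2)) \<in> cspan (ket ` spinor_index)"
    proof (cases "\<mu> = - j")
      case True
      then show ?thesis unfolding True S_coeff_bottom of_real_0 cfun.scale_zero_left by (metis cfun.span_zero)
    next
      case False
      then show ?thesis
        using down_index_psi_index(2)[OF down(1)]
        by (intro cfun.span_scale cfun.span_base) (auto simp: spinor_index_def)
    qed
    ultimately show ?thesis
      unfolding down(2) spinor_down_def tensor_ket by (rule cfun.span_add)
  qed
qed

text \<open>At the boundary of the ladder there is no up-spinor, and its coefficient is \<open>0\<close>.\<close>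

lemma spinor_basis_members:
  assumes "(l, m, n) \<in> psi_index"
  shows "spinor_down q (l + 1/2) (m + 1/2) n \<in> spinor_basis q"
    "C_coeff q (l + 1/2) (m + 1/2) = 0 \<or> (l - 1/2, m + 1/2, n) \<in> up_index"
    "spinor_down q (l + 1/2) (m - 1/2) n \<in> spinor_basis q"
    "S_coeff q (l + 1/2) (m - 1/2) = 0 \<or> (l - 1/2, m - 1/2, n) \<in> up_index"
proof -
  note idx = psi_index_spinor_index[OF assms]
  show "spinor_down q (l + 1/2) (m + 1/2) n \<in> spinor_basis q" "spinor_down q (l + 1/2) (m - 1/2) n \<in> spinor_basis q"
    using idx(1,2) by (force simp: spinor_basis_def)+
  show "C_coeff q (l + 1/2) (m + 1/2) = 0 \<or> (l - 1/2, m + 1/2, n) \<in> up_index"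
    using idx(3) C_coeff_top by (cases "m = l") auto
  have "- l - 1/2 = - (l + 1/2)" by simp
  then show "S_coeff q (l + 1/2) (m - 1/2) = 0 \<or> (l - 1/2, m - 1/2, n) \<in> up_index"
    using idx(4) S_coeff_bottom[of "l + 1/2"] by (cases "m = - l") auto
qed

lemma spinor_up_in_basis: "(j, \<mu>, n) \<in> up_index \<Longrightarrow> spinor_up q j \<mu> n \<in> spinor_basis q"
  by (force simp: spinor_basis_def)

text \<open>This transfers the commutator from the spinor basis, on which it is to be defined, to
  kets, on which the generators are shifts.\<close>

lemma span_spinor_basis: "cspan (spinor_basis q) = cspan (ket ` spinor_index)"
proof -
  have "ket k \<in> cspan (spinor_basis q)" if k: "k \<in> spinor_index" for k
  proof -
    \<comment> \<open>Up-spinors without a valid index occur with coefficient 0, so the summand lies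
      in the span in either case.\<close>
    have sc: "cscale (of_real c) x \<in> cspan (spinor_basis q)" if "c = 0 \<or> x \<in> spinor_basis q" for c x
      using that cfun.span_zero[of "spinor_basis q"]
      by (metis cfun.scale_zero_left cfun.span_base cfun.span_scale of_real_0)
    obtain l m n s where kk: "k = ((l, m, n), s)"
      by (metis prod.exhaust)
    have mem: "(l, m, n) \<in> psi_index" and s: "s = 1/2 \<or> s = - 1/2"
      using k by (auto simp: kk spinor_index_def)
    note b = psi_indexD[OF mem] and sp = spinor_basis_members[OF mem]
    from s show ?thesis
    proof
      assume s: "s = 1/2"
      show ?thesis
        unfolding kk s ket_spinor(2)[OF b(1) order_trans[OF _ b(2)] b(3), simplified]
        by (intro cfun.span_add sc) (use sp spinor_up_in_basis in auto)
    next
      assume s: "s = - 1/2"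
      \<comment> \<open>A ket with spin - 1/2 is the second vector of the plane labelled by m -
        1.\<close>
      have "m = (m - 1) + 1" "m - 1/2 = (m - 1) + 1/2" by simp_all
      then have "ket k = cscale (of_real (C_coeff q (l + 1/2) (m - 1/2))) (spinor_down q (l + 1/2) (m - 1/2) n) +
          cscale (of_real (- S_coeff q (l + 1/2) (m - 1/2))) (spinor_up q (l - 1/2) (m - 1/2) n)"
        using ket_spinor(1)[of l "m - 1" n] b by (simp add: kk s)
      also have "\<dots> \<in> cspan (spinor_basis q)"
        by (intro cfun.span_add sc) (use sp spinor_up_in_basis in auto)
      finally show ?thesis .
    qed
  qed
  then show ?thesis
    unfolding cfun.span_eq using spinor_basis_in_span by auto
qed

end

section \<open>The Dirac operator in the tensor product basis\<close>

text \<open>On the plane at level l the operator is f + (g - f) P, with f the up-eigenvalue at l -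
  1/2 and g the down-eigenvalue at l + 1/2. These half-steps produce the terms c1_up / 2 and c1_down
  / 2 in the constants.\<close>

lemma dirac_on_ket:
  assumes q: "0 < q" "q < 1"
    and lin: "clinear_on (cspan (ket ` spinor_index)) D"
    and up: "\<And>j \<mu> n. (j, \<mu>, n) \<in> up_index \<Longrightarrow>
           D (spinor_up q j \<mu> n) = cscale (of_real (d_up j)) (spinor_up q j \<mu> n)"
    and down: "\<And>j \<mu> n. (j, \<mu>, n) \<in> down_index \<Longrightarrow>
           D (spinor_down q j \<mu> n) = cscale (of_real (d_down j)) (spinor_down q j \<mu> n)"
    and d_up: "\<And>j. j \<in> half_nats \<Longrightarrow> d_up j = c1_up * j + c2_up"
    and d_down: "\<And>j. j \<in> half_nats - {0} \<Longrightarrow> d_down j = c1_down * j + c2_down"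
    and v: "v \<in> cspan (ket ` spinor_index)"
  shows "D v = (\<Sum>\<delta>\<in>spin_steps. wshift \<delta> (dirac_coeff q c1_up (c2_up - c1_up / 2)
     (c1_down - c1_up) (c2_down + c1_down / 2 - c2_up + c1_up / 2) \<delta>) v)"
proof (rule clinear_on_span_eq[OF lin _ _ v])
  let ?d = "dirac_coeff q c1_up (c2_up - c1_up / 2) (c1_down - c1_up) (c2_down + c1_down / 2 - c2_up + c1_up / 2)"
  have expand: "(\<Sum>\<delta>\<in>spin_steps. f \<delta>) = f 0 + f spin_flip + f (- spin_flip)" for f :: "_ \<Rightarrow> (real \<times> real \<times> real) \<times> real \<Rightarrow> complex"
    using spin_flip_simps unfolding spin_steps_def by (simp add: add.assoc)
  show "clinear_on (cspan (ket ` spinor_index)) (\<lambda>v. \<Sum>\<delta>\<in>spin_steps. wshift \<delta> (?d \<delta>) v)"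
    unfolding clinear_on_def expand by (simp add: fun_eq_iff wshift_def cscale_def algebra_simps)
  fix x assume "x \<in> ket ` spinor_index"
  then obtain l m n s where x: "x = ket ((l, m, n), s)" and k: "((l, m, n), s) \<in> spinor_index"
    by auto
  have mem: "(l, m, n) \<in> psi_index" and s: "s = 1/2 \<or> s = - 1/2"
    using k by (auto simp: spinor_index_def)
  note b = psi_indexD[OF mem] and sp = spinor_basis_members[OF q mem]
  let ?f = "c1_up * l + (c2_up - c1_up / 2)"
  let ?g = "?f + ((c1_down - c1_up) * l + (c2_down + c1_down / 2 - c2_up + c1_up / 2))"
  have basis: "y \<in> cspan (ket ` spinor_index)" if "y \<in> spinor_basis q" for y
    using that spinor_basis_in_span[OF q] by blast
  have D_down: "D (cscale c (spinor_down q (l + 1/2) \<mu> n)) = cscale (c * of_real ?g) (spinor_down q (l + 1/2) \<mu> n)"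
    if "(l + 1/2, \<mu>, n) \<in> down_index" for c \<mu>
  proof -
    have "spinor_down q (l + 1/2) \<mu> n \<in> spinor_basis q"
      using that by (force simp: spinor_basis_def)
    moreover have "d_down (l + 1/2) = ?g"
      using that by (subst d_down) (auto simp: down_index_def algebra_simps add_divide_distrib)
    ultimately show ?thesis
      using clinear_onD(2)[OF lin basis] down[OF that] by simp
  qed
  \<comment> \<open>At the ends of the ladder the expression for the up-spinor need not lie in the
    span, and nothing is known about D on it; there D is applied only to the vector 0.\<close>
  have D_up: "D (cscale (of_real c) (spinor_up q (l - 1/2) \<mu> n)) = cscale (of_real c * of_real ?f) (spinor_up q (l - 1/2) \<mu> n)"
    if "c = 0 \<or> (l - 1/2, \<mu>, n) \<in> up_index" for c \<mu>
  proof (cases "c = 0")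
    case True
    have "D 0 = 0"
      using clinear_onD(2)[OF lin cfun.span_zero, of 0] by (simp only: cfun.scale_zero_left)
    then show ?thesis
      unfolding True of_real_0 mult_zero_left cfun.scale_zero_left .
  next
    case False
    then have mem: "(l - 1/2, \<mu>, n) \<in> up_index" using that by blast
    have "d_up (l - 1/2) = ?f"
      using mem by (subst d_up) (auto simp: up_index_def algebra_simps add_divide_distrib)
    then show ?thesis
      using clinear_onD(2)[OF lin basis[OF spinor_up_in_basis[OF q mem]]] up[OF mem] by simp
  qed
  have up_span: "cscale (of_real c) (spinor_up q (l - 1/2) \<mu> n) \<in> cspan (ket ` spinor_index)"
    if "c = 0 \<or> (l - 1/2, \<mu>, n) \<in> up_index" for c \<mu>
    using that basis spinor_up_in_basis[OF q]
    by (metis cfun.scale_zero_left cfun.span_scale cfun.span_zero of_real_0)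
  from s have "D (ket ((l, m, n), s)) = (\<Sum>\<delta>\<in>spin_steps. wshift \<delta> (?d \<delta>) (ket ((l, m, n), s)))"
  proof
    assume s: "s = 1/2"
    define C where "C = C_coeff q (l + 1/2) (m + 1/2)"
    define S where "S = S_coeff q (l + 1/2) (m + 1/2)"
    have CS: "S * S = down_diag q l m" "C * C = 1 - down_diag q l m" "C * S = down_off q l m"
      using coeff_products[OF q, of l m] b by (auto simp: C_def S_def power2_eq_square)
    have "D (ket ((l, m, n), s)) = D (cscale (of_real S) (spinor_down q (l + 1/2) (m + 1/2) n) +
        cscale (of_real C) (spinor_up q (l - 1/2) (m + 1/2) n))"
      using ket_spinor(2)[OF q, of l m n] b by (simp add: s C_def S_def)
    also have "\<dots> = cscale (of_real S * of_real ?g) (spinor_down q (l + 1/2) (m + 1/2) n) +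
        cscale (of_real C * of_real ?f) (spinor_up q (l - 1/2) (m + 1/2) n)"
      unfolding clinear_onD(1)[OF lin cfun.span_scale[OF basis[OF sp(1)]] up_span[OF sp(2)[folded C_def]]]
        D_down[OF psi_index_spinor_index(1)[OF mem]] D_up[OF sp(2)[folded C_def]] ..
    \<comment> \<open>Regrouping by kets gives the diagonal entry S^2 g + C^2 f, which is f + h S^2,
      and the off-diagonal entry C S (g - f), which is h C S.\<close>
    also have "\<dots> = cscale (of_real (S * S * ?g + C * C * ?f)) (ket ((l, m, n), 1/2)) +
        cscale (of_real (C * S * (?g - ?f))) (ket ((l, m + 1, n), - 1/2))"
      unfolding spinor_down_ket[OF q] spinor_up_ket[OF q] C_def[symmetric] S_def[symmetric]
      by (simp add: fun_eq_iff cscale_def) (simp add: algebra_simps)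
    also have "S * S * ?g + C * C * ?f = ?d 0 ((l, m, n), s)"
      by (simp add: CS dirac_coeff_def s) (simp add: algebra_simps)
    also have "C * S * (?g - ?f) = ?d spin_flip ((l, m, n), s)"
      using spin_flip_simps by (simp add: CS dirac_coeff_def s)
    finally show ?thesis
      unfolding expand wshift_ket
      using spin_flip_simps by (simp add: s dirac_coeff_def[of _ _ _ _ _ "- spin_flip"]) (simp add: spin_flip_def fun_eq_iff)
  next
    assume s: "s = - 1/2"
    define C where "C = C_coeff q (l + 1/2) (m - 1/2)"
    define S where "S = S_coeff q (l + 1/2) (m - 1/2)"
    have S0: "- S = 0 \<or> (l - 1/2, m - 1/2, n) \<in> up_index"
      using sp(4) by (simp add: S_def)
    have CS: "S * S = down_diag q l (m - 1)" "C * C = 1 - down_diag q l (m - 1)" "C * S = down_off q l (m - 1)"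
      using coeff_products[OF q, of l "m - 1"] b by (auto simp: C_def S_def power2_eq_square)
    have "D (ket ((l, m, n), s)) = D (cscale (of_real C) (spinor_down q (l + 1/2) (m - 1/2) n) +
        cscale (of_real (- S)) (spinor_up q (l - 1/2) (m - 1/2) n))"
      using ket_spinor(1)[OF q, of l "m - 1" n] b by (simp add: s C_def S_def)
    also have "\<dots> = cscale (of_real C * of_real ?g) (spinor_down q (l + 1/2) (m - 1/2) n) +
        cscale (of_real (- S) * of_real ?f) (spinor_up q (l - 1/2) (m - 1/2) n)"
      unfolding clinear_onD(1)[OF lin cfun.span_scale[OF basis[OF sp(3)]] up_span[OF S0]]
        D_down[OF psi_index_spinor_index(2)[OF mem]] D_up[OF S0] ..
    also have "\<dots> = cscale (of_real (C * C * ?g + S * S * ?f)) (ket ((l, m, n), - 1/2)) +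
        cscale (of_real (C * S * (?g - ?f))) (ket ((l, m - 1, n), 1/2))"
      using spinor_down_ket[OF q, of l "m - 1" n] spinor_up_ket[OF q, of l "m - 1" n]
      by (simp add: fun_eq_iff cscale_def flip: C_def S_def) (simp add: algebra_simps)
    also have "C * C * ?g + S * S * ?f = ?d 0 ((l, m, n), s)"
      by (simp add: CS dirac_coeff_def s) (simp add: algebra_simps)
    also have "C * S * (?g - ?f) = ?d (- spin_flip) ((l, m, n), s)"
      using spin_flip_simps by (simp add: CS dirac_coeff_def s)
    finally show ?thesis
      unfolding expand wshift_ket
      using spin_flip_simps by (simp add: s dirac_coeff_def[of _ _ _ _ _ "spin_flip"]) (simp add: spin_flip_def fun_eq_iff)
  qed
  then show "D x = (\<Sum>\<delta>\<in>spin_steps. wshift \<delta> (?d \<delta>) x)"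
    unfolding x .
qed

section \<open>Representations of the algebra\<close>

text \<open>\<open>amplify\<close> works slice by slice; identities known only on the algebraic span
  can be lifted because slices stay in it.\<close>

lemma ket_span_slice:
  assumes "v \<in> cspan (ket ` (I \<times> J))"
  shows "(\<lambda>k. v (k, s)) \<in> cspan (ket ` I)"
  using assms
proof (induction v rule: cfun.span_induct_alt)
  case base
  have "(\<lambda>k. (0 :: 'a \<times> 'b \<Rightarrow> complex) (k, s)) = 0"
    by (simp add: fun_eq_iff)
  then show ?case by (metis cfun.span_zero)
next
  case (step c x y)
  then obtain i t where i: "i \<in> I" "x = ket (i, t)" by auto
  have "(\<lambda>k. (cscale c x + y) (k, s)) = cscale (if s = t then c else 0) (ket i) + (\<lambda>k. y (k, s))"
    by (auto simp: i fun_eq_iff cscale_def ket_def)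
  also have "\<dots> \<in> cspan (ket ` I)"
    using i step by (intro cfun.span_add cfun.span_scale) (auto intro: cfun.span_base)
  finally show ?case .
qed

lemma amplify_wshift: "amplify (wshift \<tau> \<alpha>) v = wshift (\<tau>, 0) (\<lambda>k. \<alpha> (fst k)) v"
  by (auto simp: amplify_def wshift_def fun_eq_iff)

lemma amplify_cong:
  assumes "\<And>w. w \<in> cspan (ket ` I) \<Longrightarrow> S w = T w" and "v \<in> cspan (ket ` (I \<times> J))"
  shows "amplify S v = amplify T v"
  using assms(1)[OF ket_span_slice[OF assms(2)]] by (auto simp: amplify_def fun_eq_iff)

lemma star_repD:
  assumes "star_rep A I \<pi>"
  shows "x \<in> carrier A \<Longrightarrow> bounded_op I (\<pi> x)"
    and "f \<in> ell2 I \<Longrightarrow> \<pi> \<one>\<^bsub>A\<^esub> f = f"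
    and "x \<in> carrier A \<Longrightarrow> y \<in> carrier A \<Longrightarrow> f \<in> ell2 I \<Longrightarrow> \<pi> (x \<oplus>\<^bsub>A\<^esub> y) f = \<pi> x f + \<pi> y f"
    and "x \<in> carrier A \<Longrightarrow> f \<in> ell2 I \<Longrightarrow> \<pi> (c \<odot>\<^bsub>A\<^esub> x) f = cscale c (\<pi> x f)"
    and "x \<in> carrier A \<Longrightarrow> y \<in> carrier A \<Longrightarrow> f \<in> ell2 I \<Longrightarrow> \<pi> (x \<otimes>\<^bsub>A\<^esub> y) f = \<pi> x (\<pi> y f)"
    and "x \<in> carrier A \<Longrightarrow> f \<in> ell2 I \<Longrightarrow> g \<in> ell2 I \<Longrightarrow>
      l2inner I (\<pi> (star A x) f) g = l2inner I f (\<pi> x g)"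
  using assms unfolding star_rep_def by blast+

text \<open>Nothing is assumed about the star of x on kets. Its matrix is recovered from that of x
  by the adjoint relation, which reverses both shifts; linearity then extends both formulas from
  kets to the span.\<close>

lemma regular_generator:
  fixes \<tau> \<sigma> :: "real \<times> real \<times> real"
  assumes rep: "star_rep (SUq2 q) psi_index \<pi>" and x: "x \<in> carrier (SUq2 q)"
    and ket: "\<And>k. k \<in> psi_index \<Longrightarrow> \<pi> x (ket k) = wshift \<tau> \<alpha> (ket k) + wshift \<sigma> \<beta> (ket k)"
    and van: "\<And>k. k \<notin> psi_index \<Longrightarrow> k + \<tau> \<in> psi_index \<Longrightarrow> \<alpha> k = 0"
      "\<And>k. k \<notin> psi_index \<Longrightarrow> k + \<sigma> \<in> psi_index \<Longrightarrow> \<beta> k = 0"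
    and D: "clinear_on (cspan (ket ` spinor_index)) D" "D \<in> cspan (ket ` spinor_index) \<rightarrow> cspan (ket ` spinor_index)"
    and reg: "regular_wrt spinor_index D (wshift (\<tau>, 0) (\<lambda>k. \<alpha> (fst k)))"
      "regular_wrt spinor_index D (wshift (\<sigma>, 0) (\<lambda>k. \<beta> (fst k)))"
      "regular_wrt spinor_index D (wshift (- (\<tau>, 0)) (\<lambda>k. \<alpha> (fst (k - (\<tau>, 0)))))"
      "regular_wrt spinor_index D (wshift (- (\<sigma>, 0)) (\<lambda>k. \<beta> (fst (k - (\<sigma>, 0)))))"
  shows "regular_wrt spinor_index D (amplify (\<pi> x))"
    and "regular_wrt spinor_index D (amplify (\<pi> (star (SUq2 q) x)))"
proof -
  have star_closed: "star (SUq2 q) x \<in> carrier (SUq2 q)"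
    using x by (auto simp: SUq2_ops)
  have lin: "clinear_on (cspan (ket ` psi_index)) (\<pi> y)" if "y \<in> carrier (SUq2 q)" for y
    using star_repD(1)[OF rep that] by (intro bounded_ext_linear) (auto simp: bounded_ext_def)
  have shift_lin: "clinear_on V (\<lambda>v. wshift \<tau>' \<alpha>' v + wshift \<sigma>' \<beta>' v)"
    for V :: "(real \<times> real \<times> real \<Rightarrow> complex) set" and \<tau>' \<alpha>' \<sigma>' \<beta>'
    by (simp add: clinear_on_def fun_eq_iff wshift_def cscale_def algebra_simps)
  have main: "regular_wrt spinor_index D (amplify (\<pi> y))"
    if y: "y \<in> carrier (SUq2 q)"
      and kets: "\<And>k. k \<in> psi_index \<Longrightarrow> \<pi> y (ket k) = wshift \<tau>' \<alpha>' (ket k) + wshift \<sigma>' \<beta>' (ket k)"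
      and r: "regular_wrt spinor_index D (wshift (\<tau>', 0) (\<lambda>k. \<alpha>' (fst k)))"
        "regular_wrt spinor_index D (wshift (\<sigma>', 0) (\<lambda>k. \<beta>' (fst k)))" for y \<tau>' \<alpha>' \<sigma>' \<beta>'
  proof -
    have span: "\<pi> y w = wshift \<tau>' \<alpha>' w + wshift \<sigma>' \<beta>' w" if "w \<in> cspan (ket ` psi_index)" for w
      using kets by (intro clinear_on_span_eq[OF lin[OF y] shift_lin _ that]) auto
    have "amplify (\<pi> y) v = wshift (\<tau>', 0) (\<lambda>k. \<alpha>' (fst k)) v + wshift (\<sigma>', 0) (\<lambda>k. \<beta>' (fst k)) v"
      if "v \<in> cspan (ket ` spinor_index)" for v
    proof -
      have "amplify (\<pi> y) v = amplify (\<lambda>w. wshift \<tau>' \<alpha>' w + wshift \<sigma>' \<beta>' w) v"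
        using that unfolding spinor_index_def by (intro amplify_cong[OF span])
      also have "\<dots> = amplify (wshift \<tau>' \<alpha>') v + amplify (wshift \<sigma>' \<beta>') v"
        by (auto simp: amplify_def fun_eq_iff)
      finally show ?thesis by (simp only: amplify_wshift)
    qed
    then show ?thesis
      using regular_wrt_add[OF D r] by (subst regular_wrt_cong[OF _ D(2)]) auto
  qed
  show "regular_wrt spinor_index D (amplify (\<pi> x))"
    by (rule main[OF x ket reg(1,2)])
  have adj: "\<pi> (star (SUq2 q) x) (ket k) =
      wshift (- \<tau>) (\<lambda>k. \<alpha> (k - \<tau>)) (ket k) + wshift (- \<sigma>) (\<lambda>k. \<beta> (k - \<sigma>)) (ket k)" (is "?f = ?g")
    if k: "k \<in> psi_index" for k
  proof
    fix i
    show "?f i = ?g i"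
    proof (cases "i \<in> psi_index")
      case True
      \<comment> \<open>Matrix entries are read off by pairing with kets; the coefficients are real,
        so conjugate transposition is mere transposition.\<close>
      have "cnj (?f i) = l2inner psi_index ?f (ket i)"
        by (simp add: l2inner_ket_right[OF True])
      also have "\<dots> = l2inner psi_index (ket k) (\<pi> x (ket i))"
        by (rule star_repD(6)[OF rep x ket_in_ell2[OF k] ket_in_ell2[OF True]])
      also have "\<dots> = \<pi> x (ket i) k"
        by (rule l2inner_ket_left[OF k])
      finally have "cnj (cnj (?f i)) = cnj (\<pi> x (ket i) k)"
        by (rule arg_cong)
      then have "?f i = cnj (\<pi> x (ket i) k)"
        by simp
      then show ?thesis
        unfolding ket[OF True] by (auto simp: wshift_def ket_def algebra_simps)
    next
      \<comment> \<open>Outside the index set the left side vanishes because it lies in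
        \<open>ell2 psi_index\<close>. The right side vanishes because the coefficients are 0 on
        steps that enter the index set from outside.\<close>
      case False
      have "?f \<in> ell2 psi_index"
        by (rule bounded_opD(1)[OF star_repD(1)[OF rep star_closed] ket_in_ell2[OF k]])
      then have "?f i = 0"
        using False unfolding ell2_def by blast
      moreover have "wshift (- \<tau>) (\<lambda>k. \<alpha> (k - \<tau>)) (ket k) i = 0"
        using van(1)[OF False] k by (auto simp: wshift_def ket_def)
      moreover have "wshift (- \<sigma>) (\<lambda>k. \<beta> (k - \<sigma>)) (ket k) i = 0"
        using van(2)[OF False] k by (auto simp: wshift_def ket_def)
      ultimately show ?thesis by simp
    qed
  qed
  show "regular_wrt spinor_index D (amplify (\<pi> (star (SUq2 q) x)))"
    by (rule main[OF star_closed adj]) (use reg(3,4) in \<open>simp_all add: uminus_prod_def\<close>)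
qed

context
  fixes q fc f0 hc h0 :: real and D :: "((real \<times> real \<times> real) \<times> real \<Rightarrow> complex) \<Rightarrow> ((real \<times> real \<times> real) \<times> real \<Rightarrow> complex)"
  assumes q: "0 < q" "q < 1"
    and D: "\<And>v. v \<in> cspan (ket ` spinor_index) \<Longrightarrow> D v = (\<Sum>\<delta>\<in>spin_steps. wshift \<delta> (dirac_coeff q fc f0 hc h0 \<delta>) v)"
begin

text \<open>The first vanishing condition keeps the shift inside the span, the second does so for
  its transpose.\<close>

lemma regular_shift:
  assumes van: "\<And>l m n. (l, m, n) \<in> psi_index \<Longrightarrow> (l + \<epsilon>, m + 1/2, n + \<nu>) \<notin> psi_index \<Longrightarrow> a l m n = 0"
      "\<And>l m n. (l, m, n) \<notin> psi_index \<Longrightarrow> (l + \<epsilon>, m + 1/2, n + \<nu>) \<in> psi_index \<Longrightarrow> a l m n = 0"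
    and M: "\<And>l m n. (l, m, n) \<in> psi_index \<Longrightarrow> (l + \<epsilon>, m + 1/2, n + \<nu>) \<in> psi_index \<Longrightarrow> \<bar>a l m n\<bar> \<le> M"
    and N: "\<And>\<delta>. \<delta> \<in> spin_steps \<Longrightarrow> \<exists>N. \<forall>k\<in>spinor_index. k + ((\<epsilon>, 1/2, \<nu>), 0) + \<delta> \<in> spinor_index \<longrightarrow>
      \<bar>dirac_coeff q fc f0 hc h0 \<delta> (k + ((\<epsilon>, 1/2, \<nu>), 0)) * spin_free a k - spin_free a (k + \<delta>) * dirac_coeff q fc f0 hc h0 \<delta> k\<bar> \<le> N"
  shows "regular_wrt spinor_index D (wshift ((\<epsilon>, 1/2, \<nu>), 0) (spin_free a))"
    and "regular_wrt spinor_index D (wshift (- ((\<epsilon>, 1/2, \<nu>), 0)) (\<lambda>k. spin_free a (k - ((\<epsilon>, 1/2, \<nu>), 0))))"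
proof -
  have van1: "spin_free a k = 0" if "k \<in> spinor_index" "k + ((\<epsilon>, 1/2, \<nu>), 0) \<notin> spinor_index" for k
    using that van(1) by (auto simp: spinor_index_def spin_free_def)
  have van2: "spin_free a k = 0" if "k \<notin> spinor_index" "k + ((\<epsilon>, 1/2, \<nu>), 0) \<in> spinor_index" for k
    using that van(2) by (cases k) (auto simp: spinor_index_def spin_free_def)
  have bd: "\<bar>spin_free a k\<bar> \<le> M" if "k \<in> spinor_index" "k + ((\<epsilon>, 1/2, \<nu>), 0) \<in> spinor_index" for k
    using that M by (auto simp: spinor_index_def spin_free_def)
  show "regular_wrt spinor_index D (wshift ((\<epsilon>, 1/2, \<nu>), 0) (spin_free a))"
    by (rule regular_wrt_wshift[OF finite_spin_steps D dirac_coeff_boundary[OF q] van1 bd N])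
  show "regular_wrt spinor_index D (wshift (- ((\<epsilon>, 1/2, \<nu>), 0)) (\<lambda>k. spin_free a (k - ((\<epsilon>, 1/2, \<nu>), 0))))"
    by (rule regular_wrt_wshift_adjoint[OF finite_spin_steps D dirac_coeff_boundary[OF q]
          uminus_spin_steps dirac_coeff_sym van2 bd N])
qed

text \<open>A raising step never leaves the index set, so vanishing has to be checked only for steps
  that enter it.\<close>

lemma regular_shift_plus:
  assumes a: "\<And>l m n. a l m n = \<alpha> l n * sqrt (qcomp q (l + m + 1))"
    and \<alpha>: "\<And>l m n. (l, m, n) \<in> psi_index \<Longrightarrow> \<bar>\<alpha> l n\<bar> \<le> inverse (1 - q\<^sup>2)"
    and van: "\<And>l m n. (l, m, n) \<in> psi_index \<Longrightarrow> (l + 1/2, m + 1/2, n + \<nu>) \<in> psi_index"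
      "\<And>l m n. (l, m, n) \<notin> psi_index \<Longrightarrow> (l + 1/2, m + 1/2, n + \<nu>) \<in> psi_index \<Longrightarrow> a l m n = 0"
  shows "regular_wrt spinor_index D (wshift ((1/2, 1/2, \<nu>), 0) (spin_free a))"
    and "regular_wrt spinor_index D (wshift (- ((1/2, 1/2, \<nu>), 0)) (\<lambda>k. spin_free a (k - ((1/2, 1/2, \<nu>), 0))))"
proof -
  have "\<bar>a l m n\<bar> \<le> inverse (1 - q\<^sup>2)" if "(l, m, n) \<in> psi_index" for l m n
  proof -
    have "\<bar>sqrt (qcomp q (l + m + 1))\<bar> \<le> 1"
      using psi_indexD[OF that] sqrt_qcomp_le_one[OF q] qcomp_nonneg[OF q, of "l + m + 1"] by simp
    then have "\<bar>\<alpha> l n\<bar> * \<bar>sqrt (qcomp q (l + m + 1))\<bar> \<le> inverse (1 - q\<^sup>2) * 1"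
      using \<alpha>[OF that] one_minus_q2_pos[OF q] by (intro mult_mono) auto
    then show ?thesis by (simp add: a abs_mult)
  qed
  note r = regular_shift[where \<epsilon> = "1/2" and a = a and \<nu> = \<nu>, OF _ van(2) this dirac_commutator_bounded_plus[OF q a \<alpha>]]
  show "regular_wrt spinor_index D (wshift ((1/2, 1/2, \<nu>), 0) (spin_free a))"
    by (rule r; (assumption | (drule van(1), erule (1) notE)))
  show "regular_wrt spinor_index D (wshift (- ((1/2, 1/2, \<nu>), 0)) (\<lambda>k. spin_free a (k - ((1/2, 1/2, \<nu>), 0))))"
    by (rule r; (assumption | (drule van(1), erule (1) notE)))
qed

text \<open>The mirror image of the raising case: a lowering step never enters the index set from
  outside, so only steps that leave it have to be checked.\<close>

lemma regular_shift_minus: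
  assumes a: "\<And>l m n. a l m n = \<alpha> l n * (q powr (l + m) * sqrt (qcomp q (l - m)))"
    and \<alpha>: "\<And>l m n. (l, m, n) \<in> psi_index \<Longrightarrow> 1/2 \<le> l \<Longrightarrow> \<bar>\<alpha> l n\<bar> \<le> inverse (1 - q\<^sup>2)"
    and van: "\<And>l m n. (l, m, n) \<in> psi_index \<Longrightarrow> (l + - 1/2, m + 1/2, n + \<nu>) \<notin> psi_index \<Longrightarrow> a l m n = 0"
      "\<And>l m n. (l + - 1/2, m + 1/2, n + \<nu>) \<in> psi_index \<Longrightarrow> (l, m, n) \<in> psi_index"
  shows "regular_wrt spinor_index D (wshift ((- 1/2, 1/2, \<nu>), 0) (spin_free a))"
    and "regular_wrt spinor_index D (wshift (- ((- 1/2, 1/2, \<nu>), 0)) (\<lambda>k. spin_free a (k - ((- 1/2, 1/2, \<nu>), 0))))"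
proof -
  have "\<bar>a l m n\<bar> \<le> inverse (1 - q\<^sup>2)"
    if "(l, m, n) \<in> psi_index" "(l + - 1/2, m + 1/2, n + \<nu>) \<in> psi_index" for l m n
  proof -
    note b = psi_indexD[OF that(1)] psi_indexD[OF that(2)]
    have "\<bar>sqrt (qcomp q (l - m))\<bar> \<le> 1"
      using b sqrt_qcomp_le_one[OF q] qcomp_nonneg[OF q, of "l - m"] by simp
    moreover have "q powr (l + m) \<le> 1"
      using b q_powr_le[OF q, of 0 "l + m"] q by simp
    ultimately have "q powr (l + m) * \<bar>sqrt (qcomp q (l - m))\<bar> \<le> 1 * 1"
      by (intro mult_mono) auto
    then have "\<bar>\<alpha> l n\<bar> * (q powr (l + m) * \<bar>sqrt (qcomp q (l - m))\<bar>) \<le> inverse (1 - q\<^sup>2) * 1"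
      using \<alpha>[OF that(1)] b one_minus_q2_pos[OF q] by (intro mult_mono) auto
    then show ?thesis by (simp add: a abs_mult)
  qed
  note r = regular_shift[where \<epsilon> = "- 1/2" and a = a and \<nu> = \<nu>, OF van(1) _ this dirac_commutator_bounded_minus[OF q a \<alpha>]]
  show "regular_wrt spinor_index D (wshift ((- 1/2, 1/2, \<nu>), 0) (spin_free a))"
    by (rule r; (assumption | (drule van(2), erule (1) notE)))
  show "regular_wrt spinor_index D (wshift (- ((- 1/2, 1/2, \<nu>), 0)) (\<lambda>k. spin_free a (k - ((- 1/2, 1/2, \<nu>), 0))))"
    by (rule r; (assumption | (drule van(2), erule (1) notE)))
qed

section \<open>The four coefficients of the generators and their transposes\<close>

lemma regular_A_plus:
  "regular_wrt spinor_index D (wshift ((1/2, 1/2, 1/2), 0) (spin_free (A_plus q)))"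
  "regular_wrt spinor_index D (wshift (- ((1/2, 1/2, 1/2), 0)) (\<lambda>k. spin_free (A_plus q) (k - ((1/2, 1/2, 1/2), 0))))"
proof -
  have \<alpha>: "\<bar>sqrt (qcomp q (l + n + 1) / (qcomp q (2 * l + 1) * qcomp q (2 * l + 2)))\<bar> \<le> inverse (1 - q\<^sup>2)"
    if "(l, m, n) \<in> psi_index" for l m n
    using psi_indexD[OF that] sqrt_qcomp_ratio_le[OF q, of "l + n + 1" "2 * l + 1" "2 * l + 2"]
    by (simp add: divide_inverse)
  note r = regular_shift_plus[where \<nu> = "1/2" and a = "A_plus q" and
      \<alpha> = "\<lambda>l n. sqrt (qcomp q (l + n + 1) / (qcomp q (2 * l + 1) * qcomp q (2 * l + 2)))", OF A_plus_eq[OF q] \<alpha> _ A_plus_boundary[OF q]]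
  show "regular_wrt spinor_index D (wshift ((1/2, 1/2, 1/2), 0) (spin_free (A_plus q)))"
    "regular_wrt spinor_index D (wshift (- ((1/2, 1/2, 1/2), 0)) (\<lambda>k. spin_free (A_plus q) (k - ((1/2, 1/2, 1/2), 0))))"
    by (rule r; auto dest: psi_index_up(1))+
qed

lemma regular_A_minus:
  "regular_wrt spinor_index D (wshift ((- 1/2, 1/2, 1/2), 0) (spin_free (A_minus q)))"
  "regular_wrt spinor_index D (wshift (- ((- 1/2, 1/2, 1/2), 0)) (\<lambda>k. spin_free (A_minus q) (k - ((- 1/2, 1/2, 1/2), 0))))"
proof -
  have van: "A_minus q l m n = 0" if "(l, m, n) \<in> psi_index" "(l + - 1/2, m + 1/2, n + 1/2) \<notin> psi_index" for l m n
  proof -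
    have "m = l \<or> n = l"
      using psi_index_down(1)[OF that(1)] that(2) by auto
    then show ?thesis by (auto simp: A_minus_eq[OF q] qcomp_zero[OF q])
  qed
  have \<alpha>: "\<bar>q powr (l + n + 1) * sqrt (qcomp q (l - n) / (qcomp q (2 * l) * qcomp q (2 * l + 1)))\<bar> \<le> inverse (1 - q\<^sup>2)"
    if "(l, m, n) \<in> psi_index" "1/2 \<le> l" for l m n
    using psi_indexD[OF that(1)] that(2) by (intro damped_ratio_le[OF q]) auto
  note r = regular_shift_minus[where \<nu> = "1/2" and a = "A_minus q" and
      \<alpha> = "\<lambda>l n. q powr (l + n + 1) * sqrt (qcomp q (l - n) / (qcomp q (2 * l) * qcomp q (2 * l + 1)))", OF A_minus_eq[OF q] \<alpha> van]
  show "regular_wrt spinor_index D (wshift ((- 1/2, 1/2, 1/2), 0) (spin_free (A_minus q)))"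
    "regular_wrt spinor_index D (wshift (- ((- 1/2, 1/2, 1/2), 0)) (\<lambda>k. spin_free (A_minus q) (k - ((- 1/2, 1/2, 1/2), 0))))"
    by (rule r; auto dest: psi_index_down_converse(1))+
qed

lemma regular_B_plus:
  "regular_wrt spinor_index D (wshift ((1/2, 1/2, - 1/2), 0) (spin_free (B_plus q)))"
  "regular_wrt spinor_index D (wshift (- ((1/2, 1/2, - 1/2), 0)) (\<lambda>k. spin_free (B_plus q) (k - ((1/2, 1/2, - 1/2), 0))))"
proof -
  have \<alpha>: "\<bar>q powr (l + n) * sqrt (qcomp q (l - n + 1) / (qcomp q (2 * l + 1) * qcomp q (2 * l + 2)))\<bar> \<le> inverse (1 - q\<^sup>2)"
    if "(l, m, n) \<in> psi_index" for l m n
    using psi_indexD[OF that(1)] by (intro damped_ratio_le[OF q]) auto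
  note r = regular_shift_plus[where \<nu> = "- 1/2" and a = "B_plus q" and
      \<alpha> = "\<lambda>l n. q powr (l + n) * sqrt (qcomp q (l - n + 1) / (qcomp q (2 * l + 1) * qcomp q (2 * l + 2)))", OF B_plus_eq[OF q] \<alpha> _ B_plus_boundary[OF q]]
  show "regular_wrt spinor_index D (wshift ((1/2, 1/2, - 1/2), 0) (spin_free (B_plus q)))"
    "regular_wrt spinor_index D (wshift (- ((1/2, 1/2, - 1/2), 0)) (\<lambda>k. spin_free (B_plus q) (k - ((1/2, 1/2, - 1/2), 0))))"
    by (rule r; auto dest: psi_index_up(2))+
qed

lemma regular_B_minus:
  "regular_wrt spinor_index D (wshift ((- 1/2, 1/2, - 1/2), 0) (spin_free (B_minus q)))"
  "regular_wrt spinor_index D (wshift (- ((- 1/2, 1/2, - 1/2), 0)) (\<lambda>k. spin_free (B_minus q) (k - ((- 1/2, 1/2, - 1/2), 0))))"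
proof -
  have van: "B_minus q l m n = 0" if "(l, m, n) \<in> psi_index" "(l + - 1/2, m + 1/2, n + - 1/2) \<notin> psi_index" for l m n
  proof -
    have "m = l \<or> n = - l"
      using psi_index_down(2)[OF that(1)] that(2) by auto
    then show ?thesis by (auto simp: B_minus_eq[OF q] qcomp_zero[OF q])
  qed
  have \<alpha>: "\<bar>- sqrt (qcomp q (l + n) / (qcomp q (2 * l) * qcomp q (2 * l + 1)))\<bar> \<le> inverse (1 - q\<^sup>2)"
    if "(l, m, n) \<in> psi_index" "1/2 \<le> l" for l m n
  proof -
    have "0 \<le> l + n" "1 \<le> 2 * l" "1 \<le> 2 * l + 1"
      using psi_indexD[OF that(1)] that(2) by auto
    then show ?thesis
      using sqrt_qcomp_ratio_le[OF q] by (simp only: abs_minus_cancel inverse_eq_divide)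
  qed
  note r = regular_shift_minus[where \<nu> = "- 1/2" and a = "B_minus q" and
      \<alpha> = "\<lambda>l n. - sqrt (qcomp q (l + n) / (qcomp q (2 * l) * qcomp q (2 * l + 1)))", OF B_minus_eq[OF q] \<alpha> van]
  show "regular_wrt spinor_index D (wshift ((- 1/2, 1/2, - 1/2), 0) (spin_free (B_minus q)))"
    "regular_wrt spinor_index D (wshift (- ((- 1/2, 1/2, - 1/2), 0)) (\<lambda>k. spin_free (B_minus q) (k - ((- 1/2, 1/2, - 1/2), 0))))"
    by (rule r; auto dest: psi_index_down_converse(2))+
qed

end

section \<open>From the generators to the whole algebra\<close>

lemma suq2_star_zero: "suq2_eq q (Star Zero) Zero"
proof -
  note suq2_eq.trans [trans]
  \<comment> \<open>Zero is written in the form y + (-1) y, because the congruence has rules for the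
    star of sums and multiples but none for the star of zero; -1 is its own conjugate.\<close>
  have "suq2_eq q Zero (Add Zero (Scale (- 1) Zero))"
    by (rule suq2_eq.sym[OF suq2_eq.add_inverse])
  then have "suq2_eq q (Star Zero) (Star (Add Zero (Scale (- 1) Zero)))"
    by (rule suq2_eq.Star_cong)
  also have "suq2_eq q \<dots> (Add (Star Zero) (Star (Scale (- 1) Zero)))"
    by (rule suq2_eq.star_add)
  also have "suq2_eq q \<dots> (Add (Star Zero) (Scale (- 1) (Star Zero)))"
    using suq2_eq.star_scale[of q "- 1" Zero] by (intro suq2_eq.Add_cong suq2_eq.refl) simp
  also have "suq2_eq q \<dots> Zero"
    by (rule suq2_eq.add_inverse)
  finally show ?thesis .
qed

text \<open>The star of One is a product whose left factor One is replaced by its double star, so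
  that reversing the product makes it the star of One times the star of One. The unit law then
  leaves a double star.\<close>

lemma suq2_star_one: "suq2_eq q (Star One) One"
proof -
  note suq2_eq.trans [trans]
  have "suq2_eq q (Star One) (Mult One (Star One))"
    by (rule suq2_eq.sym[OF suq2_eq.mult_one_left])
  also have "suq2_eq q \<dots> (Mult (Star (Star One)) (Star One))"
    by (intro suq2_eq.Mult_cong suq2_eq.refl suq2_eq.sym[OF suq2_eq.star_star])
  also have "suq2_eq q \<dots> (Star (Mult One (Star One)))"
    by (rule suq2_eq.sym[OF suq2_eq.star_mult])
  also have "suq2_eq q \<dots> (Star (Star One))"
    by (intro suq2_eq.Star_cong suq2_eq.mult_one_left)
  also have "suq2_eq q \<dots> One"
    by (rule suq2_eq.star_star)
  finally show ?thesis .
qed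

lemma regular_algebra:
  assumes rep: "star_rep (SUq2 q) psi_index \<pi>"
    and D: "clinear_on (cspan (ket ` spinor_index)) D" "D \<in> cspan (ket ` spinor_index) \<rightarrow> cspan (ket ` spinor_index)"
    and gen: "\<And>g. g \<in> {Gen_a, Gen_b} \<Longrightarrow> regular_wrt spinor_index D (amplify (\<pi> (suq2_class q g)))"
      "\<And>g. g \<in> {Gen_a, Gen_b} \<Longrightarrow> regular_wrt spinor_index D (amplify (\<pi> (suq2_class q (Star g))))"
  shows "regular_wrt spinor_index D (amplify (\<pi> (suq2_class q t)))"
proof -
  let ?R = "\<lambda>t. regular_wrt spinor_index D (amplify (\<pi> (suq2_class q t)))"
  have mem: "suq2_class q t \<in> carrier (SUq2 q)" for t
    by (simp add: SUq2_ops)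
  have slice: "(\<lambda>k. v (k, s)) \<in> ell2 psi_index" if "v \<in> cspan (ket ` spinor_index)" for v s
    using ket_span_slice[of v psi_index] that ket_span_subset_ell2[of psi_index] by (auto simp: spinor_index_def)
  note cong = regular_wrt_cong[OF _ D(2)]
  have add: "?R (Add x y)" if "?R x" "?R y" for x y
  proof -
    have "amplify (\<pi> (suq2_class q (Add x y))) v = amplify (\<pi> (suq2_class q x)) v + amplify (\<pi> (suq2_class q y)) v"
      if "v \<in> cspan (ket ` spinor_index)" for v
      using star_repD(3)[OF rep mem[of x] mem[of y] slice[OF that]] by (auto simp: amplify_def fun_eq_iff SUq2_ops)
    then show ?thesis
      using regular_wrt_add[OF D that] by (subst cong) auto
  qed
  have scale: "?R (Scale c x)" if "?R x" for c x
  proof -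
    have "amplify (\<pi> (suq2_class q (Scale c x))) v = cscale c (amplify (\<pi> (suq2_class q x)) v)"
      if "v \<in> cspan (ket ` spinor_index)" for v
      using star_repD(4)[OF rep mem[of x] slice[OF that], of c] by (auto simp: amplify_def cscale_def fun_eq_iff SUq2_ops)
    then show ?thesis
      using regular_wrt_scale[OF D that] by (subst cong) auto
  qed
  have mult: "?R (Mult x y)" if "?R x" "?R y" for x y
  proof -
    have "amplify (\<pi> (suq2_class q (Mult x y))) v = amplify (\<pi> (suq2_class q x)) (amplify (\<pi> (suq2_class q y)) v)"
      if "v \<in> cspan (ket ` spinor_index)" for v
      using star_repD(5)[OF rep mem[of x] mem[of y] slice[OF that]] by (auto simp: amplify_def fun_eq_iff SUq2_ops)
    then show ?thesis
      using regular_wrt_comp[OF D that] by (subst cong) auto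
  qed
  have one: "?R One"
  proof -
    have "amplify (\<pi> (suq2_class q One)) v = v" if "v \<in> cspan (ket ` spinor_index)" for v
      using star_repD(2)[OF rep slice[OF that]] by (auto simp: amplify_def fun_eq_iff SUq2_ops)
    then show ?thesis
      using regular_wrt_id[OF D(2)] by (subst cong) auto
  qed
  have cls: "?R x \<longleftrightarrow> ?R y" if "suq2_eq q x y" for x y
    using that by (simp flip: suq2_class_eq_iff)
  \<comment> \<open>Zero is reached as One + (-1) One, since \<open>star_rep\<close> prescribes no
    value at zero.\<close>
  have zero: "?R Zero"
    using add[OF one scale[OF one]] cls[OF suq2_eq.add_inverse] by blast
  \<comment> \<open>Regularity of a term and of its star are proved together: the star of a product
    involves the stars of the factors, and the case of a star exchanges the two statements.\<close>
  have "?R t \<and> ?R (Star t)"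
  proof (induction t)
    case Zero
    then show ?case using zero cls[OF suq2_star_zero] by simp
  next
    case One
    then show ?case using one cls[OF suq2_star_one] by simp
  next
    case (Add x y)
    then show ?case using add cls[OF suq2_eq.star_add] by blast
  next
    case (Scale c x)
    then show ?case using scale cls[OF suq2_eq.star_scale] by blast
  next
    case (Mult x y)
    then show ?case using mult cls[OF suq2_eq.star_mult] by blast
  next
    case (Star x)
    then show ?case using cls[OF suq2_eq.star_star] by blast
  qed (use gen in auto)
  then show ?thesis ..
qed

theorem proposition5p2:
  fixes q c1_up c2_up c1_down c2_down :: real
    and d_up d_down :: "real \<Rightarrow> real"
    and \<pi> :: "suq2_term set \<Rightarrow> (real \<times> real \<times> real \<Rightarrow> complex) \<Rightarrow> (real \<times> real \<times> real \<Rightarrow> complex)"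
    and domD :: "((real \<times> real \<times> real) \<times> real \<Rightarrow> complex) set"
    and D :: "((real \<times> real \<times> real) \<times> real \<Rightarrow> complex) \<Rightarrow> ((real \<times> real \<times> real) \<times> real \<Rightarrow> complex)"
  assumes "0 < q" and "q < 1"
    and "left_regular_rep q \<pi>"
    and "selfadjoint spinor_index domD D"
    and "\<And>j \<mu> n. (j, \<mu>, n) \<in> up_index \<Longrightarrow>
           spinor_up q j \<mu> n \<in> domD \<and>
           D (spinor_up q j \<mu> n) = cscale (of_real (d_up j)) (spinor_up q j \<mu> n)"
    and "\<And>j \<mu> n. (j, \<mu>, n) \<in> down_index \<Longrightarrow>
           spinor_down q j \<mu> n \<in> domD \<and>
           D (spinor_down q j \<mu> n) = cscale (of_real (d_down j)) (spinor_down q j \<mu> n)"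
    and "\<And>j. j \<in> half_nats \<Longrightarrow> d_up j = c1_up * j + c2_up"
    and "\<And>j. j \<in> half_nats - {0} \<Longrightarrow> d_down j = c1_down * j + c2_down"
  shows "\<forall>x\<in>carrier (SUq2 q).
           bounded_commutator spinor_index (spinor_basis q) domD D (amplify (\<pi> x))"
proof
  note q = assms(1,2)
  let ?V = "cspan (ket ` spinor_index)"
  have rep: "star_rep (SUq2 q) psi_index \<pi>"
    and gens: "\<And>l m n. (l, m, n) \<in> psi_index \<Longrightarrow>
        \<pi> (suq2_class q Gen_a) (ket (l, m, n)) =
          cscale (of_real (A_plus q l m n)) (ket (l + 1/2, m + 1/2, n + 1/2)) +
          cscale (of_real (A_minus q l m n)) (ket (l - 1/2, m + 1/2, n + 1/2)) \<and>
        \<pi> (suq2_class q Gen_b) (ket (l, m, n)) =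
          cscale (of_real (B_plus q l m n)) (ket (l + 1/2, m + 1/2, n - 1/2)) +
          cscale (of_real (B_minus q l m n)) (ket (l - 1/2, m + 1/2, n - 1/2))"
    using assms(3) unfolding left_regular_rep_def by blast+
  have domD: "csubspace domD" and lin_domD: "clinear_on domD D"
    using assms(4) by (auto simp: selfadjoint_def)
  have span: "cspan (spinor_basis q) = ?V"
    by (rule span_spinor_basis[OF q])
  have "spinor_basis q \<subseteq> domD"
    using assms(5,6) by (auto simp: spinor_basis_def)
  \<comment> \<open>The domain is a subspace containing the spinor basis, so on the span D is
    applied only where it is defined and linear.\<close>
  then have V_domD: "?V \<subseteq> domD"
    unfolding span[symmetric] by (rule cfun.span_minimal[OF _ domD])
  then have lin: "clinear_on ?V D"
    using lin_domD unfolding clinear_on_def by blast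
  define d where "d = dirac_coeff q c1_up (c2_up - c1_up / 2) (c1_down - c1_up) (c2_down + c1_down / 2 - c2_up + c1_up / 2)"
  have D: "D v = (\<Sum>\<delta>\<in>spin_steps. wshift \<delta> (d \<delta>) v)" if "v \<in> ?V" for v
    unfolding d_def by (rule dirac_on_ket[OF q lin _ _ assms(7,8) that]) (use assms(5,6) in blast)+
  have maps: "D \<in> ?V \<rightarrow> ?V"
  proof
    fix v assume v: "v \<in> ?V"
    show "D v \<in> ?V"
      unfolding D[OF v] d_def
      by (intro cfun.span_sum wshift_ket_span v dirac_coeff_boundary[OF q])
  qed
  note shifts = regular_A_plus[OF q D[unfolded d_def]] regular_A_minus[OF q D[unfolded d_def]]
    regular_B_plus[OF q D[unfolded d_def]] regular_B_minus[OF q D[unfolded d_def]]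
  note shifts = shifts[unfolded spin_free_def]
  have mem: "suq2_class q t \<in> carrier (SUq2 q)" for t
    by (simp add: SUq2_ops)
  have ket_a: "\<pi> (suq2_class q Gen_a) (ket k) =
      wshift (1/2, 1/2, 1/2) (\<lambda>(l, m, n). A_plus q l m n) (ket k) +
      wshift (- 1/2, 1/2, 1/2) (\<lambda>(l, m, n). A_minus q l m n) (ket k)" if "k \<in> psi_index" for k
    using that gens by (cases k) (auto simp: wshift_ket)
  have van_a: "(case k of (l, m, n) \<Rightarrow> A_plus q l m n) = 0"
    if "k \<notin> psi_index" "k + (1/2, 1/2, 1/2) \<in> psi_index" for k
    using that A_plus_boundary[OF q] by (cases k) auto
  have van'_a: "(case k of (l, m, n) \<Rightarrow> A_minus q l m n) = 0"
    if "k \<notin> psi_index" "k + (- 1/2, 1/2, 1/2) \<in> psi_index" for k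
    using that by (cases k) (auto dest: psi_index_down_converse(1))
  \<comment> \<open>The selection pairs the facts as required: raising shift, lowering shift, then
    the transpose of each.\<close>
  note a = regular_generator[where \<tau> = "(1/2, 1/2, 1/2)" and \<sigma> = "(- 1/2, 1/2, 1/2)" and
      \<alpha> = "\<lambda>(l, m, n). A_plus q l m n" and \<beta> = "\<lambda>(l, m, n). A_minus q l m n",
      OF rep mem ket_a van_a van'_a lin maps shifts(1,3,2,4)]
  have ket_b: "\<pi> (suq2_class q Gen_b) (ket k) =
      wshift (1/2, 1/2, - 1/2) (\<lambda>(l, m, n). B_plus q l m n) (ket k) +
      wshift (- 1/2, 1/2, - 1/2) (\<lambda>(l, m, n). B_minus q l m n) (ket k)" if "k \<in> psi_index" for k
    using that gens by (cases k) (auto simp: wshift_ket)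
  have van_b: "(case k of (l, m, n) \<Rightarrow> B_plus q l m n) = 0"
    if "k \<notin> psi_index" "k + (1/2, 1/2, - 1/2) \<in> psi_index" for k
    using that B_plus_boundary[OF q] by (cases k) auto
  have van'_b: "(case k of (l, m, n) \<Rightarrow> B_minus q l m n) = 0"
    if "k \<notin> psi_index" "k + (- 1/2, 1/2, - 1/2) \<in> psi_index" for k
    using that by (cases k) (auto dest: psi_index_down_converse(2))
  note b = regular_generator[where \<tau> = "(1/2, 1/2, - 1/2)" and \<sigma> = "(- 1/2, 1/2, - 1/2)" and
      \<alpha> = "\<lambda>(l, m, n). B_plus q l m n" and \<beta> = "\<lambda>(l, m, n). B_minus q l m n",
      OF rep mem ket_b van_b van'_b lin maps shifts(5,7,6,8)]
  have regular: "regular_wrt spinor_index D (amplify (\<pi> (suq2_class q t)))" for t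
    by (rule regular_algebra[OF rep lin maps]) (use a b in \<open>auto simp: SUq2_ops\<close>)
  show "bounded_commutator spinor_index (spinor_basis q) domD D (amplify (\<pi> x))"
    if carrier: "x \<in> carrier (SUq2 q)" for x
  proof -
    obtain t where x: "x = suq2_class q t"
      using carrier by (auto simp: SUq2_ops)
    show ?thesis
      \<comment> \<open>Since the operator maps the span to itself and the span lies in the domain,
        the commutator is defined there; its bounded extension comes from regularity.\<close>
      unfolding bounded_commutator_def span x
      using regular[of t] V_domD unfolding regular_wrt_def bounded_ext_def by blast
  qed
qed

end
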